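(* For an integer $n\ge 3$ let $n_1=\lfloor n/3\rfloor$, $n_2=n-2n_1$, and $$f(n)=n_1(n_1+1)n_2+\frac{n_2(n_2-1)}{2}+n_1(n_1-1).$$ Let $K(n,d)$ be the supremum, over all initial conditions (positions and velocities), of the number of elastic collisions of $n$ balls of equal radii and equal masses in $\mathbb{R}^d$. Then for all integers $n\ge 3$ and $d\ge 2$, $$K(n,d)\ge f(n).$$
   Context: Dynamics. Consider $n$ balls in $\mathbb{R}^d$, all of radius 1 and identical masses, with pairwise disjoint interiors at all times, evolving over all times $t\in(-\infty,\infty)$. Each ball moves with constant velocity between collisions. If two balls with centers $x(t),y(t)$ touch at time $t$ (i.e. $|x(t)-y(t)|=2$), no other ball touches either of them at time $t$, and the velocities just before satisfy $(Dx(t-)-Dy(t-))\cdot(x(t)-y(t))<0$, then with $\mathbf{x}=x(t)-y(t)$ and $P_w z=(z\cdot w)w/|w|^2$ the velocities just after are $$Dx(t)=Dx(t-)-P_{\mathbf{x}}(D(x-y)(t-)),\qquad Dy(t)=Dy(t-)-P_{\mathbf{x}}(D(y-x)(t-)).$$ Here $D$ denotes the right derivative in time and $t-$ a left limit. A simultaneous collision at time $t$ means that some collection of at least 3 balls is connected via contacts (tangencies) at time $t$. Only evolutions without simultaneous collisions are considered (contacts of disjoint pairs of balls at the same time are allowed). Collisions. A collision of two balls at a space-time point $(y,t)$ is counted if and only if: (i) the two balls are tangent at $y$ at time $t$; (ii) for some $\varepsilon>0$ the two balls do not touch during $(t-\varepsilon,t)$ and $(t,t+\varepsilon)$; (iii)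 both balls change velocity at time $t$. (In particular grazing contacts are not counted.) $K(n,d)$ is the supremum of the total number of collisions during $(-\infty,\infty)$ over all such evolutions. *)

theory Defs
  imports "HOL-Analysis.Analysis"
begin

text \<open>
  A motion of \<open>n\<close> balls is given by \<open>x :: nat \<Rightarrow> real \<Rightarrow> 'a\<close>, where \<open>x i t\<close> is the centre at time \<open>t\<close>
  of ball number \<open>i < n\<close>; values at indices \<open>i \<ge> n\<close> are irrelevant. All balls have radius 1 and
  equal mass.
\<close>

definition velocity :: "(nat \<Rightarrow> real \<Rightarrow> 'a::euclidean_space) \<Rightarrow> nat \<Rightarrow> real \<Rightarrow> 'a" where
  "velocity x i t = vector_derivative (x i) (at_right t)"

definition velocity_before :: "(nat \<Rightarrow> real \<Rightarrow> 'a::euclidean_space) \<Rightarrow> nat \<Rightarrow> real \<Rightarrow> 'a" where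
  "velocity_before x i t = Lim (at_left t) (velocity x i)"

definition touching :: "(nat \<Rightarrow> real \<Rightarrow> 'a::euclidean_space) \<Rightarrow> nat \<Rightarrow> nat \<Rightarrow> real \<Rightarrow> bool" where
  "touching x i j t \<longleftrightarrow> i \<noteq> j \<and> dist (x i t) (x j t) = 2"

definition proj_along :: "'a::euclidean_space \<Rightarrow> 'a \<Rightarrow> 'a" where
  "proj_along w z = ((z \<bullet> w) / (norm w)\<^sup>2) *\<^sub>R w"

definition impact :: "nat \<Rightarrow> (nat \<Rightarrow> real \<Rightarrow> 'a::euclidean_space) \<Rightarrow> nat \<Rightarrow> nat \<Rightarrow> real \<Rightarrow> bool" where
  "impact n x i j t \<longleftrightarrow>
     touching x i j t \<and>
     (\<forall>k<n. k \<noteq> i \<and> k \<noteq> j \<longrightarrow> \<not> touching x i k t \<and> \<not> touching x j k t) \<and>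
     (velocity_before x i t - velocity_before x j t) \<bullet> (x i t - x j t) < 0"

definition simultaneous_collision :: "nat \<Rightarrow> (nat \<Rightarrow> real \<Rightarrow> 'a::euclidean_space) \<Rightarrow> real \<Rightarrow> bool" where
  "simultaneous_collision n x t \<longleftrightarrow>
     (\<exists>S. S \<subseteq> {..<n} \<and> 3 \<le> card S \<and>
        (\<forall>i\<in>S. \<forall>j\<in>S. (i, j) \<in> {(k, l). k \<in> S \<and> l \<in> S \<and> touching x k l t}\<^sup>*))"

text \<open>
  The last clause says that a ball has constant velocity on every open time interval in which it
  undergoes no impact. In particular, grazing contacts leave the velocities unchanged. The reflection
  law is stated for ball \<open>i\<close> of an ordered pair; the law for the other ball is the same
  clause with \<open>i\<close> and \<open>j\<close> exchanged.
\<close>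

definition evolution :: "nat \<Rightarrow> (nat \<Rightarrow> real \<Rightarrow> 'a::euclidean_space) \<Rightarrow> bool" where
  "evolution n x \<longleftrightarrow>
     (\<forall>i<n. continuous_on UNIV (x i)) \<and>
     (\<forall>i<n. \<forall>t. x i differentiable (at_right t)) \<and>
     (\<forall>i<n. \<forall>t. \<exists>v. (velocity x i \<longlongrightarrow> v) (at_left t)) \<and>
     (\<forall>i<n. \<forall>j<n. \<forall>t. i \<noteq> j \<longrightarrow> ball (x i t) 1 \<inter> ball (x j t) 1 = {}) \<and>
     (\<forall>t. \<not> simultaneous_collision n x t) \<and>
     (\<forall>i<n. \<forall>j<n. \<forall>t. impact n x i j t \<longrightarrow>
        velocity x i t = velocity_before x i t -
          proj_along (x i t - x j t) (velocity_before x i t - velocity_before x j t)) \<and>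
     (\<forall>i<n. \<forall>a b. a < b \<and> (\<forall>t\<in>{a<..<b}. \<forall>j<n. \<not> impact n x i j t) \<longrightarrow>
        (\<exists>v. \<forall>t\<in>{a<..<b}. (x i has_vector_derivative v) (at t)))"

text \<open>The point of tangency of two touching unit balls is the midpoint of their centres.\<close>

definition collision ::
    "(nat \<Rightarrow> real \<Rightarrow> 'a::euclidean_space) \<Rightarrow> nat \<Rightarrow> nat \<Rightarrow> 'a \<Rightarrow> real \<Rightarrow> bool" where
  "collision x i j y t \<longleftrightarrow>
     touching x i j t \<and> y = midpoint (x i t) (x j t) \<and>
     (\<exists>\<epsilon>>0. \<forall>s\<in>{t - \<epsilon><..<t} \<union> {t<..<t + \<epsilon>}. \<not> touching x i j s) \<and>
     velocity x i t \<noteq> velocity_before x i t \<and>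
     velocity x j t \<noteq> velocity_before x j t"

definition collisions ::
    "nat \<Rightarrow> (nat \<Rightarrow> real \<Rightarrow> 'a::euclidean_space) \<Rightarrow> (nat \<times> nat \<times> 'a \<times> real) set" where
  "collisions n x = {(i, j, y, t). i < j \<and> j < n \<and> collision x i j y t}"

definition num_collisions :: "nat \<Rightarrow> (nat \<Rightarrow> real \<Rightarrow> 'a::euclidean_space) \<Rightarrow> enat" where
  "num_collisions n x =
     (if finite (collisions n x) then enat (card (collisions n x)) else \<infinity>)"

definition K :: "'a::euclidean_space itself \<Rightarrow> nat \<Rightarrow> enat" where
  "K _ n = (SUP x \<in> {x :: nat \<Rightarrow> real \<Rightarrow> 'a. evolution n x}. num_collisions n x)"

definition f_bound :: "nat \<Rightarrow> nat" where
  "f_bound n = (let n\<^sub>1 = n div 3; n\<^sub>2 = n - 2 * n\<^sub>1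
          in n\<^sub>1 * (n\<^sub>1 + 1) * n\<^sub>2 + n\<^sub>2 * (n\<^sub>2 - 1) div 2 + n\<^sub>1 * (n\<^sub>1 - 1))"

end

theory Submission
  imports Defs "HOL-Combinatorics.Permutations"
begin

text \<open>
  Put \<open>m = n div 3\<close>. A horizontal row of \<open>2 m + 1\<close> nearly touching balls has a vertical column of
  \<open>N - 1\<close> further balls hanging below its middle ball \<open>W\<close>, where \<open>N = n - 2 m\<close>, and \<open>W\<close> itself sits
  lower than the rest of the row by \<open>2 \<beta>\<close>. Gaps are of order \<open>\<beta>\<^sup>3\<close> in the row and \<open>\<beta>\<^sup>2\<close> in the column,
  velocities of order \<open>\<beta>\<close> in the row and \<open>1\<close> in the column, and time is measured in units of \<open>\<beta>\<^sup>2\<close>.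
  As \<open>\<beta>\<close> tends to 0, row and column turn into two systems of points on a line that exchange their
  velocities when they meet, with a single interaction: the contacts of \<open>W\<close> with its two row
  neighbours are tilted by the angle \<open>\<beta>\<close>, so that a vertical velocity gained by \<open>W\<close> drives the left and
  the right half of the row towards each other.

  In the beginning the row is in reverse order of velocities, which costs \<open>m (2 m + 1)\<close> collisions. Then
  the pulses \<open>j = 1, ..., N - 1\<close> travel up the column, each faster than all earlier ones. Pulse \<open>j\<close> makes
  \<open>j\<close> column collisions, and upon reaching \<open>W\<close> it inverts the velocity order of every pair of row balls
  that are separated by \<open>W\<close> or involve \<open>W\<close>, which makes \<open>m\<^sup>2 + 2 m\<close> further row collisions. All
  collisions of the limit are transversal and occur at distinct times within each of the two lines, so
  they persist for small \<open>\<beta>\<close>.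
\<close>

section \<open>Collision schedules and evolutions\<close>

text \<open>The exponents of \<open>\<beta>\<close> are forced. A vertical velocity of order 1 acts
  through a tilt of order \<open>\<beta>\<close> on the row distances at rate
  \<open>\<beta>\<close>, which must be comparable with the row velocities. The quotients gap by
  velocity must agree, \<open>\<beta>^3 / \<beta>\<close> in the row and
  \<open>\<beta>^2 / 1\<close> in the column. In the other direction, an impact inside the row gives
  \<open>W\<close> a vertical impulse of order \<open>\<beta>\<close> times \<open>\<beta>\<close>
  only, so the column does not feel the row in the limit. The main obstacle is to exclude
  simultaneous contacts in the row after every pulse. It is met by an invariant: dividing the
  relative velocity of a pair across \<open>W\<close> by the jump of \<open>side\<close> gives a
  slope, all slopes are distinct and lie between 0 and 2, and a pulse replaces each slope s by 2 -
  s. Distinct slopes produce distinct meeting times as soon as the pulse is delayed long enough, and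
  the delays are free parameters. Since only finitely many events occur, a limit argument replaces
  all explicit estimates of \<open>\<beta>\<close>.\<close>

definition apart :: "nat \<Rightarrow> (nat \<Rightarrow> 'a::euclidean_space) \<Rightarrow> bool" where
  "apart n z \<longleftrightarrow> (\<forall>i<n. \<forall>j<n. i \<noteq> j \<longrightarrow> 2 < dist (z i) (z j))"

definition hit :: "nat \<Rightarrow> nat \<Rightarrow> nat \<Rightarrow> (nat \<Rightarrow> 'a::euclidean_space) \<Rightarrow> (nat \<Rightarrow> 'a) \<Rightarrow> bool" where
  "hit n a b z v \<longleftrightarrow> a < n \<and> b < n \<and> a \<noteq> b \<and> dist (z a) (z b) = 2 \<and> (v a - v b) \<bullet> (z a - z b) < 0 \<and>
     (\<forall>i<n. \<forall>j<n. i \<noteq> j \<and> {i, j} \<noteq> {a, b} \<longrightarrow> 2 < dist (z i) (z j))"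

definition bounce :: "nat \<Rightarrow> nat \<Rightarrow> (nat \<Rightarrow> 'a::euclidean_space) \<Rightarrow> (nat \<Rightarrow> 'a) \<Rightarrow> nat \<Rightarrow> 'a" where
  "bounce a b z v = v(a := v a - proj_along (z a - z b) (v a - v b),
                      b := v b - proj_along (z b - z a) (v b - v a))"

definition drift :: "real \<Rightarrow> (nat \<Rightarrow> 'a::euclidean_space) \<Rightarrow> (nat \<Rightarrow> 'a) \<Rightarrow> nat \<Rightarrow> 'a" where
  "drift t z v = (\<lambda>i. z i + t *\<^sub>R v i)"

text \<open>An event-driven simulation of the future of a state, \<open>k\<close> counting its
  impacts. Separation is required only at positive times, because the state after an impact still
  has a touching pair. The strict \<open>0 < \<tau>\<close> makes the impact times distinct, so that
  counting times counts collisions.\<close>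

inductive run :: "nat \<Rightarrow> nat \<Rightarrow> (nat \<Rightarrow> 'a::euclidean_space) \<Rightarrow> (nat \<Rightarrow> 'a) \<Rightarrow> bool" for n where
  run_stop: "(\<And>t. 0 < t \<Longrightarrow> apart n (drift t z v)) \<Longrightarrow> run n 0 z v"
| run_hit: "0 < \<tau> \<Longrightarrow> (\<And>t. 0 < t \<Longrightarrow> t < \<tau> \<Longrightarrow> apart n (drift t z v)) \<Longrightarrow> hit n a b (drift \<tau> z v) v \<Longrightarrow>
    run n k (drift \<tau> z v) (bounce a b (drift \<tau> z v) v) \<Longrightarrow> run n (Suc k) z v"

lemma drift_drift: "drift t (drift s z v) v = drift (s + t) z v"
  by (simp add: drift_def algebra_simps)

lemma drift_0 [simp]: "drift 0 z v = z"
  by (simp add: drift_def)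

text \<open>The ideal motion has waiting steps, which \<open>run\<close> lacks; a wait is absorbed
  into the flight that follows. For this the endpoint \<open>\<tau>\<close> must be separated as
  well.\<close>

lemma run_wait:
  assumes "run n k (drift \<tau> z v) v" "0 < \<tau>" and ap: "\<And>t. 0 < t \<Longrightarrow> t \<le> \<tau> \<Longrightarrow> apart n (drift t z v)"
  shows "run n k z v"
  using assms(1)
proof cases
  case run_stop
  show ?thesis unfolding run_stop(1)
  proof (rule run.run_stop)
    fix t :: real assume "0 < t"
    show "apart n (drift t z v)"
      using ap[of t] run_stop(2)[of "t - \<tau>"] \<open>0 < t\<close> by (cases "t \<le> \<tau>") (simp_all add: drift_drift)
  qed
next
  case (run_hit \<sigma> a b l)
  show ?thesis unfolding run_hit(1)
  proof (rule run.run_hit)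
    show "0 < \<tau> + \<sigma>" using run_hit assms by simp
    show "apart n (drift t z v)" if "0 < t" "t < \<tau> + \<sigma>" for t
      using ap[of t] run_hit(3)[of "t - \<tau>"] that by (cases "t \<le> \<tau>") (simp_all add: drift_drift)
    show "hit n a b (drift (\<tau> + \<sigma>) z v) v" using run_hit(4) by (simp add: drift_drift)
    show "run n l (drift (\<tau> + \<sigma>) z v) (bounce a b (drift (\<tau> + \<sigma>) z v) v)"
      using run_hit(5) by (simp add: drift_drift)
  qed
qed

lemma apart_isometry:
  assumes "\<And>x y. dist (f x) (f y) = dist x y"
  shows "apart n (\<lambda>i. f (z i)) = apart n z"
  by (simp add: apart_def assms)

text \<open>The construction lives in the plane; this carries it to every higher dimension.\<close>

lemma run_isometry:
  fixes f :: "'a::euclidean_space \<Rightarrow> 'b::euclidean_space"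
  assumes lin: "linear f" and iso: "\<And>x y. f x \<bullet> f y = x \<bullet> y"
  shows "run n k z v \<Longrightarrow> run n k (\<lambda>i. f (z i)) (\<lambda>i. f (v i))"
proof (induction rule: run.induct)
  case (run_stop z v)
  have no: "norm (f x) = norm x" for x by (simp add: norm_eq_sqrt_inner iso)
  have di: "dist (f x) (f y) = dist x y" for x y
    by (simp add: dist_norm no flip: linear_diff[OF lin])
  have dr: "drift t (\<lambda>i. f (z i)) (\<lambda>i. f (v i)) = (\<lambda>i. f (drift t z v i))" for t z v
    by (simp add: drift_def linear_add[OF lin] linear_scale[OF lin])
  show ?case by (rule run.run_stop) (simp add: dr apart_isometry di run_stop)
next
  case (run_hit \<tau> z v a b k)
  have no: "norm (f x) = norm x" for x by (simp add: norm_eq_sqrt_inner iso)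
  have di: "dist (f x) (f y) = dist x y" for x y
    by (simp add: dist_norm no flip: linear_diff[OF lin])
  have dr: "drift t (\<lambda>i. f (z i)) (\<lambda>i. f (v i)) = (\<lambda>i. f (drift t z v i))" for t z v
    by (simp add: drift_def linear_add[OF lin] linear_scale[OF lin])
  have pr: "proj_along (f x - f y) (f x' - f y') = f (proj_along (x - y) (x' - y'))" for x y x' y'
    by (simp add: proj_along_def no iso linear_scale[OF lin] flip: linear_diff[OF lin])
  have bo: "bounce a b (\<lambda>i. f (z i)) (\<lambda>i. f (v i)) = (\<lambda>i. f (bounce a b z v i))" for z v
    by (rule ext) (simp add: bounce_def pr linear_diff[OF lin])
  show ?case
  proof (rule run.run_hit[of \<tau>])
    show "hit n a b (drift \<tau> (\<lambda>i. f (z i)) (\<lambda>i. f (v i))) (\<lambda>i. f (v i))"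
      using run_hit(3) by (simp add: hit_def dr di iso flip: linear_diff[OF lin])
  qed (use run_hit in \<open>simp_all add: dr bo apart_isometry di\<close>)
qed

section \<open>Trajectories glued from affine pieces\<close>

definition pieces where
  "pieces n x t z v w \<longleftrightarrow> (\<exists>\<epsilon>>0. \<forall>i<n.
      (\<forall>s. t - \<epsilon> < s \<and> s \<le> t \<longrightarrow> x i s = z i + (s - t) *\<^sub>R v i) \<and>
      (\<forall>s. t \<le> s \<and> s < t + \<epsilon> \<longrightarrow> x i s = z i + (s - t) *\<^sub>R w i))"

definition free_at where
  "free_at n x t \<longleftrightarrow> (\<exists>z v. pieces n x t z v v \<and> apart n z)"

definition hit_at where
  "hit_at n x t \<longleftrightarrow> (\<exists>z v a b. pieces n x t z v (bounce a b z v) \<and> hit n a b z v)"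

lemma pieces_shift:
  assumes "pieces n x (t - \<tau>) z v w" and "0 < \<delta>" and "\<And>i s. i < n \<Longrightarrow> t - \<delta> < s \<Longrightarrow> s < t + \<delta> \<Longrightarrow> y i s = x i (s - \<tau>)"
  shows "pieces n y t z v w"
proof -
  obtain \<epsilon> where e: "\<epsilon> > 0" "\<forall>i<n. (\<forall>s. (t - \<tau>) - \<epsilon> < s \<and> s \<le> (t - \<tau>) \<longrightarrow> x i s = z i + (s - (t - \<tau>)) *\<^sub>R v i) \<and>
      (\<forall>s. (t - \<tau>) \<le> s \<and> s < (t - \<tau>) + \<epsilon> \<longrightarrow> x i s = z i + (s - (t - \<tau>)) *\<^sub>R w i)"
    using assms(1) by (auto simp: pieces_def)
  show ?thesis unfolding pieces_def
  proof (rule exI[of _ "min \<epsilon> \<delta>"], intro conjI allI impI)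
    show "min \<epsilon> \<delta> > 0" using e assms by simp
    fix i s assume i: "i < n"
    have y: "y i s = x i (s - \<tau>)" if "t - min \<epsilon> \<delta> < s" "s < t + min \<epsilon> \<delta>"
      by (rule assms(3)[OF i]) (use that in linarith)+
    show "y i s = z i + (s - t) *\<^sub>R v i" if "t - min \<epsilon> \<delta> < s \<and> s \<le> t"
    proof -
      have "x i (s - \<tau>) = z i + ((s - \<tau>) - (t - \<tau>)) *\<^sub>R v i"
        using e(2)[rule_format, OF i] that by auto
      then show ?thesis using y that e(1) assms(2) by simp
    qed
    show "y i s = z i + (s - t) *\<^sub>R w i" if "t \<le> s \<and> s < t + min \<epsilon> \<delta>"
    proof -
      have "x i (s - \<tau>) = z i + ((s - \<tau>) - (t - \<tau>)) *\<^sub>R w i"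
        using e(2)[rule_format, OF i] that by auto
      then show ?thesis using y that e(1) assms(2) by simp
    qed
  qed
qed

lemma free_at_drift:
  assumes "apart n (drift t z v)" "0 < \<delta>" "\<And>i s. i < n \<Longrightarrow> t - \<delta> < s \<Longrightarrow> s < t + \<delta> \<Longrightarrow> x i s = z i + s *\<^sub>R v i"
  shows "free_at n x t"
proof -
  have "pieces n x t (drift t z v) v v"
    unfolding pieces_def using assms(2,3) by (intro exI[of _ \<delta>]) (auto simp: drift_def algebra_simps)
  then show ?thesis using assms(1) by (auto simp: free_at_def)
qed

text \<open>The first conjunct drives the gluing: the trajectory of the remaining run coincides with
  free flight for a moment after time 0, so at the impact time both one-sided affine germs are
  visible.\<close>

lemma run_trajectory:
  "run n k z v \<Longrightarrow> \<exists>(x :: nat \<Rightarrow> real \<Rightarrow> 'a::euclidean_space) T. (\<exists>\<epsilon>>0. \<forall>i<n. \<forall>t<\<epsilon>. x i t = z i + t *\<^sub>R v i) \<and>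
     (\<forall>t>0. free_at n x t \<or> hit_at n x t) \<and> finite T \<and> card T = k \<and> (\<forall>t\<in>T. 0 < t \<and> hit_at n x t)"
proof (induction rule: run.induct)
  case (run_stop z v)
  have "free_at n (\<lambda>i t. z i + t *\<^sub>R v i) t" if "0 < t" for t
    by (rule free_at_drift[OF run_stop[OF that], of 1]) auto
  then show ?case
    by (intro exI[of _ "\<lambda>i t. z i + t *\<^sub>R v i"] exI[of _ "{}"]) (auto intro: exI[of _ 1])
next
  case (run_hit \<tau> z v a b k)
  define z' v' where "z' = drift \<tau> z v" and "v' = bounce a b z' v"
  obtain x T \<epsilon> where x: "\<epsilon> > 0" "\<forall>i<n. \<forall>t<\<epsilon>. x i t = z' i + t *\<^sub>R v' i"
     "\<forall>t>0. free_at n x t \<or> hit_at n x t" "finite T" "card T = k" "\<forall>t\<in>T. 0 < t \<and> hit_at n x t"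
    using run_hit.IH by (auto simp: z'_def v'_def)
  define y where "y i t = (if t \<le> \<tau> then z i + t *\<^sub>R v i else x i (t - \<tau>))" for i t
  have before: "free_at n y t" if "0 < t" "t < \<tau>" for t
    by (rule free_at_drift[OF run_hit(2)[OF that], of "\<tau> - t"]) (use that in \<open>auto simp: y_def\<close>)
  have shift: "pieces n y t p q r" if "pieces n x (t - \<tau>) p q r" "\<tau> < t" for t p q r
    by (rule pieces_shift[OF that(1), of "t - \<tau>"]) (use that in \<open>auto simp: y_def\<close>)
  have after: "free_at n x (t - \<tau>) \<Longrightarrow> free_at n y t" "hit_at n x (t - \<tau>) \<Longrightarrow> hit_at n y t" if "\<tau> < t" for t
    using shift[OF _ that] unfolding free_at_def hit_at_def by blast+
  have now: "hit_at n y \<tau>"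
    unfolding hit_at_def
  proof (intro exI conjI)
    show "hit n a b z' v" using run_hit by (simp add: z'_def)
    show "pieces n y \<tau> z' v (bounce a b z' v)"
      unfolding pieces_def
    proof (rule exI[of _ \<epsilon>], intro conjI allI impI)
      fix i s assume "i < n"
      show "y i s = z' i + (s - \<tau>) *\<^sub>R v i" if "\<tau> - \<epsilon> < s \<and> s \<le> \<tau>"
        using that by (simp add: y_def z'_def drift_def algebra_simps)
      show "y i s = z' i + (s - \<tau>) *\<^sub>R bounce a b z' v i" if "\<tau> \<le> s \<and> s < \<tau> + \<epsilon>"
        using that x(2) \<open>i < n\<close> by (auto simp: y_def v'_def) (simp add: z'_def drift_def)
    qed (use x in simp)
  qed
  show ?case
  proof (intro exI conjI)
    show "\<tau> > 0" by (fact run_hit)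
    show "\<forall>i<n. \<forall>t<\<tau>. y i t = z i + t *\<^sub>R v i" by (simp add: y_def)
    show "\<forall>t>0. free_at n y t \<or> hit_at n y t"
    proof (intro allI impI)
      fix t :: real assume "t > 0"
      consider "t < \<tau>" | "t = \<tau>" | "t > \<tau>" by linarith
      then show "free_at n y t \<or> hit_at n y t"
      proof cases
        case 3
        then have "free_at n x (t - \<tau>) \<or> hit_at n x (t - \<tau>)" using x(3) by simp
        then show ?thesis using after[OF 3] by blast
      qed (use before now \<open>t > 0\<close> in simp_all)
    qed
    show "finite (insert \<tau> ((\<lambda>t. t + \<tau>) ` T))" using x by simp
    have "\<tau> \<notin> (\<lambda>t. t + \<tau>) ` T" using x(6) by force
    then show "card (insert \<tau> ((\<lambda>t. t + \<tau>) ` T)) = Suc k"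
      using x(4,5) by (simp add: card_image inj_on_def)
    show "\<forall>t\<in>insert \<tau> ((\<lambda>t. t + \<tau>) ` T). 0 < t \<and> hit_at n y t"
      using now after(2) x(6) run_hit(1) by auto
  qed
qed

lemma run_global_trajectory:
  fixes z v :: "nat \<Rightarrow> 'a::euclidean_space"
  assumes "run n k z v" and "\<And>t. t \<le> 0 \<Longrightarrow> apart n (drift t z v)"
  shows "\<exists>(x :: nat \<Rightarrow> real \<Rightarrow> 'a) T. (\<forall>t. free_at n x t \<or> hit_at n x t) \<and> finite T \<and> card T = k \<and> (\<forall>t\<in>T. hit_at n x t)"
proof -
  obtain x T \<epsilon> where x: "\<epsilon> > 0" "\<forall>i<n. \<forall>t<\<epsilon>. x i t = z i + t *\<^sub>R v i"
     "\<forall>t>0. free_at n x t \<or> hit_at n x t" "finite T" "card T = k" "\<forall>t\<in>T. 0 < t \<and> hit_at n x t"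
    using run_trajectory[OF assms(1)] by auto
  have "free_at n x t" if "t \<le> 0" for t
    by (rule free_at_drift[OF assms(2)[OF that] x(1)]) (use x that in auto)
  then have "\<forall>t. free_at n x t \<or> hit_at n x t" using x(3) by (meson not_le)
  then show ?thesis by (intro exI[of _ x] exI[of _ T]) (use x in auto)
qed

section \<open>From affine pieces to evolutions and counted collisions\<close>

lemma pieces_derivatives:
  assumes "pieces n x t z v w" "i < n"
  shows "x i t = z i" "(x i has_vector_derivative w i) (at_right t)"
    "velocity x i t = w i" "(velocity x i \<longlongrightarrow> v i) (at_left t)" "velocity_before x i t = v i"
    "isCont (x i) t" "w i = v i \<Longrightarrow> \<exists>\<epsilon>>0. \<forall>s. t - \<epsilon> < s \<and> s < t + \<epsilon> \<longrightarrow> (x i has_vector_derivative v i) (at s)"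
proof -
  obtain \<epsilon> where e: "\<epsilon> > 0" and l: "\<And>s. t - \<epsilon> < s \<Longrightarrow> s \<le> t \<Longrightarrow> x i s = z i + (s - t) *\<^sub>R v i"
      and r: "\<And>s. t \<le> s \<Longrightarrow> s < t + \<epsilon> \<Longrightarrow> x i s = z i + (s - t) *\<^sub>R w i"
    using assms by (auto simp: pieces_def)
  have aff: "((\<lambda>s. z i + (s - t) *\<^sub>R c) has_vector_derivative c) (at r within S)" for c r S
    unfolding has_vector_derivative_def by (auto intro!: derivative_eq_intros simp: algebra_simps)
  show t: "x i t = z i" using l[of t] e by simp
  show R: "(x i has_vector_derivative w i) (at_right t)"
  proof (rule has_vector_derivative_within_subset)
    show "(x i has_vector_derivative w i) (at t within {t..})"
      by (rule has_vector_derivative_transform_within[OF aff e]) (auto simp: dist_real_def intro!: r[symmetric])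
  qed auto
  show "velocity x i t = w i"
    unfolding velocity_def by (rule vector_derivative_within[OF _ R]) (simp add: trivial_limit_at_right_real)
  have L: "(x i has_vector_derivative v i) (at s)" if "t - \<epsilon> < s" "s < t" for s
    by (rule has_vector_derivative_transform_within_open[OF aff, of "{t - \<epsilon><..<t}"]) (use that in \<open>auto simp: l\<close>)
  have vel: "velocity x i s = v i" if "t - \<epsilon> < s" "s < t" for s
    unfolding velocity_def
    by (rule vector_derivative_within[OF _ has_vector_derivative_at_within[OF L[OF that]]])
       (simp add: trivial_limit_at_right_real)
  show T: "(velocity x i \<longlongrightarrow> v i) (at_left t)"
  proof (rule tendsto_eventually)
    show "\<forall>\<^sub>F s in at_left t. velocity x i s = v i"
      using e vel by (auto simp: eventually_at_left_field intro!: exI[of _ "t - \<epsilon>"])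
  qed
  show "velocity_before x i t = v i"
    unfolding velocity_before_def by (rule tendsto_Lim[OF _ T]) (simp add: trivial_limit_at_left_real)
  have "(x i has_vector_derivative v i) (at_left t)"
  proof (rule has_vector_derivative_within_subset)
    show "(x i has_vector_derivative v i) (at t within {..t})"
      by (rule has_vector_derivative_transform_within[OF aff e]) (auto simp: dist_real_def intro!: l[symmetric])
  qed auto
  then have "continuous (at_left t) (x i)" "continuous (at_right t) (x i)"
    using R has_vector_derivative_continuous by blast+
  then show "isCont (x i) t" by (simp add: continuous_at_split)
  show "\<exists>\<epsilon>>0. \<forall>s. t - \<epsilon> < s \<and> s < t + \<epsilon> \<longrightarrow> (x i has_vector_derivative v i) (at s)" if "w i = v i"
  proof (intro exI[of _ \<epsilon>] conjI allI impI e)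
    fix s assume "t - \<epsilon> < s \<and> s < t + \<epsilon>"
    moreover have "x i s' = z i + (s' - t) *\<^sub>R v i" if "t - \<epsilon> < s'" "s' < t + \<epsilon>" for s'
      using l[of s'] r[of s'] that \<open>w i = v i\<close> by (cases "s' \<le> t") auto
    ultimately show "(x i has_vector_derivative v i) (at s)"
      by (intro has_vector_derivative_transform_within_open[OF aff, of "{t - \<epsilon><..<t + \<epsilon>}"]) auto
  qed
qed

lemma hit_sym: "hit n a b z v \<Longrightarrow> hit n b a z v"
  by (auto simp: hit_def dist_commute insert_commute algebra_simps)

lemma bounce_sym: "a \<noteq> b \<Longrightarrow> bounce a b z v = bounce b a z v"
  by (simp add: bounce_def fun_upd_twist)

text \<open>One elimination rule for both kinds of instants. A free instant is the case
  \<open>w = v\<close>, where the clause on touching pairs holds vacuously.\<close>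

lemma lawful_cases:
  fixes x :: "nat \<Rightarrow> real \<Rightarrow> 'a::euclidean_space"
  assumes "free_at n x t \<or> hit_at n x t"
  obtains z v w where "pieces n x t z v w" "\<And>i. i < n \<Longrightarrow> x i t = z i"
    "\<And>i j. i < n \<Longrightarrow> j < n \<Longrightarrow> i \<noteq> j \<Longrightarrow> 2 \<le> dist (z i) (z j)"
    "\<And>i j. i < n \<Longrightarrow> j < n \<Longrightarrow> touching x i j t \<Longrightarrow> hit n i j z v \<and> w = bounce i j z v"
    "\<And>i. i < n \<Longrightarrow> (\<forall>j<n. \<not> touching x i j t) \<Longrightarrow> w i = v i"
  using assms
proof
  assume "free_at n x t"
  then obtain z v where *: "pieces n x t z v v" "apart n z" by (auto simp: free_at_def)
  show ?thesis
  proof (rule that[OF *(1)])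
    show xz: "x i t = z i" if "i < n" for i by (rule pieces_derivatives(1)[OF *(1) that])
    show "2 \<le> dist (z i) (z j)" if "i < n" "j < n" "i \<noteq> j" for i j
      using *(2) that by (force simp: apart_def)
    show "hit n i j z v \<and> v = bounce i j z v" if "i < n" "j < n" "touching x i j t" for i j
      using *(2) that by (force simp: apart_def touching_def xz)
  qed simp
next
  assume "hit_at n x t"
  then obtain z v a b where *: "pieces n x t z v (bounce a b z v)" and h: "hit n a b z v"
    by (auto simp: hit_at_def)
  have ab: "a < n" "b < n" "a \<noteq> b" "dist (z a) (z b) = 2"
    and oth: "\<And>i j. i < n \<Longrightarrow> j < n \<Longrightarrow> i \<noteq> j \<Longrightarrow> {i, j} \<noteq> {a, b} \<Longrightarrow> 2 < dist (z i) (z j)"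
    using h by (auto simp: hit_def)
  show ?thesis
  proof (rule that[OF *(1)])
    show xz: "x i t = z i" if "i < n" for i by (rule pieces_derivatives(1)[OF *(1) that])
    show "2 \<le> dist (z i) (z j)" if "i < n" "j < n" "i \<noteq> j" for i j
      using oth[OF that] ab by (cases "{i, j} = {a, b}") (auto simp: doubleton_eq_iff dist_commute)
    show "hit n i j z v \<and> bounce a b z v = bounce i j z v" if "i < n" "j < n" "touching x i j t" for i j
    proof -
      have "{i, j} = {a, b}" using oth[of i j] that by (force simp: touching_def xz)
      then show ?thesis using h hit_sym[OF h] bounce_sym[OF ab(3)] by (auto simp: doubleton_eq_iff)
    qed
    show "bounce a b z v i = v i" if "i < n" "\<forall>j<n. \<not> touching x i j t" for i
      using that ab by (auto simp: bounce_def touching_def xz dist_commute)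
  qed
qed

text \<open>All axioms are local in time except the last one. There, every contact at a hit is an
  impact, so a ball without impacts touches nothing and its velocity is locally constant;
  connectedness of the interval makes it constant.\<close>

lemma lawful_evolution:
  fixes x :: "nat \<Rightarrow> real \<Rightarrow> 'a::euclidean_space"
  assumes lawful: "\<And>t. free_at n x t \<or> hit_at n x t"
  shows "evolution n x"
  unfolding evolution_def
proof (intro conjI allI impI)
  fix i t assume i: "i < n"
  obtain z v w where p: "pieces n x t z v w" using lawful_cases[OF lawful[of t]] by metis
  note d = pieces_derivatives[OF p i]
  show "x i differentiable at_right t" using d(2) by (metis differentiableI_vector)
  show "\<exists>v. (velocity x i \<longlongrightarrow> v) (at_left t)" using d(4) by blast
next
  fix i assume i: "i < n"
  have "isCont (x i) t" for t
    using lawful_cases[OF lawful[of t]] pieces_derivatives(6)[OF _ i] by metis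
  then show "continuous_on UNIV (x i)" by (simp add: continuous_at_imp_continuous_on)
next
  fix i j t assume "i < n" "j < n" "i \<noteq> j"
  then show "ball (x i t) 1 \<inter> ball (x j t) 1 = {}"
    using lawful_cases[OF lawful[of t]] by (intro disjoint_ballI) (metis one_add_one)
next
  fix t
  obtain z v w where z: "\<And>i. i < n \<Longrightarrow> x i t = z i"
    and tch: "\<And>i j. i < n \<Longrightarrow> j < n \<Longrightarrow> touching x i j t \<Longrightarrow> hit n i j z v \<and> w = bounce i j z v"
    using lawful_cases[OF lawful[of t]] by metis
  show "\<not> simultaneous_collision n x t"
  proof
    assume "simultaneous_collision n x t"
    then obtain S where S: "S \<subseteq> {..<n}" "3 \<le> card S"
      and conn: "\<And>i j. i \<in> S \<Longrightarrow> j \<in> S \<Longrightarrow> (i, j) \<in> {(k, l). k \<in> S \<and> l \<in> S \<and> touching x k l t}\<^sup>*"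
      by (auto simp: simultaneous_collision_def)
    have fin: "finite S" using S(2) card.infinite by fastforce
    have ex: "\<exists>j\<in>S. touching x i j t" if i: "i \<in> S" for i
    proof -
      have "S \<noteq> {i}" using S(2) by auto
      then obtain k where "k \<in> S" "k \<noteq> i" using i by blast
      then show ?thesis using conn[OF i \<open>k \<in> S\<close>] by (auto elim: converse_rtranclE)
    qed
    \<comment> \<open>Among three connected balls there are one touching pair and a contact
      involving a third ball, whereas a hit admits a single pair at distance 2.\<close>
    obtain a where a: "a \<in> S" using S(2) by fastforce
    obtain b where b: "b \<in> S" "touching x a b t" using ex[OF a] by blast
    have "card {a, b} < card S" using S(2) by (simp add: card_insert_if)
    then obtain c where c: "c \<in> S" "c \<notin> {a, b}"
      using fin by (metis card_mono finite.emptyI finite_insert linorder_not_less subsetI)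
    obtain d where d: "d \<in> S" "touching x c d t" using ex[OF c(1)] by blast
    have n: "a < n" "b < n" "c < n" "d < n" using S(1) a b c d by auto
    have "hit n a b z v" using tch n b by blast
    moreover have "{c, d} \<noteq> {a, b}" using c by blast
    ultimately have "2 < dist (z c) (z d)" using d n by (auto simp: hit_def touching_def)
    then show False using d n z by (auto simp: touching_def)
  qed
next
  fix i j t assume ij: "i < n" "j < n" and im: "impact n x i j t"
  obtain z v w where p: "pieces n x t z v w" and z: "\<And>i. i < n \<Longrightarrow> x i t = z i"
    and tch: "\<And>i j. i < n \<Longrightarrow> j < n \<Longrightarrow> touching x i j t \<Longrightarrow> hit n i j z v \<and> w = bounce i j z v"
    using lawful_cases[OF lawful[of t]] by metis
  have "touching x i j t" using im by (simp add: impact_def)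
  then have "w = bounce i j z v" "i \<noteq> j" using tch ij by (auto simp: touching_def)
  then show "velocity x i t = velocity_before x i t -
          proj_along (x i t - x j t) (velocity_before x i t - velocity_before x j t)"
    using pieces_derivatives(3,5)[OF p] ij z by (simp add: bounce_def)
next
  fix i a b assume i: "i < n" and ab: "a < b \<and> (\<forall>t\<in>{a<..<b}. \<forall>j<n. \<not> impact n x i j t)"
  have loc: "\<exists>\<epsilon>>0. \<exists>v. \<forall>s. t - \<epsilon> < s \<and> s < t + \<epsilon> \<longrightarrow> (x i has_vector_derivative v) (at s)"
    if t: "t \<in> {a<..<b}" for t
  proof -
    obtain z v w where p: "pieces n x t z v w" and z: "\<And>i. i < n \<Longrightarrow> x i t = z i"
      and tch: "\<And>i j. i < n \<Longrightarrow> j < n \<Longrightarrow> touching x i j t \<Longrightarrow> hit n i j z v \<and> w = bounce i j z v"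
      and notch: "\<And>i. i < n \<Longrightarrow> (\<forall>j<n. \<not> touching x i j t) \<Longrightarrow> w i = v i"
      using lawful_cases[OF lawful[of t]] by metis
    have "\<not> touching x i j t" if j: "j < n" for j
    proof
      assume T: "touching x i j t"
      then have h: "hit n i j z v" using tch i j by blast
      have far: "2 < dist (z k) (z l)" if "k < n" "l < n" "k \<noteq> l" "{k, l} \<noteq> {i, j}" for k l
        using h that by (auto simp: hit_def)
      have "impact n x i j t"
        unfolding impact_def
      proof (intro conjI allI impI)
        fix k assume k: "k < n" "k \<noteq> i \<and> k \<noteq> j"
        show "\<not> touching x i k t" using far[of i k] k i z[OF i] z[OF k(1)]
          by (auto simp: touching_def doubleton_eq_iff)
        show "\<not> touching x j k t" using far[of j k] k j z[OF j] z[OF k(1)]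
          by (auto simp: touching_def doubleton_eq_iff)
      next
        show "(velocity_before x i t - velocity_before x j t) \<bullet> (x i t - x j t) < 0"
          using h pieces_derivatives(5)[OF p] i j z by (auto simp: hit_def)
      qed (fact T)
      then show False using ab t j by blast
    qed
    then have "w i = v i" using notch i by blast
    then show ?thesis using pieces_derivatives(7)[OF p i] by blast
  qed
  define D where "D t = vector_derivative (x i) (at t)" for t
  have der: "(x i has_vector_derivative D t) (at t)" if t: "t \<in> {a<..<b}" for t
  proof -
    obtain \<epsilon> v where "\<epsilon> > 0" "\<forall>s. t - \<epsilon> < s \<and> s < t + \<epsilon> \<longrightarrow> (x i has_vector_derivative v) (at s)"
      using loc[OF t] by blast
    then have "(x i has_vector_derivative v) (at t)" by auto
    then show ?thesis by (simp add: D_def vector_derivative_at)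
  qed
  have cst: "D s = D t" if "s \<in> {a<..<b}" "t \<in> {a<..<b}" for s t
  proof (rule connected_local_const[of "{a<..<b}" s t D])
    show "\<forall>t\<in>{a<..<b}. \<forall>\<^sub>F s in at t within {a<..<b}. D t = D s"
    proof
      fix t assume "t \<in> {a<..<b}"
      then obtain \<epsilon> v where e: "\<epsilon> > 0" "\<forall>s. t - \<epsilon> < s \<and> s < t + \<epsilon> \<longrightarrow> (x i has_vector_derivative v) (at s)"
        using loc by blast
      then have "D s = v" if "dist s t < \<epsilon>" for s
        using that by (auto simp: D_def dist_real_def abs_less_iff intro!: vector_derivative_at)
      then show "\<forall>\<^sub>F s in at t within {a<..<b}. D t = D s"
        unfolding eventually_at using e(1) by (intro exI[of _ \<epsilon>]) auto
    qed
  qed (use that in auto)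
  have const: "D s = D ((a + b) / 2)" if "s \<in> {a<..<b}" for s
    by (rule cst) (use that ab in auto)
  show "\<exists>v. \<forall>t\<in>{a<..<b}. (x i has_vector_derivative v) (at t)"
  proof (intro exI ballI)
    fix t assume t: "t \<in> {a<..<b}"
    show "(x i has_vector_derivative D ((a + b) / 2)) (at t)" using der[OF t] const[OF t] by simp
  qed
qed

text \<open>The squared distance is quadratic in \<open>s\<close> with value 4 at 0, a linear term
  that is positive for \<open>s < 0\<close>, and a nonnegative quadratic term. With reversed
  velocities the same statement covers the moments after an impact.\<close>

lemma touching_isolated:
  fixes p q :: "'a::euclidean_space"
  assumes "dist p q = 2" "(v - w) \<bullet> (p - q) < 0" "s < 0"
  shows "dist (p + s *\<^sub>R v) (q + s *\<^sub>R w) \<noteq> 2"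
proof -
  have "(dist (p + s *\<^sub>R v) (q + s *\<^sub>R w))\<^sup>2 = (norm ((p - q) + s *\<^sub>R (v - w)))\<^sup>2"
    by (simp add: dist_norm algebra_simps)
  also have "\<dots> = (dist p q)\<^sup>2 + 2 * s * ((v - w) \<bullet> (p - q)) + s\<^sup>2 * (norm (v - w))\<^sup>2"
    unfolding dist_norm power2_norm_eq_inner
    by (simp add: inner_add_left inner_add_right inner_commute power2_eq_square algebra_simps)
  also have "\<dots> > 4"
    using assms mult_neg_neg[of s "(v - w) \<bullet> (p - q)"] by (simp add: add_pos_nonneg)
  finally show ?thesis by auto
qed

lemma hit_at_collision:
  fixes x :: "nat \<Rightarrow> real \<Rightarrow> 'a::euclidean_space"
  assumes "hit_at n x t"
  shows "\<exists>i j y. (i, j, y, t) \<in> collisions n x"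
proof -
  obtain z v a b where p: "pieces n x t z v (bounce a b z v)" and h: "hit n a b z v" and "a < b"
  proof -
    obtain z v a b where *: "pieces n x t z v (bounce a b z v)" "hit n a b z v"
      using assms by (auto simp: hit_at_def)
    then have "a \<noteq> b" by (simp add: hit_def)
    then consider "a < b" | "b < a" by linarith
    then show thesis
    proof cases
      case 1
      show ?thesis by (rule that[OF * 1])
    next
      case 2
      have "hit n b a z v" by (rule hit_sym[OF *(2)])
      moreover have "pieces n x t z v (bounce b a z v)" using *(1) bounce_sym[OF \<open>a \<noteq> b\<close>, of z v] by simp
      ultimately show ?thesis using that 2 by blast
    qed
  qed
  have ab: "a < n" "b < n" "a \<noteq> b" and d2: "dist (z a) (z b) = 2" and app: "(v a - v b) \<bullet> (z a - z b) < 0"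
    using h by (auto simp: hit_def)
  define w where "w = bounce a b z v"
  \<comment> \<open>The denominator is the squared distance 4 of the centres, so \<open>c\<close> is
    the coefficient of the exchanged impulse; as \<open>c < 0\<close>, both velocities really
    change.\<close>
  define c where "c = ((v a - v b) \<bullet> (z a - z b)) / 4"
  have n2: "norm (z a - z b) = 2" "norm (z b - z a) = 2"
    using d2 by (simp_all add: dist_norm norm_minus_commute)
  have c: "c < 0" using app by (simp add: c_def)
  have wa: "w a = v a - c *\<^sub>R (z a - z b)"
    using ab by (simp add: w_def bounce_def proj_along_def n2 c_def)
  have "(v b - v a) \<bullet> (z b - z a) = (v a - v b) \<bullet> (z a - z b)" by (simp add: algebra_simps)
  then have wb: "w b = v b + c *\<^sub>R (z a - z b)"
    using ab by (simp add: w_def bounce_def proj_along_def n2 c_def algebra_simps)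
  have zz: "(z a - z b) \<bullet> (z a - z b) = 4" using n2 by (simp add: power2_norm_eq_inner[symmetric])
  have app': "(w a - w b) \<bullet> (z a - z b) > 0"
  proof -
    have "w a - w b = (v a - v b) - (2 * c) *\<^sub>R (z a - z b)" by (simp add: wa wb algebra_simps flip: scaleR_2)
    moreover have "(v a - v b) \<bullet> (z a - z b) = 4 * c" by (simp add: c_def)
    ultimately have "(w a - w b) \<bullet> (z a - z b) = 4 * c - 2 * c * 4"
      by (simp only: inner_diff_left[of "v a - v b"] inner_scaleR_left zz)
    then show ?thesis using c by simp
  qed
  obtain \<epsilon> where e: "\<epsilon> > 0" "\<forall>i<n. (\<forall>s. t - \<epsilon> < s \<and> s \<le> t \<longrightarrow> x i s = z i + (s - t) *\<^sub>R v i) \<and>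
      (\<forall>s. t \<le> s \<and> s < t + \<epsilon> \<longrightarrow> x i s = z i + (s - t) *\<^sub>R w i)"
    using p by (auto simp: pieces_def w_def)
  have "\<not> touching x a b s" if "s \<in> {t - \<epsilon><..<t} \<union> {t<..<t + \<epsilon>}" for s
  proof (cases "s < t")
    case True
    then show ?thesis using that e(2) ab touching_isolated[OF d2 app, of "s - t"] by (auto simp: touching_def)
  next
    case False
    then have s: "t < s" "s < t + \<epsilon>" using that by auto
    have "(- w a - - w b) \<bullet> (z a - z b) < 0" using app' by (simp add: algebra_simps)
    from touching_isolated[OF d2 this, of "t - s"] s show ?thesis
      using e(2) ab by (auto simp: touching_def scaleR_left_diff_distrib)
  qed
  then have iso: "\<exists>\<epsilon>>0. \<forall>s\<in>{t - \<epsilon><..<t} \<union> {t<..<t + \<epsilon>}. \<not> touching x a b s" using e(1) by blast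
  have "z a - z b \<noteq> 0" using n2 by auto
  then have "w a \<noteq> v a" "w b \<noteq> v b" using c by (auto simp: wa wb)
  then have "collision x a b (midpoint (x a t) (x b t)) t"
    using iso pieces_derivatives[OF p] ab d2 by (auto simp: collision_def touching_def w_def)
  then show ?thesis using ab \<open>a < b\<close> by (auto simp: collisions_def)
qed

text \<open>Projecting collisions to their times covers \<open>T\<close>, so distinct impact times
  bound the number of collisions from below.\<close>

lemma many_collisions:
  fixes x :: "nat \<Rightarrow> real \<Rightarrow> 'a::euclidean_space"
  assumes "finite T" "card T = k" "\<forall>t\<in>T. hit_at n x t"
  shows "enat k \<le> num_collisions n x"
proof (cases "finite (collisions n x)")
  case True
  let ?time = "\<lambda>(i, j, y, t). t :: real"
  have "T \<subseteq> ?time ` collisions n x"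
    using hit_at_collision assms(3) by force
  then have "card T \<le> card (collisions n x)"
    using True by (meson card_image_le card_mono finite_imageI order_trans)
  then show ?thesis using True assms by (simp add: num_collisions_def)
qed (simp add: num_collisions_def)

theorem run_K:
  fixes z v :: "nat \<Rightarrow> 'a::euclidean_space"
  assumes "run n k z v" "\<And>t. t \<le> 0 \<Longrightarrow> apart n (drift t z v)"
  shows "enat k \<le> K TYPE('a) n"
proof -
  obtain x :: "nat \<Rightarrow> real \<Rightarrow> 'a" and T where x: "\<forall>t. free_at n x t \<or> hit_at n x t"
    "finite T" "card T = k" "\<forall>t\<in>T. hit_at n x t"
    using run_global_trajectory[OF assms] by blast
  have "evolution n x" by (rule lawful_evolution) (use x in blast)
  then have "num_collisions n x \<le> K TYPE('a) n" unfolding K_def by (intro SUP_upper) simp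
  then show ?thesis using many_collisions[OF x(2-4)] by (rule order_trans[rotated])
qed

section \<open>The ideal motion\<close>

definition adv :: "real \<Rightarrow> (nat \<Rightarrow> real) \<Rightarrow> (nat \<Rightarrow> real) \<Rightarrow> nat \<Rightarrow> real" where
  "adv t x u = (\<lambda>i. x i + t * u i)"

text \<open>
  Row balls are numbered from left to right, \<open>W\<close> being number \<open>m\<close>; column balls are numbered
  downwards, \<open>W\<close> being number 0. Let \<open>q 0\<close> be the vertical velocity of \<open>W\<close>. The tilt of the contacts of
  \<open>W\<close> makes the gaps of the row change as if ball \<open>i\<close> had velocity \<open>u i = P i - side m i * q 0\<close>, where
  \<open>P i\<close> is its rescaled horizontal velocity.
\<close>

definition side :: "nat \<Rightarrow> nat \<Rightarrow> real" where
  "side m i = (if i < m then 0 else if i = m then 1 else 2)"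

definition rows_open :: "nat \<Rightarrow> (nat \<Rightarrow> real) \<Rightarrow> bool" where
  "rows_open m x \<longleftrightarrow> (\<forall>c<2 * m. x c < x (Suc c))"

definition cols_open :: "nat \<Rightarrow> (nat \<Rightarrow> real) \<Rightarrow> bool" where
  "cols_open N y \<longleftrightarrow> (\<forall>e. Suc e < N \<longrightarrow> y (Suc e) < y e)"

text \<open>
  Column velocities \<open>q\<close> point upwards. The final condition \<open>u m = - q 0\<close> says that \<open>W\<close> has no
  horizontal velocity; it lets the column escape through the row in the limiting state.
\<close>

inductive irun :: "nat \<Rightarrow> nat \<Rightarrow> nat \<Rightarrow> (nat \<Rightarrow> real) \<Rightarrow> (nat \<Rightarrow> real) \<Rightarrow> (nat \<Rightarrow> real) \<Rightarrow> (nat \<Rightarrow> real) \<Rightarrow> bool"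
  for m N where
  irun_stop: "rows_open m u \<Longrightarrow> cols_open N q \<Longrightarrow> (\<And>e. e < N \<Longrightarrow> 0 < q e) \<Longrightarrow> u m = - q 0 \<Longrightarrow>
    irun m N 0 x u y q"
| irun_wait: "0 < t \<Longrightarrow> rows_open m (adv t x u) \<Longrightarrow> cols_open N (adv t y q) \<Longrightarrow>
    irun m N k (adv t x u) u (adv t y q) q \<Longrightarrow> irun m N k x u y q"
| irun_row: "0 < t \<Longrightarrow> c < 2 * m \<Longrightarrow> u (Suc c) < u c \<Longrightarrow> adv t x u c = adv t x u (Suc c) \<Longrightarrow>
    (\<And>d. d < 2 * m \<Longrightarrow> d \<noteq> c \<Longrightarrow> adv t x u d < adv t x u (Suc d)) \<Longrightarrow> cols_open N (adv t y q) \<Longrightarrow>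
    irun m N k (adv t x u) (u \<circ> Transposition.transpose c (Suc c)) (adv t y q) q \<Longrightarrow> irun m N (Suc k) x u y q"
| irun_col: "0 < t \<Longrightarrow> Suc e < N \<Longrightarrow> q e < q (Suc e) \<Longrightarrow> adv t y q e = adv t y q (Suc e) \<Longrightarrow>
    (\<And>d. Suc d < N \<Longrightarrow> d \<noteq> e \<Longrightarrow> adv t y q (Suc d) < adv t y q d) \<Longrightarrow> rows_open m (adv t x u) \<Longrightarrow>
    irun m N k (adv t x u) (\<lambda>i. u i - (if e = 0 then side m i * (q 1 - q 0) else 0))
      (adv t y q) (q \<circ> Transposition.transpose e (Suc e)) \<Longrightarrow> irun m N (Suc k) x u y q"

lemma adv_adv: "adv s (adv t x u) u = adv (t + s) x u"
  by (simp add: adv_def algebra_simps)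

section \<open>Sorting a row of points by velocity exchange\<close>

lemma permutes_strict_mono_id:
  fixes \<pi> :: "nat \<Rightarrow> nat"
  assumes p: "\<pi> permutes {..n}" and mono: "strict_mono_on {..n} \<pi>"
  shows "\<pi> = id"
proof
  have ge: "i \<le> f i" if "strict_mono_on {..n} f" "i \<le> n" for f :: "nat \<Rightarrow> nat" and i
    using that(2)
  proof (induction i)
    case (Suc i)
    then have "f i < f (Suc i)" using strict_mono_onD[OF that(1)] by auto
    then show ?case using Suc by simp
  qed simp
  have inv: "strict_mono_on {..n} (inv \<pi>)"
  proof (rule strict_mono_onI)
    fix i j assume ij: "i \<in> {..n}" "j \<in> {..n}" "i < j"
    have in_n: "inv \<pi> i \<in> {..n}" "inv \<pi> j \<in> {..n}"
      using ij permutes_in_image[OF permutes_inv[OF p]] by auto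
    show "inv \<pi> i < inv \<pi> j"
    proof (rule ccontr)
      assume "\<not> inv \<pi> i < inv \<pi> j"
      then have "\<pi> (inv \<pi> j) \<le> \<pi> (inv \<pi> i)"
        using strict_mono_onD[OF mono in_n(2,1)] by (cases "inv \<pi> j = inv \<pi> i") auto
      then show False using ij permutes_inverses[OF p] by simp
    qed
  qed
  fix i
  show "\<pi> i = id i"
  proof (cases "i \<le> n")
    case True
    then have "\<pi> i \<le> n" using permutes_in_image[OF p, of i] by simp
    then have "\<pi> i \<le> inv \<pi> (\<pi> i)" using ge[OF inv] by simp
    then show ?thesis using ge[OF mono True] permutes_inverses[OF p] by simp
  next
    case False
    then show ?thesis using p by (simp add: permutes_def)
  qed
qed

definition inversions :: "nat \<Rightarrow> (nat \<Rightarrow> real) \<Rightarrow> (nat \<times> nat) set" where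
  "inversions n u = {(i, k). i < k \<and> k \<le> n \<and> u k < u i}"

definition meeting :: "(nat \<Rightarrow> real) \<Rightarrow> (nat \<Rightarrow> real) \<Rightarrow> nat \<times> nat \<Rightarrow> real" where
  "meeting x u = (\<lambda>(i, k). (x k - x i) / (u i - u k))"

lemma finite_inversions [simp]: "finite (inversions n u)"
  by (rule finite_subset[of _ "{..n} \<times> {..n}"]) (auto simp: inversions_def)

lemma meeting_less_iff:
  assumes "u k < u i"
  shows "meeting x u (i, k) < t \<longleftrightarrow> adv t x u k < adv t x u i"
    and "t < meeting x u (i, k) \<longleftrightarrow> adv t x u i < adv t x u k"
    and "meeting x u (i, k) = t \<longleftrightarrow> adv t x u k = adv t x u i"
  using assms by (auto simp: meeting_def adv_def field_simps)

text \<open>Points that exchange velocities are free particles up to relabelling: every inverted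
  pair of straight lines crosses once, and after all crossings the order is the permutation
  \<open>\<pi>\<close> that sorts the velocities. The induction removes the earliest crossing;
  distinct meeting times make it the only one at its instant. The weak form of the order hypothesis
  admits a pair that has just exchanged velocities and still touches.\<close>

lemma row_phase:
  assumes "inj_on (meeting x u) (inversions (2 * m) u)" "\<And>p. p \<in> inversions (2 * m) u \<Longrightarrow> meeting x u p < T"
    and "\<And>c. c < 2 * m \<Longrightarrow> x c < x (Suc c) \<or> x c = x (Suc c) \<and> u c < u (Suc c)"
    and "\<pi> permutes {..2 * m}" "strict_mono_on {..2 * m} (u \<circ> \<pi>)"
    and "\<And>t. 0 < t \<Longrightarrow> t \<le> T \<Longrightarrow> cols_open N (adv t y q)" "0 < T"
    and "irun m N k (adv T x u \<circ> \<pi>) (u \<circ> \<pi>) (adv T y q) q"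
  shows "irun m N (card (inversions (2 * m) u) + k) x u y q"
  using assms
proof (induction "card (inversions (2 * m) u)" arbitrary: x u y \<pi> T)
  case 0
  then have no: "inversions (2 * m) u = {}" by simp
  have "inj_on u {..2 * m}"
    using strict_mono_on_imp_inj_on[OF "0.prems"(5)] permutes_image[OF "0.prems"(4)]
      permutes_inj_on[OF "0.prems"(4)] by (metis comp_inj_on_iff)
  moreover have "\<not> u k < u i" if "i < k" "k \<le> 2 * m" for i k
    using no that by (auto simp: inversions_def)
  ultimately have mono: "u i < u k" if "i < k" "k \<le> 2 * m" for i k
    using that by (metis atMost_iff inj_onD less_imp_le_nat linorder_neqE_linordered_idom nat_less_le order_trans)
  have "strict_mono_on {..2 * m} \<pi>"
  proof (rule strict_mono_onI)
    fix i k assume ik: "i \<in> {..2 * m}" "k \<in> {..2 * m}" "i < k"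
    then have "u (\<pi> i) < u (\<pi> k)" using strict_mono_onD[OF "0.prems"(5)] by fastforce
    moreover have "\<pi> i \<le> 2 * m" "\<pi> k \<le> 2 * m" using ik permutes_in_image[OF "0.prems"(4)] by auto
    ultimately show "\<pi> i < \<pi> k" using mono[of "\<pi> k" "\<pi> i"]
      by (cases "\<pi> i" "\<pi> k" rule: linorder_cases) auto
  qed
  then have "\<pi> = id" using permutes_strict_mono_id[OF "0.prems"(4)] by simp
  moreover have "adv T x u c < adv T x u (Suc c)" if "c < 2 * m" for c
  proof -
    have "T * u c < T * u (Suc c)" using mono that "0.prems"(7) by simp
    then show ?thesis using "0.prems"(3)[OF that] by (auto simp: adv_def)
  qed
  ultimately show ?case
    using irun_wait[of T m x u N y q k] "0.prems" no by (simp add: rows_open_def)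
next
  case (Suc l)
  let ?I = "inversions (2 * m) u"
  have ord: "x i < x k \<or> x i = x k \<and> u i < u k" if "i < k" "k \<le> 2 * m" for i k
    using that
  proof (induction k)
    case (Suc k)
    then show ?case using Suc.prems Suc.IH "Suc.prems"(1) \<open>\<And>c. c < 2 * m \<Longrightarrow> x c < x (Suc c) \<or> _\<close>[of k]
      by (cases "i = k") auto
  qed simp
  have "?I \<noteq> {}" using Suc.hyps(2) by auto
  then obtain p where p: "p \<in> ?I" and pmin: "\<And>p'. p' \<in> ?I \<Longrightarrow> meeting x u p \<le> meeting x u p'"
    using ex_min_if_finite[of "meeting x u ` ?I"] by (auto simp: not_less)
  obtain c c' where cc: "p = (c, c')" by (cases p)
  define t where "t = meeting x u p"
  have later: "t < meeting x u p'" if "p' \<in> ?I" "p' \<noteq> p" for p'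
    using pmin[OF that(1)] inj_onD[OF Suc.prems(1) _ p that(1)] that(2) t_def by (metis order_le_less)
  have c: "c < c'" "c' \<le> 2 * m" "u c' < u c" using p by (auto simp: inversions_def cc)
  have meet: "adv t x u c' = adv t x u c" using meeting_less_iff(3)[OF c(3), of x t] by (simp add: t_def cc)
  have t: "0 < t" "t < T" using ord[OF c(1,2)] c Suc.prems(2)[OF p] by (auto simp: t_def cc meeting_def)
  \<comment> \<open>A ball \<open>l\<close> strictly between would be crossed too early. If it is
    slower than \<open>c\<close>, it is still ahead of \<open>c\<close> at time \<open>t\<close>,
    hence has already passed \<open>c'\<close>; otherwise it has caught up with \<open>c'\<close> by
    time \<open>t\<close>.\<close>
  have adj: "c' = Suc c"
  proof (rule ccontr)
    assume "c' \<noteq> Suc c"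
    then obtain l where l: "c < l" "l < c'" using c by (metis Suc_lessI lessI)
    show False
    proof (cases "u l < u c")
      case True
      then have "adv t x u c < adv t x u l"
        using later[of "(c, l)"] l c meeting_less_iff(2) by (auto simp: inversions_def cc)
      moreover have "x l \<le> x c'" using ord[of l c'] l c by auto
      ultimately have "adv t x u c' < adv t x u l" "u c' < u l"
        using meet t by (auto simp: adv_def) (smt (verit) mult_left_mono)
      then show False using later[of "(l, c')"] l c meeting_less_iff(2)[of u c' l t x] by (auto simp: inversions_def cc)
    next
      case False
      then have "adv t x u c \<le> adv t x u l" using ord[of c l] l c t by (auto simp: adv_def intro!: add_mono)
      then show False
        using later[of "(l, c')"] False l c meet meeting_less_iff(2)[of u c' l t x] by (auto simp: inversions_def cc)
    qed
  qed
  let ?s = "Transposition.transpose c (Suc c)"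
  let ?x = "adv t x u" and ?u = "u \<circ> Transposition.transpose c (Suc c)"
  have xs: "?x (?s i) = ?x i" for i using meet adj by (simp add: Transposition.transpose_def)
  have strict: "?x d < ?x (Suc d)" if "d < 2 * m" "d \<noteq> c" for d
  proof (cases "u (Suc d) < u d")
    case True
    then show ?thesis using later[of "(d, Suc d)"] that adj meeting_less_iff(2) by (auto simp: inversions_def cc)
  next
    case False
    then show ?thesis using ord[of d "Suc d"] that t by (auto simp: adv_def intro: add_less_le_mono)
  qed
  let ?\<phi> = "map_prod ?s ?s"
  \<comment> \<open>The exchange relabels the other inverted pairs and removes just
    \<open>p\<close>; absolute meeting times are unaffected, so relative ones drop by
    \<open>t\<close>.\<close>
  have inv': "inversions (2 * m) ?u = ?\<phi> ` (?I - {p})"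
  proof (intro equalityI subsetI)
    fix p' assume p': "p' \<in> inversions (2 * m) ?u"
    then have "?\<phi> p' \<in> ?I - {p}"
      using c by (auto simp: inversions_def cc adj Transposition.transpose_def split: if_splits)
    then show "p' \<in> ?\<phi> ` (?I - {p})"
      by (intro image_eqI[of _ _ "?\<phi> p'"]) (auto simp: map_prod_def split: prod.splits)
  next
    fix p' assume "p' \<in> ?\<phi> ` (?I - {p})"
    then show "p' \<in> inversions (2 * m) ?u"
      using c by (auto simp: inversions_def cc adj Transposition.transpose_def split: if_splits)
  qed
  have inj\<phi>: "inj_on ?\<phi> A" for A by (rule inj_on_inverseI[where g = ?\<phi>]) (auto simp: map_prod_def split: prod.splits)
  have card': "card (inversions (2 * m) ?u) = l"
    using Suc.hyps(2) p by (simp add: inv' card_image[OF inj\<phi>])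
  have meet': "meeting ?x ?u (?\<phi> p') = meeting x u p' - t" if "p' \<in> ?I" for p'
  proof -
    obtain i k where ik: "p' = (i, k)" by (cases p')
    then have "u k < u i" using that by (simp add: inversions_def)
    then show ?thesis unfolding ik meeting_def map_prod_def prod.case xs comp_apply transpose_involutory
      by (simp add: adv_def field_simps)
  qed
  have "irun m N (card (inversions (2 * m) ?u) + k) ?x ?u (adv t y q) q"
  proof (rule Suc.hyps(1)[of ?u ?x "T - t" "?s \<circ> \<pi>"])
    show "inj_on (meeting ?x ?u) (inversions (2 * m) ?u)"
      unfolding inv'
    proof (rule inj_onI)
      fix r r' assume r: "r \<in> ?\<phi> ` (?I - {p})" "r' \<in> ?\<phi> ` (?I - {p})" "meeting ?x ?u r = meeting ?x ?u r'"
      then obtain s s' where s: "s \<in> ?I" "r = ?\<phi> s" "s' \<in> ?I" "r' = ?\<phi> s'"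
        by (elim imageE DiffE)
      then have "meeting x u s = meeting x u s'" using r(3) meet'[OF s(1)] meet'[OF s(3)] by simp
      then show "r = r'" using inj_onD[OF Suc.prems(1) _ s(1,3)] s by simp
    qed
    show "meeting ?x ?u p' < T - t" if "p' \<in> inversions (2 * m) ?u" for p'
      using that meet' Suc.prems(2) unfolding inv' by force
    show "?x d < ?x (Suc d) \<or> ?x d = ?x (Suc d) \<and> ?u d < ?u (Suc d)" if "d < 2 * m" for d
      using strict[OF that] meet c adj by (cases "d = c") (auto simp: Transposition.transpose_def)
    show "?s \<circ> \<pi> permutes {..2 * m}"
      using c adj by (intro permutes_compose Suc.prems permutes_swap_id) auto
    show "strict_mono_on {..2 * m} (?u \<circ> (?s \<circ> \<pi>))"
      using Suc.prems(5) by (simp add: comp_def)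
    show "cols_open N (adv t' (adv t y q) q)" if "0 < t'" "t' \<le> T - t" for t'
      using Suc.prems(6)[of "t + t'"] that t by (simp add: adv_adv)
    have e: "adv (T - t) ?x ?u \<circ> (?s \<circ> \<pi>) = adv T x u \<circ> \<pi>"
    proof
      fix i
      have "?x (?s (\<pi> i)) = ?x (\<pi> i)" by (rule xs)
      then show "(adv (T - t) ?x ?u \<circ> (?s \<circ> \<pi>)) i = (adv T x u \<circ> \<pi>) i"
        by (simp add: adv_def[of "T - t"]) (simp add: adv_def algebra_simps)
    qed
    have e2: "?u \<circ> (?s \<circ> \<pi>) = u \<circ> \<pi>" by (simp add: comp_def)
    show "irun m N k (adv (T - t) ?x ?u \<circ> (?s \<circ> \<pi>)) (?u \<circ> (?s \<circ> \<pi>)) (adv (T - t) (adv t y q) q) q"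
      unfolding e e2 using Suc.prems(8) by (simp add: adv_adv)
  qed (use card' t in simp_all)
  then have "irun m N (l + k) ?x ?u (adv t y q) q" by (simp add: card')
  then have "irun m N (Suc (l + k)) x u y q"
    by (rule irun_row[of t c, rotated -1]) (use t c adj meet strict Suc.prems(6) in simp_all)
  then show ?case unfolding Suc.hyps(2)[symmetric] by simp
qed

section \<open>Pulses travelling up the column\<close>

text \<open>
  The pulse \<open>l\<close> moves along the line \<open>w l + speed l * t\<close>, and collisions only relabel who carries it:
  while pulse \<open>j\<close> passes through the column, \<open>occupant j i e\<close> is the pulse carried by column ball \<open>e\<close>
  when pulse \<open>j\<close> has arrived at column ball \<open>i\<close>.
\<close>

definition speed :: "nat \<Rightarrow> real" where
  "speed l = real (2 * l + 1)"

lemma speed_less [simp]: "speed a < speed b \<longleftrightarrow> a < b"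
  by (simp add: speed_def)

lemma speed_pos [simp]: "0 < speed a"
  by (simp add: speed_def)

definition occupant :: "nat \<Rightarrow> nat \<Rightarrow> nat \<Rightarrow> nat" where
  "occupant j i e = (if e < i then j - 1 - e else if e = i then j else if e \<le> j then j - e else e)"

definition colpos :: "(nat \<Rightarrow> real) \<Rightarrow> nat \<Rightarrow> nat \<Rightarrow> real \<Rightarrow> nat \<Rightarrow> real" where
  "colpos w j i t = (\<lambda>e. w (occupant j i e) + speed (occupant j i e) * t)"

definition colvel :: "nat \<Rightarrow> nat \<Rightarrow> nat \<Rightarrow> real" where
  "colvel j i = (\<lambda>e. speed (occupant j i e))"

abbreviation line :: "(nat \<Rightarrow> real) \<Rightarrow> nat \<Rightarrow> real \<Rightarrow> real" where
  "line w l t \<equiv> w l + speed l * t"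

lemma occupant_last: "occupant j 0 = occupant (Suc j) (Suc j)"
  by (rule ext) (auto simp: occupant_def)

lemma adv_colpos: "adv s (colpos w j i t) (colvel j i) = colpos w j i (t + s)"
  by (simp add: adv_def colpos_def colvel_def algebra_simps)

lemma line_later:
  assumes "line w a t < line w b t" "speed a \<le> speed b" "t \<le> s"
  shows "line w a s < line w b s"
proof -
  have "speed a * (s - t) \<le> speed b * (s - t)" using assms by (intro mult_right_mono) auto
  then show ?thesis using assms(1) by (simp add: algebra_simps)
qed

lemma line_earlier:
  assumes "line w a t < line w b t" "speed b \<le> speed a" "s \<le> t"
  shows "line w a s < line w b s"
proof -
  have "speed b * (t - s) \<le> speed a * (t - s)" using assms by (intro mult_right_mono) auto
  then show ?thesis using assms(1) by (simp add: algebra_simps)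
qed

text \<open>Pulses below \<open>j\<close> have passed, a faster one lying above a slower one; the
  pulses from \<open>j\<close> on are still below pulse 0, the lowest of those, and a faster one
  lies below a slower one. As speeds increase with the number, the first order persists into the
  future and the order in \<open>pending\<close> into the past.\<close>

definition sorted_lines :: "(nat \<Rightarrow> real) \<Rightarrow> nat \<Rightarrow> real \<Rightarrow> bool" where
  "sorted_lines w j t \<longleftrightarrow> (\<forall>l. Suc l < j \<longrightarrow> line w l t < line w (Suc l) t)"

definition pending :: "nat \<Rightarrow> (nat \<Rightarrow> real) \<Rightarrow> nat \<Rightarrow> real \<Rightarrow> bool" where
  "pending N w j t \<longleftrightarrow> (j < N \<longrightarrow> line w j t < line w 0 t) \<and>
     (\<forall>l. j \<le> l \<and> Suc l < N \<longrightarrow> line w (Suc l) t < line w l t)"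

lemma sorted_lines_later: "sorted_lines w j t \<Longrightarrow> t \<le> s \<Longrightarrow> sorted_lines w j s"
  unfolding sorted_lines_def using line_later by (metis speed_less less_imp_le lessI)

lemma pending_earlier: "pending N w j t \<Longrightarrow> 0 < j \<Longrightarrow> s \<le> t \<Longrightarrow> pending N w j s"
  unfolding pending_def using line_earlier by (metis speed_less less_imp_le lessI)

lemma sorted_lines_less:
  assumes "sorted_lines w j t" "a < b" "b < j"
  shows "line w a t < line w b t"
  using assms(2,3)
proof (induction b)
  case (Suc b)
  have "line w b t < line w (Suc b) t" using assms(1) Suc.prems by (simp add: sorted_lines_def)
  then show ?case using Suc by (cases "a = b") auto
qed simp

lemma cols_open_idle:
  assumes "sorted_lines w j t" "pending N w j t" "0 < j"
  shows "cols_open N (colpos w j j t)"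
  unfolding cols_open_def
proof (intro allI impI)
  fix e assume e: "Suc e < N"
  consider "Suc e < j" | "Suc e = j" | "j \<le> e" by linarith
  then show "colpos w j j t (Suc e) < colpos w j j t e"
  proof cases
    case 1
    have "line w (j - 1 - Suc e) t < line w (j - 1 - e) t"
      using 1 by (intro sorted_lines_less[OF assms(1)]) auto
    then show ?thesis using 1 by (simp add: colpos_def occupant_def)
  next
    case 2
    then show ?thesis using assms(2) e by (auto simp: colpos_def occupant_def pending_def)
  next
    case 3
    then show ?thesis using assms(2) e by (auto simp: colpos_def occupant_def pending_def)
  qed
qed

lemma column_pulse:
  assumes "0 < j" "j < N" and srt: "sorted_lines w j t0" and new: "line w j t0 < line w 0 t0"
    and \<tau>: "t0 < \<tau>" "line w j \<tau> = line w (j - 1) \<tau>" "\<tau> \<le> te" and pend: "pending N w (Suc j) te"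
    and row: "rows_open m x" "rows_open m u"
    and kick: "irun m N k (adv (\<tau> - t0) x u) (\<lambda>i. u i - side m i * 2) (colpos w j 0 \<tau>) (colvel j 0)"
  shows "irun m N (j + k) x u (colpos w j j t0) (colvel j j)"
proof -
  \<comment> \<open>The time at which the lines of the pulses \<open>j\<close> and \<open>l\<close>
    cross.\<close>
  define c where "c l = (w l - w j) / (speed j - speed l)" for l
  have c: "t < c l \<longleftrightarrow> line w j t < line w l t" "c l < t \<longleftrightarrow> line w l t < line w j t"
      "c l = t \<longleftrightarrow> line w j t = line w l t" if "l < j" for l t
  proof -
    have lt: "speed l < speed j" using that by simp
    have "0 < speed j - speed l" "speed j \<noteq> speed l" using lt by linarith+
    then show "t < c l \<longleftrightarrow> line w j t < line w l t" "c l < t \<longleftrightarrow> line w l t < line w j t"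
      "c l = t \<longleftrightarrow> line w j t = line w l t"
      unfolding c_def by (simp_all add: pos_less_divide_eq pos_divide_less_eq divide_eq_eq, auto simp: algebra_simps)
  qed
  have c0: "t0 < c l" if "l < j" for l
    using new sorted_lines_less[OF srt, of 0 l] that by (cases "l = 0") (auto simp: c)
  \<comment> \<open>Where pulse \<open>j\<close> crosses line \<open>l\<close>, line
    \<open>Suc l\<close> is strictly above, hence not yet crossed.\<close>
  have cS: "c l < c (Suc l)" if "Suc l < j" for l
  proof -
    have "line w j (c l) = line w l (c l)" using that c(3)[of l "c l"] by simp
    also have "\<dots> < line w (Suc l) (c l)"
      using sorted_lines_later[OF srt, of "c l"] c0[of l] that by (auto simp: sorted_lines_def)
    finally show ?thesis using c(1) that by simp
  qed
  have c\<tau>: "c (j - 1) = \<tau>" using c(3)[of "j - 1" \<tau>] assms(1) \<tau>(2) by simp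
  have c1: "c l \<le> \<tau>" if "l < j" for l
    using that
  proof (induction "j - l" arbitrary: l)
    case (Suc d)
    show ?case
    proof (cases "Suc l < j")
      case True
      then have "c (Suc l) \<le> \<tau>" using Suc by auto
      then show ?thesis using cS[OF True] by simp
    next
      case False
      then have "l = j - 1" using Suc by simp
      then show ?thesis using c\<tau> by simp
    qed
  qed simp
  have rows: "rows_open m (adv s x u)" if "0 \<le> s" for s
    unfolding rows_open_def adv_def
  proof (intro allI impI add_less_le_mono)
    fix c assume "c < 2 * m"
    then show "x c < x (Suc c)" "s * u c \<le> s * u (Suc c)"
      using row that by (auto simp: rows_open_def intro: mult_left_mono less_imp_le)
  qed
  \<comment> \<open>At time \<open>c (j - i)\<close> the pulse on ball \<open>i\<close> meets ball
    \<open>i - 1\<close>. Contacts elsewhere among passed pulses are open by sortedness, the one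
    directly below the pulse because that line was crossed earlier, and those at the lower end
    because the remaining pulses are pending.\<close>
  have open_other: "colpos w j i T (Suc d) < colpos w j i T d"
    if d: "Suc d < N" "Suc d \<noteq> i" and i: "i \<le> j" "0 < i" and T: "T = c (j - i)" for i d T
  proof -
    have ji: "j - i < j" using i assms by simp
    have T0: "t0 < T" "T \<le> te" using c0[OF ji] c1[OF ji] \<tau> T by auto
    note srtT = sorted_lines_less[OF sorted_lines_later[OF srt less_imp_le[OF T0(1)]]]
    have pendT: "pending N w (Suc j) T" by (rule pending_earlier[OF pend _ T0(2)]) simp
    consider "Suc d < i" | "d = i" "i < j" | "i < d" "d < j" | "d = j" | "j < d" using d i by linarith
    then show ?thesis
    proof cases
      case 1
      then show ?thesis using srtT[of "j - 1 - Suc d" "j - 1 - d"] i by (simp add: colpos_def occupant_def)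
    next
      case 2
      have "c (j - Suc i) < T" using cS[of "j - Suc i"] 2 i by (simp add: T Suc_diff_Suc)
      then show ?thesis using c(2)[of "j - Suc i" T] 2 i by (simp add: colpos_def occupant_def)
    next
      case 3
      then show ?thesis using srtT[of "j - Suc d" "j - d"] i by (simp add: colpos_def occupant_def)
    next
      case 4
      have "line w j T = line w 0 T" if "i = j" using T c(3)[of 0 T] that i by simp
      then show ?thesis using 4 pendT d i by (auto simp: colpos_def occupant_def pending_def)
    next
      case 5
      then show ?thesis using pendT d i by (auto simp: colpos_def occupant_def pending_def)
    qed
  qed
  have swap: "colvel j (Suc i) \<circ> Transposition.transpose i (Suc i) = colvel j i"
    "colpos w j (Suc i) (c (j - Suc i)) = colpos w j i (c (j - Suc i))" if i: "Suc i \<le> j" for i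
  proof -
    have "line w j (c (j - Suc i)) = line w (j - Suc i) (c (j - Suc i))"
      using c(3)[of "j - Suc i" "c (j - Suc i)"] i by simp
    then show "colpos w j (Suc i) (c (j - Suc i)) = colpos w j i (c (j - Suc i))"
      using i by (auto simp: colpos_def occupant_def fun_eq_iff less_Suc_eq)
    show "colvel j (Suc i) \<circ> Transposition.transpose i (Suc i) = colvel j i"
      using i by (auto simp: colvel_def occupant_def fun_eq_iff Transposition.transpose_def)
  qed
  \<comment> \<open>Induction on the ball \<open>i\<close> reached by the pulse, which is also the
    number of column impacts it still has to make.\<close>
  have "irun m N (i + k) (adv (t - t0) x u) u (colpos w j i t) (colvel j i)"
    if "0 < i" "i \<le> j" "t0 \<le> t" "t < c (j - i)" for i t
    using that
  proof (induction i arbitrary: t)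
    case (Suc i)
    let ?T = "c (j - Suc i)"
    have cp: "adv (?T - t) (colpos w j (Suc i) t) (colvel j (Suc i)) = colpos w j (Suc i) ?T"
      by (simp add: adv_colpos)
    have next': "irun m N (i + k) (adv (?T - t0) x u)
       (\<lambda>l. u l - (if i = 0 then side m l * (colvel j (Suc i) 1 - colvel j (Suc i) 0) else 0))
       (colpos w j i ?T) (colvel j i)"
    proof (cases "i = 0")
      case True
      then have "colvel j (Suc i) 1 - colvel j (Suc i) 0 = 2"
        using Suc.prems by (auto simp: colvel_def occupant_def speed_def)
      then show ?thesis using True kick c\<tau> by simp
    next
      case False
      have "?T < c (j - i)" using cS[of "j - Suc i"] False Suc.prems by (simp add: Suc_diff_Suc)
      then show ?thesis using False Suc.IH[of ?T] Suc.prems by simp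
    qed
    have "colpos w j i ?T i = colpos w j (Suc i) ?T i" using swap(2) Suc.prems by simp
    have meet: "colpos w j (Suc i) ?T i = colpos w j (Suc i) ?T (Suc i)"
      using Suc.prems c(3)[of "j - Suc i" ?T] by (simp add: colpos_def occupant_def)
    have "irun m N (Suc (i + k)) (adv (t - t0) x u) u (colpos w j (Suc i) t) (colvel j (Suc i))"
    proof (rule irun_col[of "?T - t" i])
      show "0 < ?T - t" "Suc i < N" using Suc.prems assms by auto
      show "colvel j (Suc i) i < colvel j (Suc i) (Suc i)" using Suc.prems by (simp add: colvel_def occupant_def)
      show "adv (?T - t) (colpos w j (Suc i) t) (colvel j (Suc i)) i =
            adv (?T - t) (colpos w j (Suc i) t) (colvel j (Suc i)) (Suc i)"
        unfolding cp by (rule meet)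
      show "adv (?T - t) (colpos w j (Suc i) t) (colvel j (Suc i)) (Suc d)
          < adv (?T - t) (colpos w j (Suc i) t) (colvel j (Suc i)) d" if "Suc d < N" "d \<noteq> i" for d
        unfolding cp using open_other[of d "Suc i"] that Suc.prems by simp
      have a: "adv (?T - t) (adv (t - t0) x u) u = adv (?T - t0) x u" by (simp add: adv_adv)
      show "rows_open m (adv (?T - t) (adv (t - t0) x u) u)"
        unfolding a using rows Suc.prems by simp
      show "irun m N (i + k) (adv (?T - t) (adv (t - t0) x u) u)
         (\<lambda>l. u l - (if i = 0 then side m l * (colvel j (Suc i) 1 - colvel j (Suc i) 0) else 0))
         (adv (?T - t) (colpos w j (Suc i) t) (colvel j (Suc i)))
         (colvel j (Suc i) \<circ> Transposition.transpose i (Suc i))"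
        unfolding a cp using next' swap[of i] Suc.prems by simp
    qed
    then show ?case by simp
  qed simp
  from this[of j t0] show ?thesis using assms c0[of 0] by (simp add: adv_def)
qed

section \<open>Kicks and generic row velocities\<close>

definition across :: "nat \<Rightarrow> (nat \<times> nat) set" where
  "across m = {(i, k). i \<le> m \<and> m \<le> k \<and> k \<le> 2 * m \<and> i < k}"

text \<open>Relative velocity per unit of \<open>side\<close>. A kick subtracts
  \<open>2 * side m i\<close>, thus lowers every slope by 2, uniformly over all pairs that it
  affects.\<close>

definition slope :: "nat \<Rightarrow> (nat \<Rightarrow> real) \<Rightarrow> nat \<times> nat \<Rightarrow> real" where
  "slope m u = (\<lambda>(i, k). (u k - u i) / (side m k - side m i))"

text \<open>The order reached once all pairs in \<open>across m\<close> have met: the two halves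
  trade places, each keeping its inner order, and the middle place is kept.\<close>

definition exchange :: "nat \<Rightarrow> nat \<Rightarrow> nat" where
  "exchange m i = (if i < m then i + m + 1 else if i = m then m else if i \<le> 2 * m then i - (m + 1) else i)"

text \<open>
  Consecutive pulses differ in speed by 2, so the bound 2 on the slopes ensures that a kick inverts
  every pair in \<open>across m\<close>; distinct slopes give distinct meeting times for almost all kick times.
\<close>

definition generic :: "nat \<Rightarrow> (nat \<Rightarrow> real) \<Rightarrow> bool" where
  "generic m u \<longleftrightarrow> rows_open m u \<and> inj_on (slope m u) (across m) \<and> (\<forall>p\<in>across m. slope m u p < 2)"

lemma rows_open_less: "rows_open m u \<Longrightarrow> i < k \<Longrightarrow> k \<le> 2 * m \<Longrightarrow> u i < u k"
proof (induction k)
  case (Suc k)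
  then have "u k < u (Suc k)" by (simp add: rows_open_def)
  then show ?case using Suc by (cases "i = k") auto
qed simp

lemma card_across: "card (across m) = m * m + 2 * m"
proof -
  have "across m = {..m} \<times> {m..2 * m} - {(m, m)}" by (auto simp: across_def)
  then show ?thesis by (simp add: card_Diff_singleton algebra_simps)
qed

lemma finite_across [simp]: "finite (across m)"
  by (rule finite_subset[of _ "{..m} \<times> {..2 * m}"]) (auto simp: across_def)

lemma side_across: "(i, k) \<in> across m \<Longrightarrow> side m i < side m k"
  by (auto simp: across_def side_def)

lemma exchange_across:
  assumes "(i, k) \<in> across m"
  shows "(exchange m k, exchange m i) \<in> across m"
    "side m (exchange m i) - side m (exchange m k) = side m k - side m i"
  using assms by (auto simp: across_def exchange_def side_def)

lemma exchange_permutes: "exchange m permutes {..2 * m}"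
proof (rule bij_imp_permutes)
  have "exchange m (exchange m i) = i" for i by (auto simp: exchange_def)
  then have "bij_betw (exchange m) {..2 * m} {..2 * m}"
    by (intro bij_betw_byWitness[where f' = "exchange m"]) (auto simp: exchange_def split: if_splits)
  then show "bij_betw (exchange m) {..2 * m} {..2 * m}" .
qed (simp add: exchange_def)

lemma exchange_involutive: "exchange m (exchange m i) = i"
  by (auto simp: exchange_def)

lemma inversions_kick:
  assumes "generic m u"
  shows "inversions (2 * m) (\<lambda>i. u i - side m i * 2) = across m"
proof -
  have less: "u i < u k" if "i < k" "k \<le> 2 * m" for i k
    using assms rows_open_less that by (auto simp: generic_def)
  have "u k - side m k * 2 < u i - side m i * 2 \<longleftrightarrow> (i, k) \<in> across m" if "i < k" "k \<le> 2 * m" for i k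
  proof (cases "(i, k) \<in> across m")
    case True
    then have "slope m u (i, k) < 2" using assms by (auto simp: generic_def)
    then show ?thesis using side_across[OF True] True by (simp add: slope_def field_simps)
  next
    case False
    then have "side m i = side m k" using that by (auto simp: across_def side_def)
    then show ?thesis using False less[OF that] by simp
  qed
  then show ?thesis by (auto simp: inversions_def across_def)
qed

text \<open>The kick lowers a slope s to s - 2, and the subsequent exchange of the two ends flips
  the sign, giving 2 - s. The map s -> 2 - s preserves distinctness and the range between 0 and 2;
  positivity of the old slopes yields the new upper bound, and the old upper bound yields that
  neighbours across \<open>W\<close> separate again.\<close>

lemma generic_kick:
  assumes "generic m u"
  defines "u' \<equiv> (\<lambda>i. u i - side m i * 2) \<circ> exchange m"
  shows "generic m u'"
proof -
  have less: "u i < u k" if "i < k" "k \<le> 2 * m" for i k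
    using assms rows_open_less that by (auto simp: generic_def)
  have sl: "slope m u' (i, k) = 2 - slope m u (exchange m k, exchange m i)" if "(i, k) \<in> across m" for i k
  proof -
    have s: "side m (exchange m i) - side m (exchange m k) = side m k - side m i" "side m i < side m k"
      using exchange_across(2)[OF that] side_across[OF that] by auto
    have "u' k - u' i = 2 * (side m k - side m i) - (u (exchange m i) - u (exchange m k))"
      using s by (simp add: u'_def)
    moreover define D where "D = side m k - side m i"
    ultimately have "slope m u' (i, k) = (2 * D - (u (exchange m i) - u (exchange m k))) / D"
      by (simp add: slope_def)
    also have "\<dots> = 2 - (u (exchange m i) - u (exchange m k)) / D"
    proof -
      have "0 < D" using s(2) by (simp add: D_def)
      then show ?thesis by (simp add: diff_divide_distrib)
    qed
    finally have "slope m u' (i, k) =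
        2 - (u (exchange m i) - u (exchange m k)) / (side m k - side m i)" by (simp only: D_def)
    then show ?thesis by (simp only: slope_def prod.case s(1))
  qed
  have pos: "0 < slope m u p" if "p \<in> across m" for p
    using that less side_across by (cases p) (auto simp: slope_def across_def)
  have "u' c < u' (Suc c)" if c: "c < 2 * m" for c
  proof (cases "(c, Suc c) \<in> across m")
    case True
    have "0 < slope m u' (c, Suc c)"
      using sl[OF True] exchange_across(1)[OF True] assms(1) by (auto simp: generic_def)
    then show ?thesis using side_across[OF True] by (simp add: slope_def zero_less_divide_iff)
  next
    case False
    then consider "Suc c < m" | "m < c" using c by (auto simp: across_def)
    then show ?thesis
    proof cases
      case 1
      then show ?thesis using less[of "c + m + 1" "Suc c + m + 1"] by (simp add: u'_def exchange_def side_def)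
    next
      case 2
      then show ?thesis using less[of "c - (m + 1)" "Suc c - (m + 1)"] c
        by (auto simp: u'_def exchange_def side_def)
    qed
  qed
  moreover have "inj_on (slope m u') (across m)"
  proof (rule inj_onI, clarify)
    fix i k i' k' assume p: "(i, k) \<in> across m" "(i', k') \<in> across m" "slope m u' (i, k) = slope m u' (i', k')"
    then have "(exchange m k, exchange m i) = (exchange m k', exchange m i')"
      using assms(1) exchange_across(1) sl by (auto simp: generic_def dest!: inj_onD)
    then show "i = i' \<and> k = k'" by (metis exchange_involutive prod.inject)
  qed
  moreover have "slope m u' p < 2" if "p \<in> across m" for p
    using that sl exchange_across(1) pos by (cases p) force
  ultimately show ?thesis by (auto simp: generic_def rows_open_def)
qed

lemma eventually_affine_neq:
  fixes a b c d :: real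
  assumes "b \<noteq> d"
  shows "\<forall>\<^sub>F t in at_top. a + b * t \<noteq> c + d * t"
proof -
  have "a + b * t \<noteq> c + d * t" if "t > (c - a) / (b - d)" for t
  proof
    assume "a + b * t = c + d * t"
    then have "t * (b - d) = c - a" by (simp add: algebra_simps)
    then have "t = (c - a) / (b - d)" using assms by (simp add: eq_divide_eq)
    then show False using that by simp
  qed
  then show ?thesis by (auto simp: eventually_at_top_dense)
qed

text \<open>Before the kick a pair of slope s separates proportionally to s, afterwards it closes
  proportionally to 2 - s. Its meeting time is therefore affine in the delay \<open>t\<close> with
  coefficient s / (2 - s). This coefficient is injective in s, so two such functions agree for at
  most one delay.\<close>

lemma eventually_kick_generic:
  assumes "generic m u"
  shows "\<forall>\<^sub>F t in at_top. inj_on (meeting (adv t x u) (\<lambda>i. u i - side m i * 2)) (across m)"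
proof -
  let ?f = "\<lambda>t. meeting (adv t x u) (\<lambda>i. u i - side m i * 2)"
  have form: "\<exists>a. \<forall>t. ?f t p = a + slope m u p / (2 - slope m u p) * t" if "p \<in> across m" for p
  proof -
    obtain i k where p: "p = (i, k)" by (cases p)
    let ?d = "side m k - side m i"
    have d: "0 < ?d" "slope m u p < 2" using that side_across assms by (auto simp: p generic_def)
    have s: "u k - u i = slope m u p * ?d" using d by (simp add: p slope_def)
    have "u i - side m i * 2 - (u k - side m k * 2) = (2 - slope m u p) * ?d" using s by (simp add: algebra_simps)
    moreover have "adv t x u k - adv t x u i = (x k - x i) + slope m u p * ?d * t" for t
      unfolding s[symmetric] by (simp add: adv_def algebra_simps)
    ultimately have "?f t p = ((x k - x i) + slope m u p * ?d * t) / ((2 - slope m u p) * ?d)" for t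
      by (simp add: p meeting_def)
    then have "?f t p = (x k - x i) / ((2 - slope m u p) * ?d) + slope m u p / (2 - slope m u p) * t" for t
      using d by (simp add: add_divide_distrib)
    then show ?thesis by blast
  qed
  have "\<forall>\<^sub>F t in at_top. ?f t p \<noteq> ?f t p'" if pp: "p \<in> across m" "p' \<in> across m" "p \<noteq> p'" for p p'
  proof -
    have "slope m u p \<noteq> slope m u p'" "slope m u p < 2" "slope m u p' < 2"
      using assms pp inj_on_eq_iff[of "slope m u" "across m" p p'] by (auto simp: generic_def)
    then have "slope m u p / (2 - slope m u p) \<noteq> slope m u p' / (2 - slope m u p')"
      by (simp add: frac_eq_eq algebra_simps)
    note neq = eventually_affine_neq[OF this]
    obtain a where a: "?f t p = a + slope m u p / (2 - slope m u p) * t" for t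
      using form[OF pp(1)] by blast
    obtain a' where a': "?f t p' = a' + slope m u p' / (2 - slope m u p') * t" for t
      using form[OF pp(2)] by blast
    show ?thesis unfolding a a' by (rule neq)
  qed
  then have "\<forall>\<^sub>F t in at_top. \<forall>p\<in>across m. \<forall>p'\<in>across m. p \<noteq> p' \<longrightarrow> ?f t p \<noteq> ?f t p'"
    by (simp add: eventually_ball_finite_distrib)
  then show ?thesis by eventually_elim (auto simp: inj_on_def)
qed

text \<open>The delay of a pulse depends on the state of the row that it finds, so the lines are
  chosen in order of arrival: only \<open>w\<close> below \<open>j\<close> is given, and
  \<open>w'\<close> supplies the rest. Accordingly the induction runs downwards from
  \<open>N\<close> with arbitrary row state, lines and starting time.\<close>

lemma irun_pulses:
  assumes "0 < m" "0 < j" "j \<le> N"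
    and "generic m u" "rows_open m x" "u m = - speed (j - 1)" "sorted_lines w j t0"
  shows "\<exists>w'. (\<forall>l<j. w' l = w l) \<and> pending N w' j t0 \<and>
    irun m N (\<Sum>l=j..<N. l + (m * m + 2 * m)) x u (colpos w' j j t0) (colvel j j)"
  using assms(3,2,4-)
proof (induction j arbitrary: x u w t0 rule: inc_induct)
  case base
  have "irun m N 0 x u (colpos w N N t0) (colvel N N)"
  proof (rule irun_stop)
    show "cols_open N (colvel N N)" using base(1) by (auto simp: cols_open_def colvel_def occupant_def)
  qed (use base in \<open>auto simp: generic_def colvel_def occupant_def\<close>)
  then show ?case by (intro exI[of _ w]) (auto simp: pending_def)
next
  case (step j)
  let ?u = "\<lambda>i. u i - side m i * 2"
  have u: "rows_open m u" using step.prems by (simp add: generic_def)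
  have "\<forall>\<^sub>F t in at_top. line w (j - 1) t0 - line w 0 t0 < 2 * t"
    by (rule eventually_mono[OF eventually_gt_at_top[of "(line w (j - 1) t0 - line w 0 t0) / 2"]]) simp
  from this eventually_kick_generic[OF step.prems(2), of x] eventually_gt_at_top[of 0]
  have "\<forall>\<^sub>F t in at_top. line w (j - 1) t0 - line w 0 t0 < 2 * t \<and>
      inj_on (meeting (adv t x u) ?u) (across m) \<and> 0 < t"
    by eventually_elim auto
  \<comment> \<open>Pulse \<open>j\<close> gains on pulse \<open>j - 1\<close> at relative speed 2
    and is to meet it after \<open>\<tau>\<close>, so now it lies \<open>2 * \<tau>\<close> below
    it; the first inequality says that this is below pulse 0.\<close>
  then obtain \<tau> where \<tau>: "line w (j - 1) t0 - line w 0 t0 < 2 * \<tau>" "0 < \<tau>"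
      and inj: "inj_on (meeting (adv \<tau> x u) ?u) (across m)"
    using eventually_happens[of _ "at_top :: real filter"] by (auto simp: trivial_limit_at_top_linorder)
  let ?x = "adv \<tau> x u"
  have "\<exists>T>0. \<forall>p\<in>across m. meeting ?x ?u p < T"
  proof (intro exI conjI ballI)
    let ?T = "Max (insert 0 (meeting ?x ?u ` across m)) + 1"
    show "0 < ?T" by (rule add_nonneg_pos) (auto intro: Max_ge)
    show "meeting ?x ?u p < ?T" if "p \<in> across m" for p
      using that by (intro less_add_one[THEN le_less_trans[rotated]] Max_ge) auto
  qed
  \<comment> \<open>All row collisions caused by the kick take place within time \<open>T\<close>,
    before the next pulse is considered.\<close>
  then obtain T where T: "0 < T" "\<And>p. p \<in> across m \<Longrightarrow> meeting ?x ?u p < T" by blast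
  define t1 where "t1 = t0 + \<tau> + T"
  define w1 where "w1 = w(j := line w (j - 1) (t0 + \<tau>) - speed j * (t0 + \<tau>))"
  define u1 where "u1 = ?u \<circ> exchange m"
  define x1 where "x1 = adv T ?x ?u \<circ> exchange m"
  have lj: "line w1 j (t0 + \<tau>) = line w1 (j - 1) (t0 + \<tau>)" using step.prems(1) by (simp add: w1_def)
  have gen1: "generic m u1" unfolding u1_def by (rule generic_kick[OF step.prems(2)])
  have inv: "inversions (2 * m) ?u = across m" by (rule inversions_kick[OF step.prems(2)])
  have xopen: "x c < x (Suc c)" "u c < u (Suc c)" if "c < 2 * m" for c
    using step.prems(3) u that by (auto simp: rows_open_def)
  have x1: "rows_open m x1"
    unfolding rows_open_def
  proof (intro allI impI)
    fix c assume c: "c < 2 * m"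
    show "x1 c < x1 (Suc c)"
    proof (cases "(c, Suc c) \<in> across m")
      case True
      then have a: "(exchange m (Suc c), exchange m c) \<in> across m" by (rule exchange_across)
      then have "?u (exchange m c) < ?u (exchange m (Suc c))" using inv by (auto simp: inversions_def)
      then show ?thesis using T(2)[OF a] by (simp add: meeting_less_iff x1_def)
    next
      case False
      then have s: "exchange m (Suc c) = Suc (exchange m c)" "exchange m c < 2 * m"
        "side m (exchange m (Suc c)) = side m (exchange m c)"
        using c by (auto simp: across_def exchange_def side_def split: if_splits)
      have "\<tau> * u (exchange m c) < \<tau> * u (Suc (exchange m c))" "T * u (exchange m c) < T * u (Suc (exchange m c))"
        using xopen(2)[OF s(2)] \<tau> T by auto
      then show ?thesis using xopen(1)[OF s(2)] s by (simp add: x1_def adv_def algebra_simps)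
    qed
  qed
  have srt1: "sorted_lines w1 (Suc j) t1"
    unfolding sorted_lines_def
  proof (intro allI impI)
    fix l assume l: "Suc l < Suc j"
    show "line w1 l t1 < line w1 (Suc l) t1"
    proof (cases "Suc l = j")
      case True
      have "speed (j - 1) * T < speed j * T" using T step.prems(1) by (intro mult_strict_right_mono) auto
      then show ?thesis using lj True by (auto simp: t1_def algebra_simps)
    next
      case False
      then have "line w l t1 < line w (Suc l) t1"
        using sorted_lines_later[OF step.prems(5), of t1] l \<tau> T by (auto simp: sorted_lines_def t1_def)
      then show ?thesis using False l by (simp add: w1_def)
    qed
  qed
  \<comment> \<open>Kick and exchange preserve \<open>u m = - q 0\<close>: the middle ball again has
    no horizontal velocity once the row is sorted. At the end this becomes the stopping
    condition.\<close>
  have um: "u1 m = - speed (Suc j - 1)"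
    using step.prems(1,4) by (simp add: u1_def exchange_def side_def speed_def of_nat_diff)
  obtain w' where w': "\<forall>l<Suc j. w' l = w1 l" "pending N w' (Suc j) t1"
    "irun m N (\<Sum>l=Suc j..<N. l + (m * m + 2 * m)) x1 u1 (colpos w' (Suc j) (Suc j) t1) (colvel (Suc j) (Suc j))"
    using step.IH[OF _ gen1 x1 um srt1] by auto
  let ?k = "\<Sum>l=Suc j..<N. l + (m * m + 2 * m)"
  have same: "line w' l t = line w1 l t" if "l \<le> j" for l t using w'(1) that by simp
  have srt': "sorted_lines w' j t0" using step.prems(5) w'(1) by (auto simp: sorted_lines_def w1_def)
  have srt1': "sorted_lines w' (Suc j) t" if "t0 + \<tau> < t" for t
    unfolding sorted_lines_def
  proof (intro allI impI)
    fix l assume l: "Suc l < Suc j"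
    show "line w' l t < line w' (Suc l) t"
    proof (cases "Suc l = j")
      case True
      have "speed (j - 1) * (t - (t0 + \<tau>)) < speed j * (t - (t0 + \<tau>))"
        using that step.prems(1) by (intro mult_strict_right_mono) auto
      then show ?thesis using lj True w'(1) by (auto simp: algebra_simps)
    next
      case False
      then show ?thesis
        using sorted_lines_later[OF srt', of t] l \<tau> that by (auto simp: sorted_lines_def)
    qed
  qed
  have new: "line w' j t0 < line w' 0 t0"
    using \<tau>(1) w'(1) step.prems(1) by (simp add: w1_def speed_def of_nat_diff algebra_simps)
  have after: "irun m N (card (inversions (2 * m) ?u) + ?k) ?x ?u (colpos w' j 0 (t0 + \<tau>)) (colvel j 0)"
  proof (rule row_phase)
    show "inj_on (meeting ?x ?u) (inversions (2 * m) ?u)" using inj by (simp add: inv)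
    show "meeting ?x ?u p < T" if "p \<in> inversions (2 * m) ?u" for p using that T by (simp add: inv)
    show "?x c < ?x (Suc c) \<or> ?x c = ?x (Suc c) \<and> ?u c < ?u (Suc c)" if "c < 2 * m" for c
      using xopen[OF that] \<tau> by (auto simp: adv_def intro: add_strict_mono)
    show "exchange m permutes {..2 * m}" by (rule exchange_permutes)
    show "strict_mono_on {..2 * m} (?u \<circ> exchange m)"
      using gen1 rows_open_less by (auto simp: generic_def u1_def intro!: strict_mono_onI)
    show "cols_open N (adv t (colpos w' j 0 (t0 + \<tau>)) (colvel j 0))" if "0 < t" "t \<le> T" for t
      unfolding adv_colpos unfolding occupant_last colpos_def
      using cols_open_idle[OF srt1' pending_earlier[OF w'(2)], of "t0 + \<tau> + t"] that
      by (simp add: t1_def colpos_def)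
    show "0 < T" by fact
    show "irun m N ?k (adv T ?x ?u \<circ> exchange m) (?u \<circ> exchange m)
       (adv T (colpos w' j 0 (t0 + \<tau>)) (colvel j 0)) (colvel j 0)"
      using w'(3) unfolding adv_colpos by (simp add: x1_def u1_def t1_def colpos_def colvel_def occupant_last)
  qed
  have "irun m N (j + (card (inversions (2 * m) ?u) + ?k)) x u (colpos w' j j t0) (colvel j j)"
  proof (rule column_pulse[where \<tau> = "t0 + \<tau>" and te = t1 and w = w'])
    show "line w' j (t0 + \<tau>) = line w' (j - 1) (t0 + \<tau>)" using lj w'(1) by simp
    show "irun m N (card (inversions (2 * m) ?u) + ?k) (adv (t0 + \<tau> - t0) x u) (\<lambda>i. u i - side m i * 2)
       (colpos w' j 0 (t0 + \<tau>)) (colvel j 0)" using after by simp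
  qed (use step.prems step.hyps \<tau> T srt' new w'(2) u in \<open>simp_all add: t1_def\<close>)
  moreover have "j + (card (inversions (2 * m) ?u) + ?k) = (\<Sum>l=j..<N. l + (m * m + 2 * m))"
    using step.hyps by (simp add: inv card_across sum.atLeast_Suc_lessThan[of j N])
  moreover have "pending N w' j t0"
  proof -
    have p: "pending N w' (Suc j) t0"
      by (rule pending_earlier[OF w'(2)]) (use \<tau> T in \<open>simp_all add: t1_def\<close>)
    moreover have "line w' (Suc j) t0 < line w' j t0" if "Suc j < N"
    proof (rule line_earlier[of _ _ t1])
      show "line w' (Suc j) t1 < line w' j t1"
        using w'(2) that sorted_lines_less[OF srt1'[of t1], of 0 j] T step.prems(1)
        by (auto simp: pending_def t1_def)
    qed (use \<tau> T in \<open>auto simp: t1_def intro: less_imp_le\<close>)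
    ultimately show ?thesis
      using new unfolding pending_def by (metis Suc_leI le_eq_less_or_eq)
  qed
  ultimately show ?case
    using w'(1) by (intro exI[of _ w']) (auto simp: w1_def)
qed


section \<open>The initial reversal of the row\<close>

definition pairs :: "nat \<Rightarrow> (nat \<times> nat) set" where
  "pairs n = {(i, k). i < k \<and> k \<le> n}"

lemma finite_pairs [simp]: "finite (pairs n)"
  by (rule finite_subset[of _ "{..n} \<times> {..n}"]) (auto simp: pairs_def)

lemma card_pairs: "card (pairs n) = n * (n + 1) div 2"
proof -
  have "pairs n = prod.swap ` (SIGMA k:{..n}. {..<k})" by (auto simp: pairs_def)
  then have "card (pairs n) = card (SIGMA k:{..n}. {..<k})" by (simp add: card_image)
  also have "\<dots> = \<Sum>{0..n}" by (simp add: card_SigmaI atMost_atLeast0)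
  also have "\<dots> = n * (n + 1) div 2" by (simp add: gauss_sum_nat)
  finally show ?thesis .
qed

text \<open>With positions \<open>- (\<delta> ^ i)\<close>, the pair (a, b) meets at a time
  asymptotic to \<open>\<delta> ^ a / (u a - u b)\<close>. Pairs with different left ends are
  separated by order of magnitude, pairs with the same left end by the velocities of their right
  ends. In the limits, \<open>0 ^ (a - i)\<close> distinguishes \<open>a = i\<close> from
  \<open>i < a\<close>.\<close>

lemma distinct_meetings_exist:
  fixes u :: "nat \<Rightarrow> real"
  assumes u: "\<And>i k. i < k \<Longrightarrow> k \<le> n \<Longrightarrow> u k < u i"
  shows "\<exists>x. (\<forall>i. x i < x (Suc i)) \<and> inj_on (meeting x u) (pairs n)"
proof -
  define x :: "real \<Rightarrow> nat \<Rightarrow> real" where "x \<delta> i = - (\<delta> ^ i)" for \<delta> i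
  have lim: "((\<lambda>\<delta>. meeting (x \<delta>) u (a, b) / \<delta> ^ i) \<longlongrightarrow> 0 ^ (a - i) / (u a - u b)) (at_right 0)"
    if "i \<le> a" "a < b" for a b i
  proof -
    have "((\<lambda>\<delta>. (\<delta> ^ (a - i) - \<delta> ^ (b - i)) / (u a - u b)) \<longlongrightarrow> (0 ^ (a - i) - 0 ^ (b - i)) * inverse (u a - u b)) (at_right 0)"
      unfolding divide_inverse by (intro tendsto_intros)
    moreover have "\<forall>\<^sub>F \<delta> in at_right 0. (\<delta> ^ (a - i) - \<delta> ^ (b - i)) / (u a - u b) = meeting (x \<delta>) u (a, b) / \<delta> ^ i"
      using eventually_at_right_less[of 0]
      by eventually_elim (use that in \<open>simp add: x_def meeting_def power_diff diff_divide_distrib mult.commute\<close>)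
    ultimately show ?thesis using that by (simp add: tendsto_cong divide_inverse power_0_left)
  qed
  have ne: "\<forall>\<^sub>F \<delta> in at_right 0. meeting (x \<delta>) u (a, b) \<noteq> meeting (x \<delta>) u (a', b')"
    if p: "(a, b) \<in> pairs n" "(a', b') \<in> pairs n" "(a, b) \<noteq> (a', b')" "a \<le> a'" for a b a' b'
  proof -
    have ab: "a < b" "b \<le> n" "a' < b'" "b' \<le> n" using p by (auto simp: pairs_def)
    have "((\<lambda>\<delta>. meeting (x \<delta>) u (a, b) / \<delta> ^ a - meeting (x \<delta>) u (a', b') / \<delta> ^ a) \<longlongrightarrow>
        0 ^ (a - a) / (u a - u b) - 0 ^ (a' - a) / (u a' - u b')) (at_right 0)"
      by (intro tendsto_diff lim) (use ab p in auto)
    moreover have "0 ^ (a - a) / (u a - u b) - 0 ^ (a' - a) / (u a' - u b') \<noteq> 0"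
    proof (cases "a = a'")
      case True
      then have "u b \<noteq> u b'" using p(3) u[of b b'] u[of b' b] ab by (cases b b' rule: linorder_cases) auto
      then show ?thesis using True u[OF ab(1,2)] u[OF ab(3,4)] by (simp add: frac_eq_eq)
    next
      case False
      then show ?thesis using u[OF ab(1,2)] p(4) by (simp add: power_0_left)
    qed
    ultimately have "\<forall>\<^sub>F \<delta> in at_right 0. meeting (x \<delta>) u (a, b) / \<delta> ^ a - meeting (x \<delta>) u (a', b') / \<delta> ^ a \<noteq> 0"
      by (rule tendsto_imp_eventually_ne)
    then show ?thesis by eventually_elim auto
  qed
  have "\<forall>\<^sub>F \<delta> in at_right 0. meeting (x \<delta>) u p \<noteq> meeting (x \<delta>) u p'"
    if "p \<in> pairs n" "p' \<in> pairs n" "p \<noteq> p'" for p p'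
  proof (cases "fst p \<le> fst p'")
    case True
    then show ?thesis using ne[of "fst p" "snd p" "fst p'" "snd p'"] that by simp
  next
    case False
    then have "\<forall>\<^sub>F \<delta> in at_right 0. meeting (x \<delta>) u p' \<noteq> meeting (x \<delta>) u p"
      using ne[of "fst p'" "snd p'" "fst p" "snd p"] that by simp
    then show ?thesis by eventually_elim auto
  qed
  then have "\<forall>\<^sub>F \<delta> in at_right 0. \<forall>p\<in>pairs n. \<forall>p'\<in>pairs n. p \<noteq> p' \<longrightarrow> meeting (x \<delta>) u p \<noteq> meeting (x \<delta>) u p'"
    by (simp add: eventually_ball_finite_distrib)
  moreover have "\<forall>\<^sub>F \<delta> in at_right 0. \<delta> < (1::real)" by (rule eventually_at_rightI[of 0 1]) auto
  moreover have "\<forall>\<^sub>F \<delta> in at_right 0. 0 < (\<delta>::real)" by (rule eventually_at_right_less)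
  ultimately have "\<forall>\<^sub>F \<delta> in at_right 0. (\<forall>i. x \<delta> i < x \<delta> (Suc i)) \<and> inj_on (meeting (x \<delta>) u) (pairs n)"
    by eventually_elim (auto simp: inj_on_def x_def intro: power_strict_decreasing)
  then show ?thesis using eventually_happens[of _ "at_right (0::real)"] trivial_limit_at_right_real by blast
qed

text \<open>
  The weights 1 and \<open>4 m\<close> on the two sides of \<open>W\<close> separate the slopes after the initial reversal, which
  become affine images of \<open>2 s\<close>, \<open>8 m r\<close> and \<open>s + 4 m r\<close> for \<open>1 \<le> r, s \<le> m\<close>.
\<close>

definition start :: "nat \<Rightarrow> nat \<Rightarrow> real" where
  "start m i = (if i \<le> m then real m - real i else 4 * real m * (real m - real i)) / (4 * real m * real m + 1)"

lemma start_less: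
  assumes "i < k" "0 < m"
  shows "start m k < start m i"
proof -
  have "(if k \<le> m then real m - real k else 4 * real m * (real m - real k)) <
      (if i \<le> m then real m - real i else 4 * real m * (real m - real i))"
  proof -
    consider "k \<le> m" | "i \<le> m" "m < k" | "m < i" using assms by linarith
    then show ?thesis
    proof cases
      case 2
      then have "4 * real m * (real m - real k) < 0" using assms by (intro mult_pos_neg) auto
      then show ?thesis using 2 by auto
    next
      case 3
      then have "4 * real m * (real m - real k) < 4 * real m * (real m - real i)"
        using assms by (intro mult_strict_left_mono) auto
      then show ?thesis using 3 assms by auto
    qed (use assms in auto)
  qed
  then show ?thesis unfolding start_def by (intro divide_strict_right_mono) (auto intro: add_nonneg_pos)
qed

text \<open>The denominator of \<open>start\<close> exceeds its largest numerator in absolute value,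
  \<open>4 * m * m\<close>. Together with \<open>start m m = 0\<close> these bounds keep the slopes
  after the reversal below 2.\<close>

lemma start_bounds: "- 1 < start m i" "start m i < 1" if "i \<le> 2 * m"
proof -
  have pos: "0 < 4 * real m * real m + 1" by (auto intro: add_nonneg_pos)
  have "real m \<le> real m * real m" by (cases m) auto
  then have "real m - real i < 4 * real m * real m + 1" using of_nat_0_le_iff[of m] of_nat_0_le_iff[of i] by linarith
  moreover have "4 * real m * real m \<ge> 4 * real m * (real i - real m)"
    by (rule mult_left_mono) (use that in auto)
  moreover have "4 * real m * (real m - real i) \<le> 0" if "\<not> i \<le> m"
    by (rule mult_nonneg_nonpos) (use that in auto)
  moreover have "0 \<le> real m * real m" by simp
  ultimately have "- (4 * real m * real m + 1) < (if i \<le> m then real m - real i else 4 * real m * (real m - real i))"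
     "(if i \<le> m then real m - real i else 4 * real m * (real m - real i)) < 4 * real m * real m + 1"
    by (auto simp: algebra_simps)
  then show "- 1 < start m i" "start m i < 1"
    unfolding start_def using pos by (simp_all only: pos_less_divide_eq pos_divide_less_eq mult_1 mult_minus1)
qed

definition rev_row :: "nat \<Rightarrow> nat \<Rightarrow> nat" where
  "rev_row m i = (if i \<le> 2 * m then 2 * m - i else i)"

lemma rev_row_permutes: "rev_row m permutes {..2 * m}"
proof (rule bij_imp_permutes)
  show "bij_betw (rev_row m) {..2 * m} {..2 * m}"
    by (intro bij_betw_byWitness[where f' = "rev_row m"]) (auto simp: rev_row_def split: if_splits)
qed (simp add: rev_row_def)

lemma start_slopes_inj:
  assumes "0 < m"
  shows "inj_on (slope m ((\<lambda>i. start m i - side m i) \<circ> rev_row m)) (across m)"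
    (is "inj_on (slope m ?u) _")
proof (rule inj_onI)
  \<comment> \<open>For the pair \<open>(m - r, m + s)\<close>, \<open>h r s\<close> is the variable
    part of the slope over a common denominator. The factors 2 arise for pairs with
    \<open>W\<close>, whose \<open>side\<close> jumps by 1 instead of 2. In base
    \<open>4 * m\<close> the digits of \<open>h r s\<close> determine \<open>r\<close> and
    \<open>s\<close>; note \<open>2 * s < 4 * m\<close>.\<close>
  define h where "h r s = (if r = 0 then 2 * s else if s = 0 then (4 * m) * (2 * r) else s + (4 * m) * r)" for r s :: nat
  let ?M = "4 * real m * real m + 1"
  have M: "0 < ?M" by (auto intro: add_nonneg_pos)
  have sl: "slope m ?u (m - r, m + s) = 1 + real (h r s) / (2 * ?M)" if "r \<le> m" "s \<le> m" "r \<noteq> 0 \<or> s \<noteq> 0" for r s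
  proof -
    have "start m (m - s) = real s / ?M" using that by (simp add: start_def of_nat_diff)
    moreover have "start m (m + r) = - (4 * real m * real r) / ?M" using that by (auto simp: start_def)
    moreover have "rev_row m (m - r) = m + r" "rev_row m (m + s) = m - s" using that by (auto simp: rev_row_def)
    moreover have "m - r = m \<longleftrightarrow> r = 0" "m - r < m \<longleftrightarrow> r \<noteq> 0" "m - s = m \<longleftrightarrow> s = 0" "m - s < m \<longleftrightarrow> s \<noteq> 0"
      using that assms by auto
    ultimately show ?thesis using that M
      by (auto simp: slope_def side_def h_def field_simps)
  qed
  have h: "r = r' \<and> s = s'" if "h r s = h r' s'" "r \<le> m" "s \<le> m" "r' \<le> m" "s' \<le> m" for r s r' s'
  proof -
    have q: "h r s div (4 * m) = (if r = 0 then 0 else if s = 0 then 2 * r else r)"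
      "h r s mod (4 * m) = (if r = 0 then 2 * s else if s = 0 then 0 else s)" if "r \<le> m" "s \<le> m" for r s
      using that assms by (auto simp: h_def)
    have "h r s div (4 * m) = h r' s' div (4 * m)" "h r s mod (4 * m) = h r' s' mod (4 * m)" using that by auto
    then show ?thesis using q[OF that(2,3)] q[OF that(4,5)] by (auto split: if_splits)
  qed
  fix p p' assume p: "p \<in> across m" "p' \<in> across m" and eq: "slope m ?u p = slope m ?u p'"
  have rs: "\<exists>r s. p = (m - r, m + s) \<and> r \<le> m \<and> s \<le> m \<and> (r \<noteq> 0 \<or> s \<noteq> 0)" if "p \<in> across m" for p
  proof -
    obtain i k where p: "p = (i, k)" by (cases p)
    show ?thesis unfolding p
      by (rule exI[of _ "m - i"], rule exI[of _ "k - m"]) (use that in \<open>auto simp: p across_def\<close>)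
  qed
  obtain r s where rs1: "p = (m - r, m + s)" "r \<le> m" "s \<le> m" "r \<noteq> 0 \<or> s \<noteq> 0" using rs[OF p(1)] by blast
  obtain r' s' where rs2: "p' = (m - r', m + s')" "r' \<le> m" "s' \<le> m" "r' \<noteq> 0 \<or> s' \<noteq> 0" using rs[OF p(2)] by blast
  have "real (h r s) / (2 * ?M) = real (h r' s') / (2 * ?M)"
    using eq sl[OF rs1(2-4)] sl[OF rs2(2-4)] by (simp add: rs1(1) rs2(1))
  then have "real (h r s) = real (h r' s')" using M by (simp only: divide_cancel_right) auto
  then have "h r s = h r' s'" by (simp only: of_nat_eq_iff)
  then show "p = p'" using h rs1 rs2 by blast
qed

lemma start_generic:
  assumes "0 < m"
  shows "generic m ((\<lambda>i. start m i - side m i) \<circ> rev_row m)" (is "generic m ?u")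
  unfolding generic_def
proof (intro conjI ballI)
  show "rows_open m ?u"
    unfolding rows_open_def
  proof (intro allI impI)
    fix c assume c: "c < 2 * m"
    have "side m (2 * m - Suc c) \<le> side m (2 * m - c)" by (auto simp: side_def)
    moreover have "start m (2 * m - c) < start m (2 * m - Suc c)"
      by (rule start_less) (use c assms in linarith)+
    ultimately show "?u c < ?u (Suc c)" using c by (simp add: rev_row_def)
  qed
  show "inj_on (slope m ?u) (across m)" by (rule start_slopes_inj[OF assms])
  fix p assume "p \<in> across m"
  then obtain i k where p: "p = (i, k)" "i \<le> m" "m \<le> k" "k \<le> 2 * m" "i < k" by (auto simp: across_def)
  have "start m m = 0" by (simp add: start_def)
  moreover have "start m (2 * m - k) < 1" "- 1 < start m (2 * m - i)" using p by (auto intro: start_bounds)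
  ultimately show "slope m ?u p < 2" using p
    by (auto simp: slope_def side_def rev_row_def)
qed

text \<open>Initially all pairs of the row are inverted, and the row is reversed by time
  \<open>T\<close>. The pulses are constructed from time \<open>T\<close> on and followed back to
  time 0, which keeps the column open because \<open>pending\<close> persists into the past.\<close>

theorem ideal_run:
  assumes "0 < m" "0 < N"
  shows "\<exists>x y. (\<forall>i. x i < x (Suc i)) \<and> cols_open N y \<and>
    irun m N (m * (2 * m + 1) + (\<Sum>l=1..<N. l + (m * m + 2 * m))) x (\<lambda>i. start m i - side m i) y speed"
proof -
  let ?u = "\<lambda>i. start m i - side m i"
  have u: "?u k < ?u i" if "i < k" for i k
    using start_less[OF that assms(1)] that by (auto simp: side_def)
  have inv: "inversions (2 * m) ?u = pairs (2 * m)" using u by (auto simp: inversions_def pairs_def)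
  obtain x where x: "\<forall>i. x i < x (Suc i)" and inj: "inj_on (meeting x ?u) (pairs (2 * m))"
    using distinct_meetings_exist[of "2 * m" ?u] u by blast
  define T where "T = Max (insert 0 (meeting x ?u ` pairs (2 * m))) + 1"
  have T: "0 < T" unfolding T_def by (rule add_nonneg_pos) (auto intro: Max_ge)
  have mT: "meeting x ?u p < T" if "p \<in> pairs (2 * m)" for p
    unfolding T_def using that by (intro less_add_one[THEN le_less_trans[rotated]] Max_ge) auto
  let ?x = "adv T x ?u \<circ> rev_row m"
  have "rows_open m ?x"
    unfolding rows_open_def
  proof (intro allI impI)
    fix c assume c: "c < 2 * m"
    then have "(2 * m - Suc c, 2 * m - c) \<in> pairs (2 * m)" by (auto simp: pairs_def)
    from mT[OF this] show "?x c < ?x (Suc c)"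
      using c u by (subst (asm) meeting_less_iff) (auto simp: rev_row_def)
  qed
  moreover have "(?u \<circ> rev_row m) m = - speed (1 - 1)"
    by (simp add: rev_row_def start_def side_def speed_def)
  ultimately obtain w where w: "pending N w 1 T"
      "irun m N (\<Sum>l=1..<N. l + (m * m + 2 * m)) ?x (?u \<circ> rev_row m) (colpos w 1 1 T) (colvel 1 1)"
    using irun_pulses[OF assms(1), of 1 N "?u \<circ> rev_row m" ?x "\<lambda>_. 0" T] assms start_generic[OF assms(1)]
    by (auto simp: sorted_lines_def)
  have colopen: "cols_open N (colpos w 1 1 t)" if "t \<le> T" for t
    by (rule cols_open_idle) (use pending_earlier[OF w(1)] that in \<open>auto simp: sorted_lines_def\<close>)
  have "irun m N (card (inversions (2 * m) ?u) + (\<Sum>l=1..<N. l + (m * m + 2 * m))) x ?u (colpos w 1 1 0) (colvel 1 1)"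
  proof (rule row_phase)
    show "rev_row m permutes {..2 * m}" by (rule rev_row_permutes)
    show "strict_mono_on {..2 * m} (?u \<circ> rev_row m)"
      by (intro strict_mono_onI) (use u in \<open>auto simp: rev_row_def\<close>)
    show "cols_open N (adv t (colpos w 1 1 0) (colvel 1 1))" if "0 < t" "t \<le> T" for t
      using colopen[OF that(2)] by (simp add: adv_colpos)
    show "irun m N (\<Sum>l=1..<N. l + (m * m + 2 * m)) ?x (?u \<circ> rev_row m)
       (adv T (colpos w 1 1 0) (colvel 1 1)) (colvel 1 1)" using w(2) by (simp add: adv_colpos)
  qed (use inj mT T x in \<open>simp_all add: inv\<close>)
  moreover have "colvel 1 1 = speed" by (rule ext) (auto simp: colvel_def occupant_def intro: arg_cong[of _ _ speed])
  moreover have "card (inversions (2 * m) ?u) = m * (2 * m + 1)" by (simp add: inv card_pairs)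
  ultimately show ?thesis using x colopen[of 0] T by (metis less_imp_le)
qed

section \<open>Realising the ideal motion by balls\<close>

text \<open>
  Ball \<open>b \<le> 2 m\<close> is row ball \<open>b\<close>, and ball \<open>2 m + e\<close> with \<open>e > 0\<close> is column ball \<open>e\<close>. Contact \<open>c\<close> joins
  the balls \<open>contact m c\<close> and \<open>Suc c\<close>: the contacts \<open>c < 2 m\<close> form the row, the others the column.
\<close>

definition contact :: "nat \<Rightarrow> nat \<Rightarrow> nat" where
  "contact m c = (if c = 2 * m then m else c)"

definition gap :: "nat \<Rightarrow> (nat \<Rightarrow> real) \<Rightarrow> (nat \<Rightarrow> real) \<Rightarrow> nat \<Rightarrow> real" where
  "gap m x y c = (if c < 2 * m then x (Suc c) - x c else y (c - 2 * m) - y (Suc (c - 2 * m)))"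

definition scale :: "nat \<Rightarrow> nat \<Rightarrow> real \<Rightarrow> real" where
  "scale m c \<beta> = (if c < 2 * m then \<beta> else 1)"

text \<open>Squared distances are used because free flight makes them quadratic polynomials. Near
  contact a quarter of the excess of the square over 4 is the gap itself to first order, and it is
  measured in \<open>\<beta>^3\<close> for the row and \<open>\<beta>^2\<close> for the column. With
  time in units of \<open>\<beta>^2\<close>, \<open>approach\<close> is the linear and
  \<open>bend\<close> the quadratic coefficient of this polynomial.\<close>

definition clearance :: "nat \<Rightarrow> nat \<Rightarrow> real \<Rightarrow> (nat \<Rightarrow> complex) \<Rightarrow> real" where
  "clearance m c \<beta> z = ((norm (z (Suc c) - z (contact m c)))\<^sup>2 - 4) / (4 * \<beta>\<^sup>2 * scale m c \<beta>)"

definition approach :: "nat \<Rightarrow> nat \<Rightarrow> real \<Rightarrow> (nat \<Rightarrow> complex) \<Rightarrow> (nat \<Rightarrow> complex) \<Rightarrow> real" where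
  "approach m c \<beta> z v =
     (z (Suc c) - z (contact m c)) \<bullet> (v (Suc c) - v (contact m c)) / (2 * scale m c \<beta>)"

definition bend :: "nat \<Rightarrow> nat \<Rightarrow> real \<Rightarrow> (nat \<Rightarrow> complex) \<Rightarrow> real" where
  "bend m c \<beta> v = \<beta>\<^sup>2 * (norm (v (Suc c) - v (contact m c)))\<^sup>2 / (4 * scale m c \<beta>)"

definition site :: "nat \<Rightarrow> nat \<Rightarrow> complex" where
  "site m b = (if b \<le> 2 * m then Complex (2 * (real b - real m)) 0 else Complex 0 (- 2 * real (b - 2 * m)))"

text \<open>The displacement from the site in units of \<open>\<beta>\<close>. The column is lowered
  together with \<open>W\<close>, so its lines of centres are vertical up to
  \<open>o(\<beta>)\<close> and its impacts transmit no horizontal velocity of order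
  \<open>\<beta>\<close>.\<close>

definition offset :: "nat \<Rightarrow> nat \<Rightarrow> complex" where
  "offset m b = (if b = m \<or> 2 * m < b then Complex 0 (- 2) else 0)"

text \<open>Inverts the substitution \<open>u i = P i - side m i * q 0\<close>: the horizontal
  velocity in units of \<open>\<beta>\<close>.\<close>

definition xvel :: "nat \<Rightarrow> (nat \<Rightarrow> real) \<Rightarrow> (nat \<Rightarrow> real) \<Rightarrow> nat \<Rightarrow> real" where
  "xvel m u q b = (if b \<le> 2 * m then u b + side m b * q 0 else 0)"

definition yvel :: "nat \<Rightarrow> (nat \<Rightarrow> real) \<Rightarrow> nat \<Rightarrow> real" where
  "yvel m q b = (if b = m then q 0 else if b \<le> 2 * m then 0 else q (b - 2 * m))"

text \<open>A family of ball states whose limit is the ideal state. Nonnegative clearance is a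
  separate clause because a pair that has just collided has limiting gap 0, and convergence alone
  would permit overlap.\<close>

definition approx where
  "approx m N z v x u y q \<longleftrightarrow>
     (\<forall>b<2 * m + N. ((\<lambda>\<beta>. (z \<beta> b - site m b) /\<^sub>R \<beta>) \<longlongrightarrow> offset m b) (at_right 0) \<and>
        ((\<lambda>\<beta>. Re (v \<beta> b) / \<beta>) \<longlongrightarrow> xvel m u q b) (at_right 0) \<and>
        ((\<lambda>\<beta>. Im (v \<beta> b)) \<longlongrightarrow> yvel m q b) (at_right 0)) \<and>
     (\<forall>c. Suc c < 2 * m + N \<longrightarrow> ((\<lambda>\<beta>. clearance m c \<beta> (z \<beta>)) \<longlongrightarrow> gap m x y c) (at_right 0) \<and>
        (\<forall>\<^sub>F \<beta> in at_right 0. 0 \<le> clearance m c \<beta> (z \<beta>)))"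

lemma gap_adv: "gap m (adv t x u) (adv t y q) c = gap m x y c + t * gap m u q c"
  by (simp add: gap_def adv_def algebra_simps)

lemma open_iff_gap: "rows_open m x \<and> cols_open N y \<longleftrightarrow> (\<forall>c. Suc c < 2 * m + N \<longrightarrow> 0 < gap m x y c)"
  if "0 < N"
proof safe
  fix c assume "rows_open m x" "cols_open N y" "Suc c < 2 * m + N"
  then show "0 < gap m x y c" by (auto simp: gap_def rows_open_def cols_open_def)
next
  assume *: "\<forall>c. Suc c < 2 * m + N \<longrightarrow> 0 < gap m x y c"
  show "rows_open m x"
    unfolding rows_open_def
  proof (intro allI impI)
    fix c assume "c < 2 * m"
    then show "x c < x (Suc c)" using *[rule_format, of c] that by (simp add: gap_def)
  qed
  show "cols_open N y"
    unfolding cols_open_def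
  proof (intro allI impI)
    fix e assume "Suc e < N"
    then show "y (Suc e) < y e" using *[rule_format, of "2 * m + e"] by (simp add: gap_def)
  qed
qed

section \<open>Clearances under free flight\<close>

lemma norm_drift_square:
  fixes p w :: "'a::real_inner"
  shows "(norm (p + s *\<^sub>R w))\<^sup>2 = (norm p)\<^sup>2 + 2 * s * (p \<bullet> w) + s\<^sup>2 * (norm w)\<^sup>2"
  unfolding power2_norm_eq_inner
  by (simp add: inner_add_left inner_add_right inner_commute power2_eq_square algebra_simps)

lemma drift_diff: "drift s z v a - drift s z v b = (z a - z b) + s *\<^sub>R (v a - v b)"
  by (simp add: drift_def algebra_simps)

lemma clearance_drift:
  assumes "0 < \<beta>"
  shows "clearance m c \<beta> (drift (\<beta>\<^sup>2 * \<theta>) z v) =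
    clearance m c \<beta> z + \<theta> * approach m c \<beta> z v + \<theta>\<^sup>2 * bend m c \<beta> v"
  unfolding clearance_def approach_def bend_def drift_diff norm_drift_square
  using assms by (simp add: scale_def field_simps power2_eq_square)

lemma clearance_pos_iff:
  assumes "0 < \<beta>"
  shows "0 < clearance m c \<beta> z \<longleftrightarrow> 2 < dist (z (Suc c)) (z (contact m c))"
    and "clearance m c \<beta> z = 0 \<longleftrightarrow> dist (z (Suc c)) (z (contact m c)) = 2"
    and "0 \<le> clearance m c \<beta> z \<longleftrightarrow> 2 \<le> dist (z (Suc c)) (z (contact m c))"
proof -
  have s: "0 < 4 * \<beta>\<^sup>2 * scale m c \<beta>" using assms by (simp add: scale_def)
  have div: "0 < X / S \<longleftrightarrow> 0 < X" "X / S = 0 \<longleftrightarrow> X = 0" "0 \<le> X / S \<longleftrightarrow> 0 \<le> X" if "0 < S" for X S :: real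
    using that by (auto simp: zero_less_divide_iff zero_le_divide_iff)
  have "(2::real)\<^sup>2 = 4" by simp
  then have "0 < (norm p)\<^sup>2 - 4 \<longleftrightarrow> 2 < norm p" "(norm p)\<^sup>2 - 4 = 0 \<longleftrightarrow> norm p = 2" "0 \<le> (norm p)\<^sup>2 - 4 \<longleftrightarrow> 2 \<le> norm p"
    for p :: complex
    using power2_less_imp_less[of 2 "norm p"] power_strict_mono[of 2 "norm p" 2]
      power2_le_imp_le[of 2 "norm p"] power_mono[of 2 "norm p" 2] power2_eq_iff_nonneg[of "norm p" 2] by auto
  then show "0 < clearance m c \<beta> z \<longleftrightarrow> 2 < dist (z (Suc c)) (z (contact m c))"
    "clearance m c \<beta> z = 0 \<longleftrightarrow> dist (z (Suc c)) (z (contact m c)) = 2"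
    "0 \<le> clearance m c \<beta> z \<longleftrightarrow> 2 \<le> dist (z (Suc c)) (z (contact m c))"
    by (simp_all only: clearance_def dist_norm div[OF s])
qed

lemma bend_nonneg: "0 < \<beta> \<Longrightarrow> 0 \<le> bend m c \<beta> v"
  by (simp add: bend_def scale_def)

lemma positive_parabola:
  fixes D R A :: real
  assumes "0 \<le> D" "0 < D + \<theta> * R" "0 \<le> A" "0 < s" "s \<le> \<theta>"
  shows "0 < D + s * R + s\<^sup>2 * A"
proof -
  have "0 < D + s * R"
  proof (cases "R < 0")
    case True
    then have "\<theta> * R \<le> s * R" using assms by (intro mult_right_mono_neg) auto
    then show ?thesis using assms by simp
  next
    case False
    then show ?thesis using assms by (cases "R = 0") (auto intro: add_nonneg_pos)
  qed
  then show ?thesis using assms by (simp add: add_pos_nonneg)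
qed

text \<open>The root is written with the square root in the denominator: this form makes sense for
  \<open>A = 0\<close> and tends to \<open>- D / R\<close> as \<open>A\<close> vanishes, which is
  the ideal collision time.\<close>

lemma parabola_first_root:
  fixes D R A :: real
  assumes D: "0 < D" and R: "R < 0" and A: "0 \<le> A" and disc: "0 < R\<^sup>2 - 4 * A * D"
  defines "\<theta> \<equiv> 2 * D / (sqrt (R\<^sup>2 - 4 * A * D) - R)"
  shows "0 < \<theta>" "D + \<theta> * R + \<theta>\<^sup>2 * A = 0" "\<And>s. 0 \<le> s \<Longrightarrow> s < \<theta> \<Longrightarrow> 0 < D + s * R + s\<^sup>2 * A"
proof -
  define S where "S = sqrt (R\<^sup>2 - 4 * A * D)"
  have S: "0 < S" "S\<^sup>2 = R\<^sup>2 - 4 * A * D" using disc by (simp_all add: S_def)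
  have SR: "0 < S - R" using S R by simp
  have th: "\<theta> * (S - R) = 2 * D" using SR by (simp add: \<theta>_def S_def)
  show pos: "0 < \<theta>" using D SR by (simp add: \<theta>_def S_def)
  have "(S - R) * (S - R) * (D + \<theta> * R + \<theta>\<^sup>2 * A) =
      D * (S - R)\<^sup>2 + (\<theta> * (S - R)) * (S - R) * R + (\<theta> * (S - R))\<^sup>2 * A"
    by (simp add: algebra_simps power2_eq_square)
  also have "\<dots> = D * (S\<^sup>2 - R\<^sup>2 + 4 * A * D)"
    unfolding th by (simp add: algebra_simps power2_eq_square)
  also have "\<dots> = 0" using S by simp
  finally show root: "D + \<theta> * R + \<theta>\<^sup>2 * A = 0" using SR by simp
  have "(S - R) * (R + 2 * A * \<theta>) = (S - R) * R + 2 * A * (\<theta> * (S - R))" by (simp add: algebra_simps)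
  also have "\<dots> = S * R - R\<^sup>2 + 4 * A * D" unfolding th by (simp add: algebra_simps power2_eq_square)
  also have "\<dots> = (S - R) * (- S)" using S(2) by (simp add: algebra_simps power2_eq_square)
  finally have "(S - R) * (R + 2 * A * \<theta>) = (S - R) * (- S)" .
  then have der: "R + 2 * A * \<theta> = - S" using SR by (subst (asm) mult_cancel_left) simp
  fix s assume s: "0 \<le> s" "s < \<theta>"
  have "A * (s + \<theta>) \<le> 2 * A * \<theta>" using mult_left_mono[of "s + \<theta>" "2 * \<theta>" A] s A by simp
  then have "R + A * (s + \<theta>) < 0" using der S by simp
  then have "0 < (s - \<theta>) * (R + A * (s + \<theta>))" using s by (intro mult_neg_neg) auto
  also have "\<dots> = (D + s * R + s\<^sup>2 * A) - (D + \<theta> * R + \<theta>\<^sup>2 * A)"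
    by (simp add: algebra_simps power2_eq_square)
  finally show "0 < D + s * R + s\<^sup>2 * A" using root by simp
qed

section \<open>Limits of positions, velocities and approach rates\<close>

lemma approx_limits:
  assumes "approx m N z v x u y q" "b < 2 * m + N"
  shows "((\<lambda>\<beta>. (z \<beta> b - site m b) /\<^sub>R \<beta>) \<longlongrightarrow> offset m b) (at_right 0)"
    "((\<lambda>\<beta>. z \<beta> b) \<longlongrightarrow> site m b) (at_right 0)"
    "((\<lambda>\<beta>. Re (v \<beta> b) / \<beta>) \<longlongrightarrow> xvel m u q b) (at_right 0)"
    "((\<lambda>\<beta>. v \<beta> b) \<longlongrightarrow> Complex 0 (yvel m q b)) (at_right 0)"
proof -
  show off: "((\<lambda>\<beta>. (z \<beta> b - site m b) /\<^sub>R \<beta>) \<longlongrightarrow> offset m b) (at_right 0)"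
    and P: "((\<lambda>\<beta>. Re (v \<beta> b) / \<beta>) \<longlongrightarrow> xvel m u q b) (at_right 0)"
    using assms by (auto simp: approx_def)
  have Q: "((\<lambda>\<beta>. Im (v \<beta> b)) \<longlongrightarrow> yvel m q b) (at_right 0)" using assms by (auto simp: approx_def)
  have "((\<lambda>\<beta>. \<beta> *\<^sub>R ((z \<beta> b - site m b) /\<^sub>R \<beta>) + site m b) \<longlongrightarrow> 0 *\<^sub>R offset m b + site m b) (at_right 0)"
    by (intro tendsto_intros off)
  then have "((\<lambda>\<beta>. \<beta> *\<^sub>R ((z \<beta> b - site m b) /\<^sub>R \<beta>) + site m b) \<longlongrightarrow> site m b) (at_right 0)" by simp
  then show "((\<lambda>\<beta>. z \<beta> b) \<longlongrightarrow> site m b) (at_right 0)"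
    by (rule Lim_transform_eventually)
      (use eventually_at_right_less[of 0] in eventually_elim, simp)
  have "((\<lambda>\<beta>. \<beta> * (Re (v \<beta> b) / \<beta>)) \<longlongrightarrow> 0 * xvel m u q b) (at_right 0)" by (intro tendsto_intros P)
  then have "((\<lambda>\<beta>. \<beta> * (Re (v \<beta> b) / \<beta>)) \<longlongrightarrow> 0) (at_right 0)" by simp
  then have "((\<lambda>\<beta>. Re (v \<beta> b)) \<longlongrightarrow> 0) (at_right 0)"
    by (rule Lim_transform_eventually)
      (use eventually_at_right_less[of 0] in eventually_elim, simp)
  then show "((\<lambda>\<beta>. v \<beta> b) \<longlongrightarrow> Complex 0 (yvel m q b)) (at_right 0)" using Q by (simp add: tendsto_complex_iff)
qed

lemma approx_clearance:
  assumes "approx m N z v x u y q" "Suc c < 2 * m + N"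
  shows "((\<lambda>\<beta>. clearance m c \<beta> (z \<beta>)) \<longlongrightarrow> gap m x y c) (at_right 0)"
    "\<forall>\<^sub>F \<beta> in at_right 0. 0 \<le> clearance m c \<beta> (z \<beta>)"
  using assms by (auto simp: approx_def)

lemma approx_bend:
  assumes "approx m N z v x u y q" "Suc c < 2 * m + N"
  shows "((\<lambda>\<beta>. bend m c \<beta> (v \<beta>)) \<longlongrightarrow> 0) (at_right 0)"
proof -
  have l: "contact m c < 2 * m + N" using assms(2) by (auto simp: contact_def)
  let ?V = "\<lambda>\<beta>. (norm (v \<beta> (Suc c) - v \<beta> (contact m c)))\<^sup>2 / 4"
  have V: "(?V \<longlongrightarrow> (norm (Complex 0 (yvel m q (Suc c)) - Complex 0 (yvel m q (contact m c))))\<^sup>2 / 4) (at_right 0)"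
    by (intro tendsto_intros approx_limits(4)[OF assms(1)] assms l) simp
  have "((\<lambda>\<beta>::real. if c < 2 * m then \<beta> else \<beta>\<^sup>2) \<longlongrightarrow> 0) (at_right 0)"
    by (cases "c < 2 * m") (auto intro!: tendsto_eq_intros)
  from tendsto_mult[OF this V] have "((\<lambda>\<beta>. (if c < 2 * m then \<beta> else \<beta>\<^sup>2) * ?V \<beta>) \<longlongrightarrow> 0) (at_right 0)" by simp
  then show ?thesis
    by (rule Lim_transform_eventually)
      (use eventually_at_right_less[of 0] in eventually_elim, simp add: bend_def scale_def power2_eq_square)
qed

lemma approx_inner:
  assumes ap: "approx m N z v x u y q" and n: "a < 2 * m + N" "b < 2 * m + N"
  shows "((\<lambda>\<beta>. (z \<beta> b - z \<beta> a) \<bullet> (v \<beta> b - v \<beta> a)) \<longlongrightarrow>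
    (Im (site m b) - Im (site m a)) * (yvel m q b - yvel m q a)) (at_right 0)"
proof -
  have "((\<lambda>\<beta>. (z \<beta> b - z \<beta> a) \<bullet> (v \<beta> b - v \<beta> a)) \<longlongrightarrow>
    (site m b - site m a) \<bullet> (Complex 0 (yvel m q b) - Complex 0 (yvel m q a))) (at_right 0)"
    by (intro tendsto_intros approx_limits[OF ap] n)
  then show ?thesis by (simp add: inner_complex_def)
qed

text \<open>Here the tilt enters. At order \<open>\<beta>\<close> two products survive: horizontal
  distance of order 1 with horizontal velocity of order \<open>\<beta>\<close>, and vertical offset
  of order \<open>\<beta>\<close> with vertical velocity of order 1.\<close>

lemma approx_inner_row:
  assumes ap: "approx m N z v x u y q" and n: "a \<le> 2 * m" "b \<le> 2 * m" "0 < N"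
  shows "((\<lambda>\<beta>. (z \<beta> b - z \<beta> a) \<bullet> (v \<beta> b - v \<beta> a) / \<beta>) \<longlongrightarrow>
    2 * (real b - real a) * (xvel m u q b - xvel m u q a) +
    (Im (offset m b) - Im (offset m a)) * (yvel m q b - yvel m q a)) (at_right 0)"
proof -
  have ab: "a < 2 * m + N" "b < 2 * m + N" using n by auto
  have I: "((\<lambda>\<beta>. Im (v \<beta> c)) \<longlongrightarrow> yvel m q c) (at_right 0)" if "c < 2 * m + N" for c
    using tendsto_Im[OF approx_limits(4)[OF ap that]] by simp
  have "((\<lambda>\<beta>. (Re (z \<beta> b) - Re (z \<beta> a)) * (Re (v \<beta> b) / \<beta> - Re (v \<beta> a) / \<beta>) +
      (Im ((z \<beta> b - site m b) /\<^sub>R \<beta>) - Im ((z \<beta> a - site m a) /\<^sub>R \<beta>)) * (Im (v \<beta> b) - Im (v \<beta> a))) \<longlongrightarrow>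
    (Re (site m b) - Re (site m a)) * (xvel m u q b - xvel m u q a) +
    (Im (offset m b) - Im (offset m a)) * (yvel m q b - yvel m q a)) (at_right 0)"
    by (intro tendsto_intros approx_limits[OF ap] ab I)
  moreover have flat: "Re (site m b) - Re (site m a) = 2 * (real b - real a)" "Im (site m a) = 0" "Im (site m b) = 0"
    using n by (simp_all add: site_def)
  moreover have "\<forall>\<^sub>F \<beta> in at_right 0. (Re (z \<beta> b) - Re (z \<beta> a)) * (Re (v \<beta> b) / \<beta> - Re (v \<beta> a) / \<beta>) +
      (Im ((z \<beta> b - site m b) /\<^sub>R \<beta>) - Im ((z \<beta> a - site m a) /\<^sub>R \<beta>)) * (Im (v \<beta> b) - Im (v \<beta> a)) =
      (z \<beta> b - z \<beta> a) \<bullet> (v \<beta> b - v \<beta> a) / \<beta>"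
    using eventually_at_right_less[of 0]
    by eventually_elim (simp add: inner_complex_def flat field_simps)
  ultimately show ?thesis by (simp add: tendsto_cong)
qed

text \<open>On either side of \<open>W\<close> the tilt term contributes \<open>- q 0\<close>, which
  cancels the jump of \<open>side\<close> in \<open>xvel\<close> and leaves the difference of
  \<open>u\<close>.\<close>

lemma approx_approach:
  assumes ap: "approx m N z v x u y q" and n: "Suc c < 2 * m + N" "0 < N"
  shows "((\<lambda>\<beta>. approach m c \<beta> (z \<beta>) (v \<beta>)) \<longlongrightarrow> gap m u q c) (at_right 0)"
proof (cases "c < 2 * m")
  case True
  have "((\<lambda>\<beta>. (z \<beta> (Suc c) - z \<beta> c) \<bullet> (v \<beta> (Suc c) - v \<beta> c) / \<beta> / 2) \<longlongrightarrow>
    (2 * (real (Suc c) - real c) * (xvel m u q (Suc c) - xvel m u q c) +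
    (Im (offset m (Suc c)) - Im (offset m c)) * (yvel m q (Suc c) - yvel m q c)) / 2) (at_right 0)"
    by (intro tendsto_divide approx_inner_row[OF ap] tendsto_const) (use True n in auto)
  moreover have "(2 * (real (Suc c) - real c) * (xvel m u q (Suc c) - xvel m u q c) +
    (Im (offset m (Suc c)) - Im (offset m c)) * (yvel m q (Suc c) - yvel m q c)) / 2 = gap m u q c"
    using True by (auto simp: gap_def xvel_def yvel_def offset_def side_def)
  ultimately show ?thesis using True by (simp add: approach_def contact_def scale_def mult.commute)
next
  case False
  have l: "contact m c < 2 * m + N" using n by (auto simp: contact_def)
  have "((\<lambda>\<beta>. (z \<beta> (Suc c) - z \<beta> (contact m c)) \<bullet> (v \<beta> (Suc c) - v \<beta> (contact m c)) / 2) \<longlongrightarrow>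
    (Im (site m (Suc c)) - Im (site m (contact m c))) * (yvel m q (Suc c) - yvel m q (contact m c)) / 2) (at_right 0)"
    by (intro tendsto_divide approx_inner[OF ap] tendsto_const n l) simp
  moreover have "(Im (site m (Suc c)) - Im (site m (contact m c))) * (yvel m q (Suc c) - yvel m q (contact m c)) / 2 = gap m u q c"
    using False by (auto simp: gap_def contact_def yvel_def site_def Suc_diff_le of_nat_diff)
  ultimately show ?thesis using False by (simp add: approach_def scale_def)
qed


lemma eventually_contacts:
  assumes "\<And>c. Suc c < n \<Longrightarrow> \<forall>\<^sub>F \<beta> in F. P c \<beta>"
  shows "\<forall>\<^sub>F \<beta> in F. \<forall>c. Suc c < n \<longrightarrow> P c \<beta>"
proof -
  have "\<forall>\<^sub>F \<beta> in F. \<forall>c\<in>{..<n - 1}. P c \<beta>" using assms by (intro eventually_ball_finite) auto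
  then show ?thesis by eventually_elim auto
qed

lemma site_far:
  assumes "0 < m" "i < j" "i \<noteq> contact m (j - 1)"
  shows "2 < norm (site m j - site m i)"
proof -
  consider "j \<le> 2 * m" | "i \<le> 2 * m" "2 * m < j" | "2 * m < i" using assms by linarith
  then show ?thesis
  proof cases
    case 1
    then have "j \<noteq> Suc i" using assms by (auto simp: contact_def)
    then have "i + 2 \<le> j" using assms by simp
    then have "4 \<le> Re (site m j - site m i)" using 1 by (simp add: site_def)
    then show ?thesis using complex_Re_le_cmod[of "site m j - site m i"] by linarith
  next
    case 2
    define r where "r = real j - 2 * real m"
    have r: "real (j - 2 * m) = r" "1 \<le> r" using 2 by (auto simp: r_def of_nat_diff)
    have sq: "(norm (site m j - site m i))\<^sup>2 = 4 * r\<^sup>2 + 4 * (real i - real m)\<^sup>2"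
    proof -
      have "site m j - site m i = Complex (- (2 * (real i - real m))) (- (2 * r))"
        using 2 r by (simp add: complex_eq_iff site_def)
      then show ?thesis by (simp only: cmod_power2 complex.sel power2_minus power_mult_distrib) simp
    qed
    have "4 < 4 * r\<^sup>2 + 4 * (real i - real m)\<^sup>2"
    proof (cases "i = m")
      case True
      then have "2 * m + 1 < j" using assms 2 by (auto simp: contact_def split: if_splits)
      then have "1 < r" by (simp add: r_def)
      then show ?thesis using True by (simp add: one_less_power)
    next
      case False
      then have "0 < (real i - real m)\<^sup>2" by simp
      then show ?thesis using one_le_power[OF r(2), of 2] by linarith
    qed
    then have "2\<^sup>2 < (norm (site m j - site m i))\<^sup>2" using sq by simp
    then show ?thesis by (rule power2_less_imp_less) simp
  next
    case 3
    then have "i + 2 \<le> j" using assms by (auto simp: contact_def split: if_splits)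
    then have "4 \<le> \<bar>Im (site m j - site m i)\<bar>" using 3 assms by (simp add: site_def of_nat_diff)
    then show ?thesis using abs_Im_le_cmod[of "site m j - site m i"] by linarith
  qed
qed

definition loose :: "nat \<Rightarrow> nat \<Rightarrow> (nat \<Rightarrow> complex) \<Rightarrow> bool" where
  "loose m n z \<longleftrightarrow> (\<forall>i j. i < j \<and> j < n \<and> i \<noteq> contact m (j - 1) \<longrightarrow> 2 < dist (z j) (z i))"

lemma apartI:
  fixes z :: "nat \<Rightarrow> 'a::euclidean_space"
  assumes "\<And>i j. i < j \<Longrightarrow> j < n \<Longrightarrow> 2 < dist (z j) (z i)"
  shows "apart n z"
  unfolding apart_def
proof (intro allI impI)
  fix i j assume "i < n" "j < n" "i \<noteq> j"
  then show "2 < dist (z i) (z j)" using assms[of i j] assms[of j i]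
    by (cases i j rule: linorder_cases) (auto simp: dist_commute)
qed

lemma apart_loose:
  assumes "loose m n z" "0 < \<beta>" "\<And>c. Suc c < n \<Longrightarrow> 0 < clearance m c \<beta> z"
  shows "apart n z"
proof (rule apartI)
  fix i j assume ij: "i < j" "j < n"
  show "2 < dist (z j) (z i)"
  proof (cases "i = contact m (j - 1)")
    case True
    then show ?thesis using assms(3)[of "j - 1"] ij assms(2) by (simp add: clearance_pos_iff)
  qed (use assms ij in \<open>auto simp: loose_def\<close>)
qed

text \<open>Pairs that form no contact have sites at distance more than 2, and in a time of order
  \<open>\<beta>^2\<close> they hardly move.\<close>

lemma approx_loose:
  assumes ap: "approx m N z v x u y q" and m: "0 < m" and th: "(\<theta> \<longlongrightarrow> t) (at_right 0)"
  shows "\<forall>\<^sub>F \<beta> in at_right 0. \<forall>s. 0 \<le> s \<and> s \<le> \<beta>\<^sup>2 * \<theta> \<beta> \<longrightarrow> loose m (2 * m + N) (drift s (z \<beta>) (v \<beta>))"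
proof -
  have far: "\<forall>\<^sub>F \<beta> in at_right 0. \<forall>s. 0 \<le> s \<and> s \<le> \<beta>\<^sup>2 * \<theta> \<beta> \<longrightarrow>
      2 < dist (drift s (z \<beta>) (v \<beta>) j) (drift s (z \<beta>) (v \<beta>) i)"
    if ij: "i < j" "j < 2 * m + N" "i \<noteq> contact m (j - 1)" for i j
  proof -
    have n: "i < 2 * m + N" using ij by simp
    have "((\<lambda>\<beta>. norm (z \<beta> j - z \<beta> i) - \<beta>\<^sup>2 * \<theta> \<beta> * norm (v \<beta> j - v \<beta> i)) \<longlongrightarrow>
        norm (site m j - site m i) - 0\<^sup>2 * t * norm (Complex 0 (yvel m q j) - Complex 0 (yvel m q i))) (at_right 0)"
      by (intro tendsto_intros approx_limits[OF ap] ij n th)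
    then have "\<forall>\<^sub>F \<beta> in at_right 0. 2 < norm (z \<beta> j - z \<beta> i) - \<beta>\<^sup>2 * \<theta> \<beta> * norm (v \<beta> j - v \<beta> i)"
      by (rule order_tendstoD) (use site_far[OF m ij(1,3)] in simp)
    then show ?thesis
    proof eventually_elim
      case (elim \<beta>)
      show ?case
      proof (intro allI impI)
        fix s assume s: "0 \<le> s \<and> s \<le> \<beta>\<^sup>2 * \<theta> \<beta>"
        have "norm (z \<beta> j - z \<beta> i) - s * norm (v \<beta> j - v \<beta> i) \<le> norm ((z \<beta> j - z \<beta> i) + s *\<^sub>R (v \<beta> j - v \<beta> i))"
          using norm_diff_ineq[of "z \<beta> j - z \<beta> i" "s *\<^sub>R (v \<beta> j - v \<beta> i)"] s by simp
        moreover have "s * norm (v \<beta> j - v \<beta> i) \<le> \<beta>\<^sup>2 * \<theta> \<beta> * norm (v \<beta> j - v \<beta> i)"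
          using s by (intro mult_right_mono) auto
        ultimately show "2 < dist (drift s (z \<beta>) (v \<beta>) j) (drift s (z \<beta>) (v \<beta>) i)"
          using elim by (simp add: dist_norm drift_diff)
      qed
    qed
  qed
  have "\<forall>\<^sub>F \<beta> in at_right 0. \<forall>j\<in>{..<2 * m + N}. \<forall>i\<in>{..<j}. i \<noteq> contact m (j - 1) \<longrightarrow>
      (\<forall>s. 0 \<le> s \<and> s \<le> \<beta>\<^sup>2 * \<theta> \<beta> \<longrightarrow> 2 < dist (drift s (z \<beta>) (v \<beta>) j) (drift s (z \<beta>) (v \<beta>) i))"
  proof (intro eventually_ball_finite ballI finite_lessThan)
    fix i j assume "j \<in> {..<2 * m + N}" "i \<in> {..<j}"
    then show "\<forall>\<^sub>F \<beta> in at_right 0. i \<noteq> contact m (j - 1) \<longrightarrow>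
      (\<forall>s. 0 \<le> s \<and> s \<le> \<beta>\<^sup>2 * \<theta> \<beta> \<longrightarrow> 2 < dist (drift s (z \<beta>) (v \<beta>) j) (drift s (z \<beta>) (v \<beta>) i))"
      by (cases "i = contact m (j - 1)") (auto intro: far)
  qed
  then show ?thesis by eventually_elim (auto simp: loose_def)
qed

text \<open>A flight of duration \<open>\<beta>^2 * \<theta> \<beta>\<close> displaces the balls by
  \<open>O(\<beta>^2)\<close>, invisible in the offsets of order \<open>\<beta>\<close>; only the
  clearances change.\<close>

lemma approx_drift:
  assumes ap: "approx m N z v x u y q" and "0 < N" and th: "(\<theta> \<longlongrightarrow> t) (at_right 0)"
    and ge: "\<forall>\<^sub>F \<beta> in at_right 0. \<forall>c. Suc c < 2 * m + N \<longrightarrow>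
      0 \<le> clearance m c \<beta> (drift (\<beta>\<^sup>2 * \<theta> \<beta>) (z \<beta>) (v \<beta>))"
  shows "approx m N (\<lambda>\<beta>. drift (\<beta>\<^sup>2 * \<theta> \<beta>) (z \<beta>) (v \<beta>)) v (adv t x u) u (adv t y q) q"
  unfolding approx_def gap_adv
proof (intro conjI allI impI)
  fix b assume b: "b < 2 * m + N"
  have "((\<lambda>\<beta>. (z \<beta> b - site m b) /\<^sub>R \<beta> + (\<beta> * \<theta> \<beta>) *\<^sub>R v \<beta> b) \<longlongrightarrow> offset m b + (0 * t) *\<^sub>R Complex 0 (yvel m q b)) (at_right 0)"
    by (intro tendsto_intros approx_limits[OF ap b] th)
  moreover have "\<forall>\<^sub>F \<beta> in at_right 0. (z \<beta> b - site m b) /\<^sub>R \<beta> + (\<beta> * \<theta> \<beta>) *\<^sub>R v \<beta> b =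
      (drift (\<beta>\<^sup>2 * \<theta> \<beta>) (z \<beta>) (v \<beta>) b - site m b) /\<^sub>R \<beta>"
    using eventually_at_right_less[of 0]
    by eventually_elim (simp add: drift_def scaleR_add_right scaleR_diff_right power2_eq_square)
  ultimately show "((\<lambda>\<beta>. (drift (\<beta>\<^sup>2 * \<theta> \<beta>) (z \<beta>) (v \<beta>) b - site m b) /\<^sub>R \<beta>) \<longlongrightarrow> offset m b) (at_right 0)"
    by (simp add: tendsto_cong)
next
  fix c assume c: "Suc c < 2 * m + N"
  have "((\<lambda>\<beta>. clearance m c \<beta> (z \<beta>) + \<theta> \<beta> * approach m c \<beta> (z \<beta>) (v \<beta>) + (\<theta> \<beta>)\<^sup>2 * bend m c \<beta> (v \<beta>)) \<longlongrightarrow>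
      gap m x y c + t * gap m u q c + t\<^sup>2 * 0) (at_right 0)"
    by (intro tendsto_intros th approx_clearance[OF ap c] approx_approach[OF ap c] approx_bend[OF ap c] assms)
  moreover have "\<forall>\<^sub>F \<beta> in at_right 0. clearance m c \<beta> (z \<beta>) + \<theta> \<beta> * approach m c \<beta> (z \<beta>) (v \<beta>) + (\<theta> \<beta>)\<^sup>2 * bend m c \<beta> (v \<beta>) =
      clearance m c \<beta> (drift (\<beta>\<^sup>2 * \<theta> \<beta>) (z \<beta>) (v \<beta>))"
    using eventually_at_right_less[of 0] by eventually_elim (simp add: clearance_drift)
  ultimately show "((\<lambda>\<beta>. clearance m c \<beta> (drift (\<beta>\<^sup>2 * \<theta> \<beta>) (z \<beta>) (v \<beta>))) \<longlongrightarrow>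
      gap m x y c + t * gap m u q c) (at_right 0)"
    by (simp add: tendsto_cong)
  show "\<forall>\<^sub>F \<beta> in at_right 0. 0 \<le> clearance m c \<beta> (drift (\<beta>\<^sup>2 * \<theta> \<beta>) (z \<beta>) (v \<beta>))"
    using ge by eventually_elim (use c in simp)
qed (use ap in \<open>auto simp: approx_def\<close>)

section \<open>Persistence of open gaps and of transversal contacts\<close>

lemma approx_no_contact:
  assumes ap: "approx m N z v x u y q" and c: "Suc c < 2 * m + N" "0 < N"
    and th: "(\<theta> \<longlongrightarrow> t) (at_right 0)" and pos: "0 < gap m x y c + t * gap m u q c"
  shows "\<forall>\<^sub>F \<beta> in at_right 0. \<forall>\<sigma>. 0 < \<sigma> \<and> \<sigma> \<le> \<theta> \<beta> \<longrightarrow> 0 < clearance m c \<beta> (drift (\<beta>\<^sup>2 * \<sigma>) (z \<beta>) (v \<beta>))"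
proof -
  have "((\<lambda>\<beta>. clearance m c \<beta> (z \<beta>) + \<theta> \<beta> * approach m c \<beta> (z \<beta>) (v \<beta>)) \<longlongrightarrow>
      gap m x y c + t * gap m u q c) (at_right 0)"
    by (intro tendsto_intros th approx_clearance[OF ap c(1)] approx_approach[OF ap c])
  then have "\<forall>\<^sub>F \<beta> in at_right 0. 0 < clearance m c \<beta> (z \<beta>) + \<theta> \<beta> * approach m c \<beta> (z \<beta>) (v \<beta>)"
    using pos by (rule order_tendstoD)
  then show ?thesis
    using approx_clearance(2)[OF ap c(1)] eventually_at_right_less[of 0]
  proof eventually_elim
    case (elim \<beta>)
    then show ?case
      using positive_parabola[of "clearance m c \<beta> (z \<beta>)" "\<theta> \<beta>" "approach m c \<beta> (z \<beta>) (v \<beta>)" "bend m c \<beta> (v \<beta>)"]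
        bend_nonneg[of \<beta> m c "v \<beta>"] by (simp add: clearance_drift)
  qed
qed

lemma approx_contact:
  assumes ap: "approx m N z v x u y q" and c: "Suc c < 2 * m + N" "0 < N"
    and t: "0 < t" "gap m u q c < 0" "gap m x y c + t * gap m u q c = 0"
  shows "\<exists>\<theta>. (\<theta> \<longlongrightarrow> t) (at_right 0) \<and> (\<forall>\<^sub>F \<beta> in at_right 0. 0 < \<theta> \<beta> \<and>
    clearance m c \<beta> (drift (\<beta>\<^sup>2 * \<theta> \<beta>) (z \<beta>) (v \<beta>)) = 0 \<and>
    (\<forall>\<sigma>. 0 < \<sigma> \<and> \<sigma> < \<theta> \<beta> \<longrightarrow> 0 < clearance m c \<beta> (drift (\<beta>\<^sup>2 * \<sigma>) (z \<beta>) (v \<beta>))))"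
proof -
  define D R A where "D \<beta> = clearance m c \<beta> (z \<beta>)" and "R \<beta> = approach m c \<beta> (z \<beta>) (v \<beta>)"
    and "A \<beta> = bend m c \<beta> (v \<beta>)" for \<beta>
  define \<theta> where "\<theta> \<beta> = 2 * D \<beta> / (sqrt ((R \<beta>)\<^sup>2 - 4 * A \<beta> * D \<beta>) - R \<beta>)" for \<beta>
  have D: "(D \<longlongrightarrow> gap m x y c) (at_right 0)" and R: "(R \<longlongrightarrow> gap m u q c) (at_right 0)" and A: "(A \<longlongrightarrow> 0) (at_right 0)"
    unfolding D_def R_def A_def by (intro approx_clearance[OF ap c(1)] approx_approach[OF ap c] approx_bend[OF ap c(1)])+
  have G: "gap m x y c = - t * gap m u q c" using t by simp
  then have "0 < gap m x y c" using t mult_pos_neg[OF t(1,2)] by linarith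
  have disc: "((\<lambda>\<beta>. (R \<beta>)\<^sup>2 - 4 * A \<beta> * D \<beta>) \<longlongrightarrow> (gap m u q c)\<^sup>2 - 4 * 0 * gap m x y c) (at_right 0)"
    by (intro tendsto_intros D R A)
  have "((\<lambda>\<beta>. \<theta> \<beta>) \<longlongrightarrow> 2 * gap m x y c / (sqrt ((gap m u q c)\<^sup>2 - 4 * 0 * gap m x y c) - gap m u q c)) (at_right 0)"
    unfolding \<theta>_def by (intro tendsto_intros D R disc) (use t in simp)
  then have th: "(\<theta> \<longlongrightarrow> t) (at_right 0)" using t by (simp add: G)
  have "\<forall>\<^sub>F \<beta> in at_right 0. 0 < D \<beta>" using D \<open>0 < gap m x y c\<close> by (rule order_tendstoD)
  moreover have "\<forall>\<^sub>F \<beta> in at_right 0. R \<beta> < 0" using R t(2) by (rule order_tendstoD)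
  moreover have "\<forall>\<^sub>F \<beta> in at_right 0. 0 < (R \<beta>)\<^sup>2 - 4 * A \<beta> * D \<beta>"
    using disc by (rule order_tendstoD) (use t in simp)
  ultimately have "\<forall>\<^sub>F \<beta> in at_right 0. 0 < \<theta> \<beta> \<and>
    clearance m c \<beta> (drift (\<beta>\<^sup>2 * \<theta> \<beta>) (z \<beta>) (v \<beta>)) = 0 \<and>
    (\<forall>\<sigma>. 0 < \<sigma> \<and> \<sigma> < \<theta> \<beta> \<longrightarrow> 0 < clearance m c \<beta> (drift (\<beta>\<^sup>2 * \<sigma>) (z \<beta>) (v \<beta>)))"
    using eventually_at_right_less[of 0]
  proof eventually_elim
    case (elim \<beta>)
    have "0 \<le> A \<beta>" using bend_nonneg[OF elim(4)] by (simp add: A_def)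
    note root = parabola_first_root[OF elim(1,2) this elim(3), folded \<theta>_def]
    have "clearance m c \<beta> (drift (\<beta>\<^sup>2 * \<sigma>) (z \<beta>) (v \<beta>)) = D \<beta> + \<sigma> * R \<beta> + \<sigma>\<^sup>2 * A \<beta>" for \<sigma>
      using elim(4) by (simp add: clearance_drift D_def R_def A_def)
    then show ?case using root by simp
  qed
  then show ?thesis using th by blast
qed


lemma approx_wait:
  assumes ap: "approx m N z v x u y q" and m: "0 < m" "0 < N" and "0 < t"
    and open': "rows_open m (adv t x u)" "cols_open N (adv t y q)"
  shows "approx m N (\<lambda>\<beta>. drift (\<beta>\<^sup>2 * t) (z \<beta>) (v \<beta>)) v (adv t x u) u (adv t y q) q"
    and "\<forall>\<^sub>F \<beta> in at_right 0. \<forall>s. 0 < s \<and> s \<le> \<beta>\<^sup>2 * t \<longrightarrow> apart (2 * m + N) (drift s (z \<beta>) (v \<beta>))"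
proof -
  have gaps: "0 < gap m x y c + t * gap m u q c" if "Suc c < 2 * m + N" for c
    using open' open_iff_gap[OF m(2), of m "adv t x u" "adv t y q"] that by (simp add: gap_adv)
  have ev: "\<forall>\<^sub>F \<beta> in at_right 0. \<forall>c. Suc c < 2 * m + N \<longrightarrow>
      (\<forall>\<sigma>. 0 < \<sigma> \<and> \<sigma> \<le> t \<longrightarrow> 0 < clearance m c \<beta> (drift (\<beta>\<^sup>2 * \<sigma>) (z \<beta>) (v \<beta>)))"
    by (intro eventually_contacts approx_no_contact[OF ap _ m(2) tendsto_const gaps])
  show "approx m N (\<lambda>\<beta>. drift (\<beta>\<^sup>2 * t) (z \<beta>) (v \<beta>)) v (adv t x u) u (adv t y q) q"
    by (rule approx_drift[OF ap m(2) tendsto_const])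
      (use ev in \<open>eventually_elim, use \<open>0 < t\<close> in \<open>auto intro: less_imp_le\<close>\<close>)
  show "\<forall>\<^sub>F \<beta> in at_right 0. \<forall>s. 0 < s \<and> s \<le> \<beta>\<^sup>2 * t \<longrightarrow> apart (2 * m + N) (drift s (z \<beta>) (v \<beta>))"
    using ev approx_loose[OF ap m(1) tendsto_const[of t]] eventually_at_right_less[of 0]
  proof eventually_elim
    case (elim \<beta>)
    show ?case
    proof (intro allI impI)
      fix s assume s: "0 < s \<and> s \<le> \<beta>\<^sup>2 * t"
      define \<sigma> where "\<sigma> = s / \<beta>\<^sup>2"
      have \<sigma>: "s = \<beta>\<^sup>2 * \<sigma>" "0 < \<sigma>" "\<sigma> \<le> t" using s elim(3) by (simp_all add: \<sigma>_def field_simps)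
      show "apart (2 * m + N) (drift s (z \<beta>) (v \<beta>))"
        by (rule apart_loose[of m _ _ \<beta>]) (use elim \<sigma> s in auto)
    qed
  qed
qed

text \<open>Transversality, \<open>gap m u q c < 0\<close>, makes the contact time converge to the
  ideal one; the other gaps are strictly positive at the limiting time, hence remain open for small
  \<open>\<beta>\<close>.\<close>

lemma approx_hit:
  assumes ap: "approx m N z v x u y q" and m: "0 < m" "0 < N" and "0 < t"
    and c: "Suc c < 2 * m + N" "gap m u q c < 0" "gap m x y c + t * gap m u q c = 0"
    and other: "\<And>d. Suc d < 2 * m + N \<Longrightarrow> d \<noteq> c \<Longrightarrow> 0 < gap m x y d + t * gap m u q d"
  shows "\<exists>\<theta>. approx m N (\<lambda>\<beta>. drift (\<beta>\<^sup>2 * \<theta> \<beta>) (z \<beta>) (v \<beta>)) v (adv t x u) u (adv t y q) q \<and>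
    (\<forall>\<^sub>F \<beta> in at_right 0. 0 < \<theta> \<beta> \<and>
      (\<forall>s. 0 < s \<and> s < \<beta>\<^sup>2 * \<theta> \<beta> \<longrightarrow> apart (2 * m + N) (drift s (z \<beta>) (v \<beta>))) \<and>
      hit (2 * m + N) (contact m c) (Suc c) (drift (\<beta>\<^sup>2 * \<theta> \<beta>) (z \<beta>) (v \<beta>)) (v \<beta>))"
proof -
  obtain \<theta> where th: "(\<theta> \<longlongrightarrow> t) (at_right 0)" and root: "\<forall>\<^sub>F \<beta> in at_right 0. 0 < \<theta> \<beta> \<and>
      clearance m c \<beta> (drift (\<beta>\<^sup>2 * \<theta> \<beta>) (z \<beta>) (v \<beta>)) = 0 \<and>
      (\<forall>\<sigma>. 0 < \<sigma> \<and> \<sigma> < \<theta> \<beta> \<longrightarrow> 0 < clearance m c \<beta> (drift (\<beta>\<^sup>2 * \<sigma>) (z \<beta>) (v \<beta>)))"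
    using approx_contact[OF ap c(1) m(2) \<open>0 < t\<close> c(2,3)] by blast
  have "\<forall>\<^sub>F \<beta> in at_right 0. \<forall>d. Suc d < 2 * m + N \<longrightarrow> d \<noteq> c \<longrightarrow>
      (\<forall>\<sigma>. 0 < \<sigma> \<and> \<sigma> \<le> \<theta> \<beta> \<longrightarrow> 0 < clearance m d \<beta> (drift (\<beta>\<^sup>2 * \<sigma>) (z \<beta>) (v \<beta>)))"
  proof (rule eventually_contacts)
    fix d assume "Suc d < 2 * m + N"
    then show "\<forall>\<^sub>F \<beta> in at_right 0. d \<noteq> c \<longrightarrow>
      (\<forall>\<sigma>. 0 < \<sigma> \<and> \<sigma> \<le> \<theta> \<beta> \<longrightarrow> 0 < clearance m d \<beta> (drift (\<beta>\<^sup>2 * \<sigma>) (z \<beta>) (v \<beta>)))"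
      using approx_no_contact[OF ap _ m(2) th other] by (cases "d = c") auto
  qed
  then have ev: "\<forall>\<^sub>F \<beta> in at_right 0. 0 < \<beta> \<and> 0 < \<theta> \<beta> \<and>
      clearance m c \<beta> (drift (\<beta>\<^sup>2 * \<theta> \<beta>) (z \<beta>) (v \<beta>)) = 0 \<and>
      (\<forall>\<sigma>. 0 < \<sigma> \<and> \<sigma> < \<theta> \<beta> \<longrightarrow> 0 < clearance m c \<beta> (drift (\<beta>\<^sup>2 * \<sigma>) (z \<beta>) (v \<beta>))) \<and>
      (\<forall>d. Suc d < 2 * m + N \<longrightarrow> d \<noteq> c \<longrightarrow>
        (\<forall>\<sigma>. 0 < \<sigma> \<and> \<sigma> \<le> \<theta> \<beta> \<longrightarrow> 0 < clearance m d \<beta> (drift (\<beta>\<^sup>2 * \<sigma>) (z \<beta>) (v \<beta>))))"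
    using root eventually_at_right_less[of 0] by eventually_elim auto
  have ap': "approx m N (\<lambda>\<beta>. drift (\<beta>\<^sup>2 * \<theta> \<beta>) (z \<beta>) (v \<beta>)) v (adv t x u) u (adv t y q) q"
  proof (rule approx_drift[OF ap m(2) th])
    show "\<forall>\<^sub>F \<beta> in at_right 0. \<forall>c. Suc c < 2 * m + N \<longrightarrow>
      0 \<le> clearance m c \<beta> (drift (\<beta>\<^sup>2 * \<theta> \<beta>) (z \<beta>) (v \<beta>))"
      using ev
    proof eventually_elim
      case (elim \<beta>)
      show ?case
      proof (intro allI impI)
        fix d assume "Suc d < 2 * m + N"
        then show "0 \<le> clearance m d \<beta> (drift (\<beta>\<^sup>2 * \<theta> \<beta>) (z \<beta>) (v \<beta>))"
          using elim by (cases "d = c") (auto intro: less_imp_le)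
      qed
    qed
  qed
  have "\<forall>\<^sub>F \<beta> in at_right 0. approach m c \<beta> (drift (\<beta>\<^sup>2 * \<theta> \<beta>) (z \<beta>) (v \<beta>)) (v \<beta>) < 0"
    using approx_approach[OF ap' c(1) m(2)] c(2) by (rule order_tendstoD)
  with ev approx_loose[OF ap m(1) th]
  have "\<forall>\<^sub>F \<beta> in at_right 0. 0 < \<theta> \<beta> \<and>
      (\<forall>s. 0 < s \<and> s < \<beta>\<^sup>2 * \<theta> \<beta> \<longrightarrow> apart (2 * m + N) (drift s (z \<beta>) (v \<beta>))) \<and>
      hit (2 * m + N) (contact m c) (Suc c) (drift (\<beta>\<^sup>2 * \<theta> \<beta>) (z \<beta>) (v \<beta>)) (v \<beta>)"
  proof eventually_elim
    case (elim \<beta>)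
    let ?z = "drift (\<beta>\<^sup>2 * \<theta> \<beta>) (z \<beta>) (v \<beta>)"
    have \<beta>: "0 < \<beta>" "0 < \<theta> \<beta>" using elim by auto
    have "apart (2 * m + N) (drift s (z \<beta>) (v \<beta>))" if s: "0 < s" "s < \<beta>\<^sup>2 * \<theta> \<beta>" for s
    proof (rule apart_loose[of m _ _ \<beta>])
      define \<sigma> where "\<sigma> = s / \<beta>\<^sup>2"
      have \<sigma>: "s = \<beta>\<^sup>2 * \<sigma>" "0 < \<sigma>" "\<sigma> < \<theta> \<beta>" using s \<beta> by (simp_all add: \<sigma>_def field_simps)
      show "loose m (2 * m + N) (drift s (z \<beta>) (v \<beta>))" using elim(2) s by simp
      show "0 < clearance m d \<beta> (drift s (z \<beta>) (v \<beta>))" if "Suc d < 2 * m + N" for d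
        using elim(1) \<sigma> that by (cases "d = c") auto
    qed (fact \<beta>)
    moreover have "hit (2 * m + N) (contact m c) (Suc c) ?z (v \<beta>)"
    proof -
      have l: "loose m (2 * m + N) ?z" using elim(2) \<beta> by simp
      have gt: "2 < dist (?z j) (?z i)" if "i < j" "j < 2 * m + N" "{i, j} \<noteq> {contact m c, Suc c}" for i j
      proof (cases "i = contact m (j - 1)")
        case True
        then have "j - 1 \<noteq> c" "Suc (j - 1) = j" using that by auto
        then have "0 < clearance m (j - 1) \<beta> ?z" using elim(1) \<beta> that by auto
        then show ?thesis using \<beta> \<open>Suc (j - 1) = j\<close> True by (simp add: clearance_pos_iff)
      qed (use l that in \<open>auto simp: loose_def\<close>)
      have lt: "contact m c < Suc c" by (simp add: contact_def)
      have "dist (?z (Suc c)) (?z (contact m c)) = 2" using elim(1) clearance_pos_iff(2)[OF \<beta>(1)] by auto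
      moreover have "(v \<beta> (Suc c) - v \<beta> (contact m c)) \<bullet> (?z (Suc c) - ?z (contact m c)) < 0"
      proof -
        have "0 < 2 * scale m c \<beta>" using \<beta> by (simp add: scale_def)
        then show ?thesis using elim(3) by (simp add: approach_def divide_less_0_iff inner_commute)
      qed
      then have "(v \<beta> (contact m c) - v \<beta> (Suc c)) \<bullet> (?z (contact m c) - ?z (Suc c)) < 0"
        by (simp add: algebra_simps)
      moreover have "2 < dist (?z i) (?z j)" if "i < 2 * m + N" "j < 2 * m + N" "i \<noteq> j"
        "{i, j} \<noteq> {contact m c, Suc c}" for i j
        using gt[of i j] gt[of j i] that by (cases i j rule: linorder_cases) (auto simp: dist_commute insert_commute)
      ultimately show ?thesis using c(1) lt by (auto simp: hit_def dist_commute)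
    qed
    ultimately show ?case using \<beta> by blast
  qed
  then show ?thesis using ap' by blast
qed


section \<open>Velocities after an impact\<close>

lemma bounce_contact:
  fixes z v :: "nat \<Rightarrow> complex"
  assumes "0 < \<beta>" "dist (z (Suc c)) (z (contact m c)) = 2"
  shows "bounce (contact m c) (Suc c) z v i = v i +
    ((if i = contact m c then 1 else if i = Suc c then - 1 else 0) * (approach m c \<beta> z v * scale m c \<beta> / 2)) *\<^sub>R
      (z (Suc c) - z (contact m c))"
proof -
  let ?a = "contact m c" and ?b = "Suc c"
  have n: "norm (z ?b - z ?a) = 2" "norm (z ?a - z ?b) = 2" using assms(2) by (simp_all add: dist_norm norm_minus_commute)
  have s: "approach m c \<beta> z v * scale m c \<beta> / 2 = (z ?b - z ?a) \<bullet> (v ?b - v ?a) / 4"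
    using assms(1) by (simp add: approach_def scale_def)
  have "proj_along (z ?b - z ?a) (v ?b - v ?a) = (approach m c \<beta> z v * scale m c \<beta> / 2) *\<^sub>R (z ?b - z ?a)"
    unfolding s by (simp add: proj_along_def n inner_commute)
  moreover have "proj_along (z ?a - z ?b) (v ?a - v ?b) = - proj_along (z ?b - z ?a) (v ?b - v ?a)"
  proof -
    have "proj_along (- w) (- p) = - proj_along w p" for w p :: complex by (simp add: proj_along_def)
    from this[of "z ?b - z ?a" "v ?b - v ?a"] show ?thesis by simp
  qed
  moreover have "?a \<noteq> ?b" by (simp add: contact_def)
  ultimately show ?thesis by (simp add: bounce_def)
qed

text \<open>The impulse points along the line of centres. In the row it has order
  \<open>\<beta>\<close> and is nearly horizontal, so its vertical part vanishes in the limit and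
  the horizontal velocities exchange as \<open>u\<close> does. In the column it has order 1 and is
  vertical up to \<open>o(\<beta>)\<close>, so horizontal velocities keep their limits; an impact on
  \<open>W\<close> then changes \<open>u\<close> only through \<open>q 0\<close>.\<close>

lemma approx_bounce:
  assumes ap: "approx m N z v x u y q" and c: "Suc c < 2 * m + N" "0 < N" "0 < m"
    and touch: "\<forall>\<^sub>F \<beta> in at_right 0. dist (z \<beta> (Suc c)) (z \<beta> (contact m c)) = 2"
    and row: "c < 2 * m \<Longrightarrow> u' = u \<circ> Transposition.transpose c (Suc c) \<and> q' = q"
    and col: "2 * m \<le> c \<Longrightarrow> u' = (\<lambda>i. u i - (if c = 2 * m then side m i * (q 1 - q 0) else 0)) \<and>
      q' = q \<circ> Transposition.transpose (c - 2 * m) (Suc (c - 2 * m))"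
  shows "approx m N z (\<lambda>\<beta>. bounce (contact m c) (Suc c) (z \<beta>) (v \<beta>)) x u' y q'"
  unfolding approx_def
proof (intro conjI allI impI)
  let ?a = "contact m c" and ?b = "Suc c"
  have a: "?a < 2 * m + N" using c by (auto simp: contact_def)
  define sg :: "nat \<Rightarrow> real" where "sg i = (if i = ?a then 1 else if i = ?b then - 1 else 0)" for i
  define R where "R \<beta> = approach m c \<beta> (z \<beta>) (v \<beta>)" for \<beta>
  have R: "(R \<longlongrightarrow> gap m u q c) (at_right 0)" unfolding R_def by (rule approx_approach[OF ap c(1,2)])
  note lim = approx_limits[OF ap]
  have ev: "\<forall>\<^sub>F \<beta> in at_right 0. 0 < \<beta> \<and>
      Re (bounce ?a ?b (z \<beta>) (v \<beta>) i) = Re (v \<beta> i) + sg i * (R \<beta> * scale m c \<beta> / 2) * (Re (z \<beta> ?b) - Re (z \<beta> ?a)) \<and>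
      Im (bounce ?a ?b (z \<beta>) (v \<beta>) i) = Im (v \<beta> i) + sg i * (R \<beta> * scale m c \<beta> / 2) * (Im (z \<beta> ?b) - Im (z \<beta> ?a))" for i
    using touch eventually_at_right_less[of 0]
    by eventually_elim (simp add: bounce_contact sg_def R_def)
  fix i assume i: "i < 2 * m + N"
  have Imv: "((\<lambda>\<beta>. Im (v \<beta> i)) \<longlongrightarrow> yvel m q i) (at_right 0)"
    using tendsto_Im[OF lim(4)[OF i]] by simp
  show "((\<lambda>\<beta>. Re (bounce ?a ?b (z \<beta>) (v \<beta>) i) / \<beta>) \<longlongrightarrow> xvel m u' q' i) (at_right 0)"
  proof (cases "c < 2 * m")
    case True
    have "((\<lambda>\<beta>. Re (v \<beta> i) / \<beta> + sg i * (R \<beta> / 2) * (Re (z \<beta> ?b) - Re (z \<beta> ?a))) \<longlongrightarrow>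
        xvel m u q i + sg i * (gap m u q c / 2) * (Re (site m ?b) - Re (site m ?a))) (at_right 0)"
      by (intro tendsto_intros lim i a c R) simp
    moreover have "\<forall>\<^sub>F \<beta> in at_right 0. Re (v \<beta> i) / \<beta> + sg i * (R \<beta> / 2) * (Re (z \<beta> ?b) - Re (z \<beta> ?a)) =
        Re (bounce ?a ?b (z \<beta>) (v \<beta>) i) / \<beta>"
      using ev[of i]
    proof eventually_elim
      case (elim \<beta>)
      show ?case unfolding elim[THEN conjunct2, THEN conjunct1]
        using elim[THEN conjunct1] True by (simp add: scale_def field_simps)
    qed
    moreover have "xvel m u q i + sg i * (gap m u q c / 2) * (Re (site m ?b) - Re (site m ?a)) = xvel m u' q' i"
      using True row by (auto simp: xvel_def sg_def gap_def contact_def site_def Transposition.transpose_def)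
    ultimately show ?thesis by (simp add: tendsto_cong)
  next
    case False
    have "((\<lambda>\<beta>. Re (v \<beta> i) / \<beta> + sg i * (R \<beta> / 2) *
          (Re ((z \<beta> ?b - site m ?b) /\<^sub>R \<beta>) - Re ((z \<beta> ?a - site m ?a) /\<^sub>R \<beta>))) \<longlongrightarrow>
        xvel m u q i + sg i * (gap m u q c / 2) * (Re (offset m ?b) - Re (offset m ?a))) (at_right 0)"
      by (intro tendsto_intros lim i a c R) simp
    moreover have "\<forall>\<^sub>F \<beta> in at_right 0. Re (v \<beta> i) / \<beta> + sg i * (R \<beta> / 2) *
          (Re ((z \<beta> ?b - site m ?b) /\<^sub>R \<beta>) - Re ((z \<beta> ?a - site m ?a) /\<^sub>R \<beta>)) =
        Re (bounce ?a ?b (z \<beta>) (v \<beta>) i) / \<beta>"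
    proof -
      have "Re (site m ?b) = 0" "Re (site m ?a) = 0" using False by (auto simp: site_def contact_def)
      note flat = this
      show ?thesis using ev[of i]
      proof eventually_elim
        case (elim \<beta>)
        show ?case unfolding elim[THEN conjunct2, THEN conjunct1]
          using elim[THEN conjunct1] False flat by (simp add: scale_def field_simps)
      qed
    qed
    moreover have "xvel m u q i + sg i * (gap m u q c / 2) * (Re (offset m ?b) - Re (offset m ?a)) = xvel m u' q' i"
      using False col by (auto simp: xvel_def offset_def Transposition.transpose_def algebra_simps)
    ultimately show ?thesis by (simp add: tendsto_cong)
  qed
  show "((\<lambda>\<beta>. Im (bounce ?a ?b (z \<beta>) (v \<beta>) i)) \<longlongrightarrow> yvel m q' i) (at_right 0)"
  proof -
    have "((\<lambda>\<beta>. scale m c \<beta>) \<longlongrightarrow> (if c < 2 * m then 0 else 1)) (at_right 0)"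
      by (simp add: scale_def tendsto_ident_at)
    then have "((\<lambda>\<beta>. Im (v \<beta> i) + sg i * (R \<beta> * scale m c \<beta> / 2) * (Im (z \<beta> ?b) - Im (z \<beta> ?a))) \<longlongrightarrow>
        yvel m q i + sg i * (gap m u q c * (if c < 2 * m then 0 else 1) / 2) * (Im (site m ?b) - Im (site m ?a))) (at_right 0)"
      by (intro tendsto_intros lim i a c R Imv) simp_all
    moreover have "\<forall>\<^sub>F \<beta> in at_right 0. Im (v \<beta> i) + sg i * (R \<beta> * scale m c \<beta> / 2) * (Im (z \<beta> ?b) - Im (z \<beta> ?a)) =
        Im (bounce ?a ?b (z \<beta>) (v \<beta>) i)"
      using ev[of i] by eventually_elim simp
    moreover have "yvel m q i + sg i * (gap m u q c * (if c < 2 * m then 0 else 1) / 2) * (Im (site m ?b) - Im (site m ?a)) =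
        yvel m q' i"
    proof (cases "c < 2 * m")
      case True
      then show ?thesis using row by simp
    next
      case False
      define e where "e = c - 2 * m"
      have ce: "c = 2 * m + e" using False by (simp add: e_def)
      have s: "Im (site m ?b) - Im (site m ?a) = - 2" "gap m u q c = q e - q (Suc e)"
        by (simp_all add: ce site_def contact_def gap_def)
      have "sg i * (gap m u q c * (if c < 2 * m then 0 else 1) / 2) * (Im (site m ?b) - Im (site m ?a)) =
          sg i * (q (Suc e) - q e)" unfolding s using False by (simp add: field_simps)
      note s = this
      have q': "q' = q \<circ> Transposition.transpose e (Suc e)" using col False by (simp add: e_def)
      show ?thesis unfolding s q' using c(3)
        by (auto simp: ce yvel_def sg_def contact_def Transposition.transpose_def)
    qed
    ultimately show ?thesis by (simp add: tendsto_cong)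
  qed
qed (use ap in \<open>auto simp: approx_def\<close>)

section \<open>Escape after the last collision\<close>

lemma recede:
  fixes p w :: "'a::real_inner"
  assumes "2 \<le> norm p" "0 < p \<bullet> w" "0 < s"
  shows "2 < norm (p + s *\<^sub>R w)"
proof -
  have "4 \<le> (norm p)\<^sup>2" using power_mono[OF assms(1), of 2] by simp
  moreover have "0 < 2 * s * (p \<bullet> w)" using assms by simp
  moreover have "0 \<le> s\<^sup>2 * (norm w)\<^sup>2" by simp
  ultimately have "4 < (norm (p + s *\<^sub>R w))\<^sup>2" unfolding norm_drift_square by linarith
  then have "2\<^sup>2 < (norm (p + s *\<^sub>R w))\<^sup>2" by simp
  then show ?thesis by (rule power2_less_imp_less) simp
qed

lemma recede_past:
  fixes p w :: "'a::real_inner"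
  assumes "2 < norm p" "p \<bullet> w < 0" "s \<le> 0"
  shows "2 < norm (p + s *\<^sub>R w)"
proof (cases "s = 0")
  case False
  then show ?thesis using recede[of p "- w" "- s"] assms by simp
qed (use assms in simp)

text \<open>
  A column ball leaves upwards between row balls it never touches. Its horizontal distance from such
  a ball may start below 2 by \<open>o(\<beta>)\<close>, but grows at a rate of order \<open>\<beta>\<close>, and before it has grown enough
  the vertical distance is still at least 1.
\<close>

lemma eventually_clears:
  fixes a b c e :: "real \<Rightarrow> real"
  assumes a: "((\<lambda>\<beta>. (a \<beta> - d) / \<beta>) \<longlongrightarrow> 0) (at_right 0)" "2 \<le> d"
    and b: "((\<lambda>\<beta>. b \<beta> / \<beta>) \<longlongrightarrow> p) (at_right 0)" "0 < p"
    and c: "(c \<longlongrightarrow> c0) (at_right 0)" "2 \<le> \<bar>c0\<bar>" and e: "(e \<longlongrightarrow> e0) (at_right 0)"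
  shows "\<forall>\<^sub>F \<beta> in at_right 0. \<forall>s>0. 4 < (a \<beta> + s * b \<beta>)\<^sup>2 + (c \<beta> + s * e \<beta>)\<^sup>2"
proof -
  \<comment> \<open>Up to \<open>s0\<close> the vertical distance changes by at most 1/2, so it
    stays at least 3/2 - 1/2 = 1. With horizontal distance above 9/5 this suffices, as 81/25 + 1 >
    4. After \<open>s0\<close> the horizontal distance alone exceeds 2.\<close>
  define s0 where "s0 = 1 / (2 * (\<bar>e0\<bar> + 1))"
  have s0: "0 < s0" "s0 * (\<bar>e0\<bar> + 1) = 1 / 2" by (simp_all add: s0_def add_nonneg_pos)
  have "((\<lambda>\<beta>. \<beta> * ((a \<beta> - d) / \<beta>) + d) \<longlongrightarrow> 0 * 0 + d) (at_right 0)" by (intro tendsto_intros a)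
  then have "\<forall>\<^sub>F \<beta> in at_right 0. 9 / 5 < \<beta> * ((a \<beta> - d) / \<beta>) + d" by (rule order_tendstoD) (use a in simp)
  moreover have "\<forall>\<^sub>F \<beta> in at_right 0. 0 < b \<beta> / \<beta>" using b by (rule order_tendstoD)
  moreover have "\<forall>\<^sub>F \<beta> in at_right 0. 3 / 2 < \<bar>c \<beta>\<bar>"
    using tendsto_rabs[OF c(1)] by (rule order_tendstoD) (use c in simp)
  moreover have "\<forall>\<^sub>F \<beta> in at_right 0. \<bar>e \<beta>\<bar> < \<bar>e0\<bar> + 1"
    using tendsto_rabs[OF e] by (rule order_tendstoD) simp
  moreover have "((\<lambda>\<beta>. (a \<beta> - d) / \<beta> + s0 * (b \<beta> / \<beta>)) \<longlongrightarrow> 0 + s0 * p) (at_right 0)"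
    by (intro tendsto_intros a b)
  then have "\<forall>\<^sub>F \<beta> in at_right 0. 0 < (a \<beta> - d) / \<beta> + s0 * (b \<beta> / \<beta>)"
    by (rule order_tendstoD) (use s0 b in simp)
  ultimately show ?thesis using eventually_at_right_less[of 0]
  proof eventually_elim
    case (elim \<beta>)
    have bb: "0 < b \<beta>" "9 / 5 < a \<beta>" using elim by (simp_all add: zero_less_divide_iff)
    have "0 < ((a \<beta> - d) + s0 * b \<beta>) / \<beta>" using elim(5) by (simp add: add_divide_distrib)
    then have d: "d < a \<beta> + s0 * b \<beta>" using elim(6) by (simp add: zero_less_divide_iff)
    show ?case
    proof (intro allI impI)
      fix s :: real assume s: "0 < s"
      show "4 < (a \<beta> + s * b \<beta>)\<^sup>2 + (c \<beta> + s * e \<beta>)\<^sup>2"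
      proof (cases "s \<le> s0")
        case True
        have "\<bar>s * e \<beta>\<bar> \<le> s0 * (\<bar>e0\<bar> + 1)"
          unfolding abs_mult using True s elim(4) by (intro mult_mono) auto
        then have "1 \<le> \<bar>c \<beta> + s * e \<beta>\<bar>" using elim(3) s0 by linarith
        then have "1 \<le> (c \<beta> + s * e \<beta>)\<^sup>2" using abs_le_square_iff[of 1 "c \<beta> + s * e \<beta>"] by simp
        moreover have "0 < s * b \<beta>" using s bb by simp
        then have "(9 / 5)\<^sup>2 < (a \<beta> + s * b \<beta>)\<^sup>2" using bb by (intro power_strict_mono) auto
        then have "81 / 25 < (a \<beta> + s * b \<beta>)\<^sup>2" by (simp add: power2_eq_square)
        ultimately show ?thesis by linarith
      next
        case False
        then have "s0 * b \<beta> \<le> s * b \<beta>" using bb by (intro mult_right_mono) auto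
        then have "2\<^sup>2 < (a \<beta> + s * b \<beta>)\<^sup>2" using d a(2) by (intro power_strict_mono) auto
        then have "4 < (a \<beta> + s * b \<beta>)\<^sup>2" by simp
        then show ?thesis using zero_le_power2[of "c \<beta> + s * e \<beta>"] by linarith
      qed
    qed
  qed
qed

lemma cols_open_less: "cols_open N q \<Longrightarrow> e < f \<Longrightarrow> f < N \<Longrightarrow> q f < q e"
proof (induction f)
  case (Suc f)
  then have "q (Suc f) < q f" by (simp add: cols_open_def)
  then show ?case using Suc by (cases "e = f") auto
qed simp

lemma eventually_pairs:
  fixes n :: nat
  assumes "\<And>i j. i < j \<Longrightarrow> j < n \<Longrightarrow> \<forall>\<^sub>F \<beta> in F. P i j \<beta>"
  shows "\<forall>\<^sub>F \<beta> in F. \<forall>j<n. \<forall>i<j. P i j \<beta>"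
proof -
  have "\<forall>\<^sub>F \<beta> in F. \<forall>j\<in>{..<n}. \<forall>i\<in>{..<j}. P i j \<beta>"
    using assms by (intro eventually_ball_finite[OF finite_lessThan] ballI) auto
  then show ?thesis by eventually_elim auto
qed

lemma approx_separated:
  assumes ap: "approx m N z v x u y q" and m: "0 < m" and ij: "i < j" "j < 2 * m + N"
  shows "\<forall>\<^sub>F \<beta> in at_right 0. 2 \<le> norm (z \<beta> j - z \<beta> i)"
    and "(\<And>c. Suc c < 2 * m + N \<Longrightarrow> 0 < gap m x y c) \<Longrightarrow> \<forall>\<^sub>F \<beta> in at_right 0. 2 < norm (z \<beta> j - z \<beta> i)"
proof -
  have far: "\<forall>\<^sub>F \<beta> in at_right 0. 2 < norm (z \<beta> j - z \<beta> i)" if "i \<noteq> contact m (j - 1)"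
    using approx_loose[OF ap m tendsto_const[of 0]]
    by eventually_elim (use ij that in \<open>auto simp: loose_def dist_norm\<close>)
  have c: "Suc (j - 1) < 2 * m + N" "Suc (j - 1) = j" using ij by auto
  show "\<forall>\<^sub>F \<beta> in at_right 0. 2 \<le> norm (z \<beta> j - z \<beta> i)"
  proof (cases "i = contact m (j - 1)")
    case True
    show ?thesis using approx_clearance(2)[OF ap c(1)] eventually_at_right_less[of 0]
      by eventually_elim (use True c in \<open>simp add: clearance_pos_iff dist_norm\<close>)
  next
    case False
    show ?thesis using far[OF False] by eventually_elim simp
  qed
  show "\<forall>\<^sub>F \<beta> in at_right 0. 2 < norm (z \<beta> j - z \<beta> i)" if g: "\<And>c. Suc c < 2 * m + N \<Longrightarrow> 0 < gap m x y c"
  proof (cases "i = contact m (j - 1)")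
    case True
    have "\<forall>\<^sub>F \<beta> in at_right 0. 0 < clearance m (j - 1) \<beta> (z \<beta>)"
      using approx_clearance(1)[OF ap c(1)] g[OF c(1)] by (rule order_tendstoD)
    then show ?thesis using eventually_at_right_less[of 0]
      by eventually_elim (use True c in \<open>simp add: clearance_pos_iff dist_norm\<close>)
  qed (rule far)
qed


text \<open>Within the row, and within the column including \<open>W\<close>, relative position and
  velocity have positive inner product, so distances grow. For a column ball and a side ball of the
  row this product is negative, since the column rises towards the row; there the widening of the
  row decides.\<close>

lemma approx_stop:
  assumes ap: "approx m N z v x u y q" and m: "0 < m" "0 < N"
    and u: "rows_open m u" "u m = - q 0" and q: "cols_open N q" "\<And>e. e < N \<Longrightarrow> 0 < q e"
  shows "\<forall>\<^sub>F \<beta> in at_right 0. \<forall>s>0. apart (2 * m + N) (drift s (z \<beta>) (v \<beta>))"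
proof -
  note lim = approx_limits[OF ap]
  have via: "\<forall>\<^sub>F \<beta> in at_right 0. \<forall>s>0. 2 < norm ((z \<beta> j - z \<beta> i) + s *\<^sub>R (v \<beta> j - v \<beta> i))"
    if "\<forall>\<^sub>F \<beta> in at_right 0. 0 < (z \<beta> j - z \<beta> i) \<bullet> (v \<beta> j - v \<beta> i)" "i < j" "j < 2 * m + N" for i j
    using that(1) approx_separated(1)[OF ap m(1) that(2,3)]
    by eventually_elim (auto intro: recede)
  have pair: "\<forall>\<^sub>F \<beta> in at_right 0. \<forall>s>0. 2 < norm ((z \<beta> j - z \<beta> i) + s *\<^sub>R (v \<beta> j - v \<beta> i))"
    if ij: "i < j" "j < 2 * m + N" for i j
  proof -
    consider "j \<le> 2 * m" | "2 * m < j" "i = m \<or> 2 * m < i" | "2 * m < j" "i \<le> 2 * m" "i \<noteq> m" by linarith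
    then show ?thesis
    proof cases
      case 1
      have q0: "0 < q 0" using q m by simp
      have uu: "u i < u j" using rows_open_less[OF u(1) ij(1) 1] .
      define d where "d = real j - real i"
      have d: "1 \<le> d" using ij by (simp add: d_def)
      have "0 < 2 * d * (xvel m u q j - xvel m u q i) +
          (Im (offset m j) - Im (offset m i)) * (yvel m q j - yvel m q i)"
      proof (cases "i = m \<or> j = m")
        case True
        then have "xvel m u q j - xvel m u q i = u j - u i + q 0"
          using 1 ij by (auto simp: xvel_def side_def)
        moreover have "(Im (offset m j) - Im (offset m i)) * (yvel m q j - yvel m q i) = - 2 * q 0"
          using True 1 ij by (auto simp: offset_def yvel_def)
        \<comment> \<open>The share of \<open>q 0\<close> in the horizontal term, at least
          \<open>2 * q 0\<close> since \<open>1 \<le> d\<close>, compensates the tilt term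
          \<open>- 2 * q 0\<close>.\<close>
        moreover have "1 * (u j - u i + q 0) \<le> d * (u j - u i + q 0)"
          using d uu q0 by (intro mult_right_mono) auto
        ultimately show ?thesis using uu by simp
      next
        case False
        then have "u j - u i \<le> xvel m u q j - xvel m u q i" "yvel m q i = 0" "yvel m q j = 0"
          using 1 ij q0 by (auto simp: xvel_def yvel_def side_def)
        then show ?thesis using uu d by simp
      qed
      from order_tendstoD(1)[OF approx_inner_row[OF ap _ 1 m(2)] this[unfolded d_def]]
      have "\<forall>\<^sub>F \<beta> in at_right 0. 0 < (z \<beta> j - z \<beta> i) \<bullet> (v \<beta> j - v \<beta> i) / \<beta>" using ij 1 by simp
      then have "\<forall>\<^sub>F \<beta> in at_right 0. 0 < (z \<beta> j - z \<beta> i) \<bullet> (v \<beta> j - v \<beta> i)"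
        using eventually_at_right_less[of 0] by eventually_elim (simp add: zero_less_divide_iff)
      then show ?thesis using via ij by blast
    next
      case 2
      define e where "e = (if i = m then 0 else i - 2 * m)"
      define f where "f = j - 2 * m"
      have ef: "e < f" "f < N" "i = (if e = 0 then m else 2 * m + e)" "j = 2 * m + f"
        using 2 ij m by (auto simp: e_def f_def)
      have "q f < q e" by (rule cols_open_less[OF q(1) ef(1,2)])
      then have "0 < (- 2 * (real f - real e)) * (q f - q e)" using ef by (intro mult_neg_neg) auto
      moreover have "(Im (site m j) - Im (site m i)) * (yvel m q j - yvel m q i) = (- 2 * (real f - real e)) * (q f - q e)"
        using ef m by (auto simp: site_def yvel_def)
      ultimately have "0 < (Im (site m j) - Im (site m i)) * (yvel m q j - yvel m q i)" by simp
      from order_tendstoD(1)[OF approx_inner[OF ap _ ij(2)] this] show ?thesis using via ij by simp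
    next
      case 3
      define \<sigma> :: real where "\<sigma> = (if m < i then 1 else - 1)"
      define d where "d = 2 * \<bar>real i - real m\<bar>"
      have i: "i < 2 * m + N" using ij by simp
      have off: "Re (offset m b) = 0" for b by (simp add: offset_def)
      have \<sigma>: "\<sigma> * \<sigma> = 1" "\<sigma> * (2 * (real i - real m)) = d" by (auto simp: \<sigma>_def d_def)
      have "\<bar>Im (site m i) - Im (site m j)\<bar> = 2 * real (j - 2 * m)" using 3 by (simp add: site_def)
      then have c0: "2 \<le> \<bar>Im (site m i) - Im (site m j)\<bar>" using 3 by simp
      have "((\<lambda>\<beta>. \<sigma> * (Re ((z \<beta> i - site m i) /\<^sub>R \<beta>) - Re ((z \<beta> j - site m j) /\<^sub>R \<beta>))) \<longlongrightarrow>
          \<sigma> * (Re (offset m i) - Re (offset m j))) (at_right 0)"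
        by (intro tendsto_intros lim i ij)
      moreover have "\<forall>\<^sub>F \<beta> in at_right 0. \<sigma> * (Re ((z \<beta> i - site m i) /\<^sub>R \<beta>) - Re ((z \<beta> j - site m j) /\<^sub>R \<beta>)) =
          (\<sigma> * (Re (z \<beta> i) - Re (z \<beta> j)) - d) / \<beta>"
      proof -
        have s: "Re (site m i) = 2 * (real i - real m)" "Re (site m j) = 0" using 3 by (auto simp: site_def)
        show ?thesis using eventually_at_right_less[of 0]
          by eventually_elim (simp add: s \<sigma>(2)[symmetric] field_simps)
      qed
      ultimately have a: "((\<lambda>\<beta>. (\<sigma> * (Re (z \<beta> i) - Re (z \<beta> j)) - d) / \<beta>) \<longlongrightarrow> 0) (at_right 0)"
        by (simp add: tendsto_cong off)
      have "((\<lambda>\<beta>. \<sigma> * (Re (v \<beta> i) / \<beta> - Re (v \<beta> j) / \<beta>)) \<longlongrightarrow> \<sigma> * (xvel m u q i - xvel m u q j)) (at_right 0)"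
        by (intro tendsto_intros lim i ij)
      then have b: "((\<lambda>\<beta>. \<sigma> * (Re (v \<beta> i) - Re (v \<beta> j)) / \<beta>) \<longlongrightarrow> \<sigma> * (xvel m u q i - xvel m u q j)) (at_right 0)"
        by (simp only: diff_divide_distrib[symmetric] times_divide_eq_right)
      \<comment> \<open>As \<open>u m = - q 0\<close>, the middle ball and the column have zero
        horizontal velocity at order \<open>\<beta>\<close>, and openness of \<open>u\<close> drives
        the two halves of the row apart from them.\<close>
      have p: "0 < \<sigma> * (xvel m u q i - xvel m u q j)"
      proof (cases "m < i")
        case True
        then have "u m < u i" using rows_open_less[OF u(1)] 3 by simp
        then show ?thesis using True 3 u(2) q(2)[of 0] m by (simp add: \<sigma>_def xvel_def side_def)
      next
        case False
        then have "u i < u m" using rows_open_less[OF u(1)] 3 by simp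
        then show ?thesis using False 3 u(2) q(2)[of 0] m by (simp add: \<sigma>_def xvel_def side_def)
      qed
      have c: "((\<lambda>\<beta>. Im (z \<beta> i) - Im (z \<beta> j)) \<longlongrightarrow> Im (site m i) - Im (site m j)) (at_right 0)"
        by (intro tendsto_intros lim i ij)
      have e: "((\<lambda>\<beta>. Im (v \<beta> i) - Im (v \<beta> j)) \<longlongrightarrow> Im (Complex 0 (yvel m q i)) - Im (Complex 0 (yvel m q j))) (at_right 0)"
        by (intro tendsto_intros lim i ij)
      have "2 \<le> d" using 3 by (auto simp: d_def abs_real_def)
      from eventually_clears[OF a this b p c c0 e] show ?thesis
      proof eventually_elim
        case (elim \<beta>)
        show ?case
        proof (intro allI impI)
          fix s :: real assume "0 < s"
          then have "4 < (\<sigma> * (Re (z \<beta> i) - Re (z \<beta> j)) + s * (\<sigma> * (Re (v \<beta> i) - Re (v \<beta> j))))\<^sup>2 +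
              (Im (z \<beta> i) - Im (z \<beta> j) + s * (Im (v \<beta> i) - Im (v \<beta> j)))\<^sup>2" using elim by blast
          also have "\<dots> = (Re (z \<beta> i) - Re (z \<beta> j) + s * (Re (v \<beta> i) - Re (v \<beta> j)))\<^sup>2 +
              (Im (z \<beta> i) - Im (z \<beta> j) + s * (Im (v \<beta> i) - Im (v \<beta> j)))\<^sup>2"
            by (simp add: \<sigma>_def power2_eq_square algebra_simps)
          also have "\<dots> = (norm ((z \<beta> j - z \<beta> i) + s *\<^sub>R (v \<beta> j - v \<beta> i)))\<^sup>2"
            unfolding cmod_power2 by (simp add: power2_eq_square algebra_simps)
          finally have "2\<^sup>2 < (norm ((z \<beta> j - z \<beta> i) + s *\<^sub>R (v \<beta> j - v \<beta> i)))\<^sup>2" by simp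
          then show "2 < norm ((z \<beta> j - z \<beta> i) + s *\<^sub>R (v \<beta> j - v \<beta> i))" by (rule power2_less_imp_less) simp
        qed
      qed
    qed
  qed
  have "\<forall>\<^sub>F \<beta> in at_right 0. \<forall>j<2 * m + N. \<forall>i<j. \<forall>s>0. 2 < norm ((z \<beta> j - z \<beta> i) + s *\<^sub>R (v \<beta> j - v \<beta> i))"
    by (rule eventually_pairs) (rule pair)
  then show ?thesis by eventually_elim (auto intro!: apartI simp: dist_norm drift_diff)
qed

text \<open>Each event is realised for all sufficiently small \<open>\<beta>\<close>, and only
  finitely many such conditions are combined. The induction hypothesis is applied to the family of
  states at the actual impact times, which vary with \<open>\<beta>\<close>.\<close>

lemma irun_run:
  assumes "irun m N k x u y q" and m: "0 < m" "0 < N" and "approx m N z v x u y q"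
  shows "\<forall>\<^sub>F \<beta> in at_right 0. run (2 * m + N) k (z \<beta>) (v \<beta>)"
  using assms(1,4)
proof (induction arbitrary: z v rule: irun.induct)
  case (irun_stop u q x y)
  have "\<forall>\<^sub>F \<beta> in at_right 0. \<forall>s>0. apart (2 * m + N) (drift s (z \<beta>) (v \<beta>))"
    by (rule approx_stop[OF irun_stop(5) m irun_stop(1,4,2)]) (rule irun_stop(3))
  then show ?case by eventually_elim (auto intro: run.run_stop)
next
  case (irun_wait t x u y q k)
  note w = approx_wait[OF irun_wait(6) m irun_wait(1,2,3)]
  from irun_wait.IH[OF w(1)] w(2) eventually_at_right_less[of 0] show ?case
  proof eventually_elim
    case (elim \<beta>)
    show ?case by (rule run_wait[of _ _ "\<beta>\<^sup>2 * t"]) (use elim irun_wait(1) in auto)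
  qed
next
  case (irun_row t c u x y q k)
  have gaps: "0 < gap m x y d + t * gap m u q d" if "Suc d < 2 * m + N" "d \<noteq> c" for d
    using irun_row(5)[of d] irun_row(6) that unfolding gap_adv[symmetric]
    by (cases "d < 2 * m") (auto simp: gap_def cols_open_def)
  have c: "Suc c < 2 * m + N" "gap m u q c < 0" "gap m x y c + t * gap m u q c = 0"
    using irun_row m unfolding gap_adv[symmetric] by (auto simp: gap_def)
  obtain \<theta> where ap: "approx m N (\<lambda>\<beta>. drift (\<beta>\<^sup>2 * \<theta> \<beta>) (z \<beta>) (v \<beta>)) v (adv t x u) u (adv t y q) q"
    and h: "\<forall>\<^sub>F \<beta> in at_right 0. 0 < \<theta> \<beta> \<and>
      (\<forall>s. 0 < s \<and> s < \<beta>\<^sup>2 * \<theta> \<beta> \<longrightarrow> apart (2 * m + N) (drift s (z \<beta>) (v \<beta>))) \<and>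
      hit (2 * m + N) (contact m c) (Suc c) (drift (\<beta>\<^sup>2 * \<theta> \<beta>) (z \<beta>) (v \<beta>)) (v \<beta>)"
    using approx_hit[OF irun_row.prems m irun_row(1) c gaps] by blast
  have touch: "\<forall>\<^sub>F \<beta> in at_right 0. dist (drift (\<beta>\<^sup>2 * \<theta> \<beta>) (z \<beta>) (v \<beta>) (Suc c)) (drift (\<beta>\<^sup>2 * \<theta> \<beta>) (z \<beta>) (v \<beta>) (contact m c)) = 2"
    using h by eventually_elim (auto simp: hit_def dist_commute)
  have "approx m N (\<lambda>\<beta>. drift (\<beta>\<^sup>2 * \<theta> \<beta>) (z \<beta>) (v \<beta>))
     (\<lambda>\<beta>. bounce (contact m c) (Suc c) (drift (\<beta>\<^sup>2 * \<theta> \<beta>) (z \<beta>) (v \<beta>)) (v \<beta>))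
     (adv t x u) (u \<circ> Transposition.transpose c (Suc c)) (adv t y q) q"
    by (rule approx_bounce[OF ap c(1) m(2,1) touch]) (use irun_row(2) in auto)
  from irun_row.IH[OF this] h eventually_at_right_less[of 0] show ?case
  proof eventually_elim
    case (elim \<beta>)
    show ?case by (rule run_hit[of "\<beta>\<^sup>2 * \<theta> \<beta>"]) (use elim in auto)
  qed
next
  case (irun_col t e q y x u k)
  define c where "c = 2 * m + e"
  have gaps: "0 < gap m x y d + t * gap m u q d" if "Suc d < 2 * m + N" "d \<noteq> c" for d
    using irun_col(5)[of "d - 2 * m"] irun_col(6) that unfolding gap_adv[symmetric]
    by (cases "d < 2 * m") (auto simp: gap_def rows_open_def c_def)
  have c: "Suc c < 2 * m + N" "gap m u q c < 0" "gap m x y c + t * gap m u q c = 0"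
    using irun_col m unfolding gap_adv[symmetric] by (auto simp: gap_def c_def)
  obtain \<theta> where ap: "approx m N (\<lambda>\<beta>. drift (\<beta>\<^sup>2 * \<theta> \<beta>) (z \<beta>) (v \<beta>)) v (adv t x u) u (adv t y q) q"
    and h: "\<forall>\<^sub>F \<beta> in at_right 0. 0 < \<theta> \<beta> \<and>
      (\<forall>s. 0 < s \<and> s < \<beta>\<^sup>2 * \<theta> \<beta> \<longrightarrow> apart (2 * m + N) (drift s (z \<beta>) (v \<beta>))) \<and>
      hit (2 * m + N) (contact m c) (Suc c) (drift (\<beta>\<^sup>2 * \<theta> \<beta>) (z \<beta>) (v \<beta>)) (v \<beta>)"
    using approx_hit[OF irun_col.prems m irun_col(1) c gaps] by blast
  have touch: "\<forall>\<^sub>F \<beta> in at_right 0. dist (drift (\<beta>\<^sup>2 * \<theta> \<beta>) (z \<beta>) (v \<beta>) (Suc c)) (drift (\<beta>\<^sup>2 * \<theta> \<beta>) (z \<beta>) (v \<beta>) (contact m c)) = 2"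
    using h by eventually_elim (auto simp: hit_def dist_commute)
  have "approx m N (\<lambda>\<beta>. drift (\<beta>\<^sup>2 * \<theta> \<beta>) (z \<beta>) (v \<beta>))
     (\<lambda>\<beta>. bounce (contact m c) (Suc c) (drift (\<beta>\<^sup>2 * \<theta> \<beta>) (z \<beta>) (v \<beta>)) (v \<beta>))
     (adv t x u) (\<lambda>i. u i - (if e = 0 then side m i * (q 1 - q 0) else 0))
     (adv t y q) (q \<circ> Transposition.transpose e (Suc e))"
    by (rule approx_bounce[OF ap c(1) m(2,1) touch]) (auto simp: c_def)
  from irun_col.IH[OF this] h eventually_at_right_less[of 0] show ?case
  proof eventually_elim
    case (elim \<beta>)
    show ?case by (rule run_hit[of "\<beta>\<^sup>2 * \<theta> \<beta>"]) (use elim in auto)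
  qed
qed

section \<open>Initial data and their past\<close>

text \<open>Initially every pair is approaching at distance more than 2, so going back in time all
  distances increase.\<close>

lemma approx_past:
  assumes ap: "approx m N z v x u y q" and m: "0 < m" "0 < N"
    and gaps: "\<And>c. Suc c < 2 * m + N \<Longrightarrow> 0 < gap m x y c"
    and P: "\<And>i j. i < j \<Longrightarrow> j \<le> 2 * m \<Longrightarrow> xvel m u q j < xvel m u q i"
    and q: "strict_mono q" "0 < q 0"
  shows "\<forall>\<^sub>F \<beta> in at_right 0. \<forall>s\<le>0. apart (2 * m + N) (drift s (z \<beta>) (v \<beta>))"
proof -
  have pair: "\<forall>\<^sub>F \<beta> in at_right 0. \<forall>s\<le>0. 2 < norm ((z \<beta> j - z \<beta> i) + s *\<^sub>R (v \<beta> j - v \<beta> i))"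
    if ij: "i < j" "j < 2 * m + N" for i j
  proof -
    have "\<forall>\<^sub>F \<beta> in at_right 0. (z \<beta> j - z \<beta> i) \<bullet> (v \<beta> j - v \<beta> i) < 0"
    proof (cases "j \<le> 2 * m")
      case True
      have "2 * (real j - real i) * (xvel m u q j - xvel m u q i) < 0"
        using P[OF ij(1) True] ij by (intro mult_pos_neg) auto
      moreover have "(Im (offset m j) - Im (offset m i)) * (yvel m q j - yvel m q i) \<le> 0"
        using True ij q by (auto simp: offset_def yvel_def)
      ultimately have "2 * (real j - real i) * (xvel m u q j - xvel m u q i) +
          (Im (offset m j) - Im (offset m i)) * (yvel m q j - yvel m q i) < 0" by linarith
      from order_tendstoD(2)[OF approx_inner_row[OF ap _ True m(2)] this]
      have "\<forall>\<^sub>F \<beta> in at_right 0. (z \<beta> j - z \<beta> i) \<bullet> (v \<beta> j - v \<beta> i) / \<beta> < 0" using ij True by simp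
      then show ?thesis
        using eventually_at_right_less[of 0] by eventually_elim (simp add: divide_less_0_iff)
    next
      case False
      have "q (i - 2 * m) < q (j - 2 * m)" "q 0 < q (j - 2 * m)"
        using strict_monoD[OF q(1), of "i - 2 * m" "j - 2 * m"] strict_monoD[OF q(1), of 0 "j - 2 * m"] ij False
        by auto
      then have "yvel m q i < yvel m q j" using False ij q(2) by (auto simp: yvel_def)
      moreover have "Im (site m j) < Im (site m i)" using False ij by (auto simp: site_def)
      ultimately have "(Im (site m j) - Im (site m i)) * (yvel m q j - yvel m q i) < 0"
        by (intro mult_neg_pos) auto
      from order_tendstoD(2)[OF approx_inner[OF ap _ ij(2)] this] show ?thesis using ij by simp
    qed
    moreover have "\<forall>\<^sub>F \<beta> in at_right 0. 2 < norm (z \<beta> j - z \<beta> i)"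
      by (rule approx_separated(2)[OF ap m(1) ij]) (rule gaps)
    ultimately show ?thesis by eventually_elim (auto intro: recede_past)
  qed
  have "\<forall>\<^sub>F \<beta> in at_right 0. \<forall>j<2 * m + N. \<forall>i<j. \<forall>s\<le>0. 2 < norm ((z \<beta> j - z \<beta> i) + s *\<^sub>R (v \<beta> j - v \<beta> i))"
    by (rule eventually_pairs) (rule pair)
  then show ?thesis by eventually_elim (auto intro!: apartI simp: dist_norm drift_diff)
qed

lemma sqrt_near_two:
  assumes "((\<lambda>\<beta>. h \<beta> / \<beta>) \<longlongrightarrow> 0) (at_right 0)"
  shows "((\<lambda>\<beta>. (sqrt (4 + h \<beta>) - 2) / \<beta>) \<longlongrightarrow> 0) (at_right 0)" "\<forall>\<^sub>F \<beta> in at_right 0. 0 \<le> 4 + h \<beta>"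
proof -
  have "((\<lambda>\<beta>. \<beta> * (h \<beta> / \<beta>)) \<longlongrightarrow> 0 * 0) (at_right 0)" by (intro tendsto_intros assms)
  moreover have "\<forall>\<^sub>F \<beta> in at_right 0. \<beta> * (h \<beta> / \<beta>) = h \<beta>"
    using eventually_at_right_less[of "0::real"] by eventually_elim simp
  ultimately have h: "(h \<longlongrightarrow> 0) (at_right 0)" by (simp add: tendsto_cong)
  have "\<forall>\<^sub>F \<beta> in at_right 0. - 4 < h \<beta>" using h by (rule order_tendstoD) simp
  then show ge: "\<forall>\<^sub>F \<beta> in at_right 0. 0 \<le> 4 + h \<beta>" by eventually_elim simp
  have "((\<lambda>\<beta>. h \<beta> / \<beta> / (sqrt (4 + h \<beta>) + 2)) \<longlongrightarrow> 0 / (sqrt (4 + 0) + 2)) (at_right 0)"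
    by (intro tendsto_intros assms h) simp
  moreover have "\<forall>\<^sub>F \<beta> in at_right 0. h \<beta> / \<beta> / (sqrt (4 + h \<beta>) + 2) = (sqrt (4 + h \<beta>) - 2) / \<beta>"
    using ge
  proof eventually_elim
    case (elim \<beta>)
    have "sqrt (4 + h \<beta>) + 2 > 0" using elim by (simp add: add_nonneg_pos)
    moreover have "(sqrt (4 + h \<beta>) - 2) * (sqrt (4 + h \<beta>) + 2) = h \<beta>"
      using elim by (simp add: algebra_simps)
    ultimately have "sqrt (4 + h \<beta>) - 2 = h \<beta> / (sqrt (4 + h \<beta>) + 2)" by (simp add: field_simps)
    then show ?case by (simp add: mult.commute)
  qed
  ultimately show "((\<lambda>\<beta>. (sqrt (4 + h \<beta>) - 2) / \<beta>) \<longlongrightarrow> 0) (at_right 0)" by (simp add: tendsto_cong)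
qed

lemma initial_approx:
  assumes "0 < N" and gaps: "\<And>c. Suc c < 2 * m + N \<Longrightarrow> 0 < gap m x y c"
  shows "\<exists>z v. approx m N z v x u y q"
proof -
  \<comment> \<open>The horizontal spacing is the square root of \<open>4 + hr c \<beta>\<close>. At
    the contacts of \<open>W\<close> the vertical offset \<open>2 * \<beta>\<close> contributes
    \<open>4 * \<beta>^2\<close> to the squared distance, which is subtracted here so that the
    clearances equal the prescribed gaps exactly.\<close>
  define hr where "hr c \<beta> = 4 * \<beta> ^ 3 * (x (Suc c) - x c) - (if c = m \<or> Suc c = m then 4 * \<beta>\<^sup>2 else 0)" for c and \<beta> :: real
  define hc where "hc e \<beta> = 4 * \<beta>\<^sup>2 * (y e - y (Suc e))" for e and \<beta> :: real
  have l: "((\<lambda>\<beta>::real. 4 * \<beta>\<^sup>2 * (x (Suc c) - x c) - (if c = m \<or> Suc c = m then 4 else 0) * \<beta>) \<longlongrightarrow>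
      4 * 0\<^sup>2 * (x (Suc c) - x c) - (if c = m \<or> Suc c = m then 4 else 0) * 0) (at_right 0)" for c
    by (intro tendsto_intros)
  have e: "\<forall>\<^sub>F \<beta>::real in at_right 0. 4 * \<beta>\<^sup>2 * (x (Suc c) - x c) - (if c = m \<or> Suc c = m then 4 else 0) * \<beta> = hr c \<beta> / \<beta>" for c
    using eventually_at_right_less[of "0::real"]
    by eventually_elim (simp add: hr_def field_simps power2_eq_square power3_eq_cube)
  have hr: "((\<lambda>\<beta>. hr c \<beta> / \<beta>) \<longlongrightarrow> 0) (at_right 0)" for c
    using Lim_transform_eventually[OF l[of c] e[of c]] by simp
  have l: "((\<lambda>\<beta>::real. 4 * \<beta> * (y e - y (Suc e))) \<longlongrightarrow> 4 * 0 * (y e - y (Suc e))) (at_right 0)" for e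
    by (intro tendsto_intros)
  have e: "\<forall>\<^sub>F \<beta>::real in at_right 0. 4 * \<beta> * (y e - y (Suc e)) = hc e \<beta> / \<beta>" for e
    using eventually_at_right_less[of "0::real"]
    by eventually_elim (simp add: hc_def field_simps power2_eq_square)
  have hc: "((\<lambda>\<beta>. hc c \<beta> / \<beta>) \<longlongrightarrow> 0) (at_right 0)" for c
    using Lim_transform_eventually[OF l[of c] e[of c]] by simp
  \<comment> \<open>The second sum places \<open>W\<close> at horizontal coordinate 0, above the
    column.\<close>
  define X where "X b \<beta> = (\<Sum>c<b. sqrt (4 + hr c \<beta>)) - (\<Sum>c<m. sqrt (4 + hr c \<beta>))" for b \<beta>
  define Y where "Y e \<beta> = - 2 * \<beta> - (\<Sum>f<e. sqrt (4 + hc f \<beta>))" for e \<beta>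
  define z where "z \<beta> b = (if b \<le> 2 * m then Complex (X b \<beta>) (if b = m then Y 0 \<beta> else 0) else Complex 0 (Y (b - 2 * m) \<beta>))" for \<beta> b
  define v where "v \<beta> b = Complex (\<beta> * xvel m u q b) (yvel m q b)" for \<beta> :: real and b
  have sums: "((\<lambda>\<beta>. (\<Sum>c<b. (sqrt (4 + h c \<beta>) - 2) / \<beta>)) \<longlongrightarrow> 0) (at_right 0)"
    if "\<And>c. ((\<lambda>\<beta>. h c \<beta> / \<beta>) \<longlongrightarrow> 0) (at_right 0)" for h b
    using tendsto_sum[of "{..<b}", OF sqrt_near_two(1)[OF that]] by simp
  have X: "((\<lambda>\<beta>. (X b \<beta> - 2 * (real b - real m)) / \<beta>) \<longlongrightarrow> 0) (at_right 0)" for b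
  proof -
    have "((\<lambda>\<beta>. (\<Sum>c<b. (sqrt (4 + hr c \<beta>) - 2) / \<beta>) - (\<Sum>c<m. (sqrt (4 + hr c \<beta>) - 2) / \<beta>)) \<longlongrightarrow> 0 - 0) (at_right 0)"
      by (intro tendsto_diff sums hr)
    moreover have "(X b \<beta> - 2 * (real b - real m)) / \<beta> =
        (\<Sum>c<b. (sqrt (4 + hr c \<beta>) - 2) / \<beta>) - (\<Sum>c<m. (sqrt (4 + hr c \<beta>) - 2) / \<beta>)" for \<beta>
      by (simp add: X_def sum_subtractf diff_divide_distrib right_diff_distrib mult.commute flip: sum_divide_distrib)
    ultimately show ?thesis by simp
  qed
  have Y: "((\<lambda>\<beta>. (Y e \<beta> + 2 * real e) / \<beta>) \<longlongrightarrow> - 2) (at_right 0)" for e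
  proof -
    have "\<forall>\<^sub>F \<beta> in at_right 0. - 2 - (\<Sum>f<e. (sqrt (4 + hc f \<beta>) - 2) / \<beta>) = (Y e \<beta> + 2 * real e) / \<beta>"
      using eventually_at_right_less[of "0::real"]
      by eventually_elim
        (simp add: Y_def sum_subtractf diff_divide_distrib add_divide_distrib flip: sum_divide_distrib)
    moreover have "((\<lambda>\<beta>. - 2 - (\<Sum>f<e. (sqrt (4 + hc f \<beta>) - 2) / \<beta>)) \<longlongrightarrow> - 2 - 0) (at_right 0)"
      by (intro tendsto_intros sums hc)
    ultimately show ?thesis by (simp add: tendsto_cong)
  qed
  have "approx m N z v x u y q"
    unfolding approx_def
  proof (intro conjI allI impI)
    fix b assume b: "b < 2 * m + N"
    have "((\<lambda>\<beta>. Re ((z \<beta> b - site m b) /\<^sub>R \<beta>)) \<longlongrightarrow> Re (offset m b)) (at_right 0)"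
      using X[of b] by (cases "b \<le> 2 * m"; cases "b = m") (simp_all add: z_def site_def offset_def divide_inverse_commute)
    moreover have "((\<lambda>\<beta>. Im ((z \<beta> b - site m b) /\<^sub>R \<beta>)) \<longlongrightarrow> Im (offset m b)) (at_right 0)"
      using Y[of "b - 2 * m"] Y[of 0]
      by (cases "b \<le> 2 * m"; cases "b = m")
        (simp_all add: z_def site_def offset_def divide_inverse_commute algebra_simps)
    ultimately show "((\<lambda>\<beta>. (z \<beta> b - site m b) /\<^sub>R \<beta>) \<longlongrightarrow> offset m b) (at_right 0)" by (simp add: tendsto_complex_iff)
    show "((\<lambda>\<beta>. Im (v \<beta> b)) \<longlongrightarrow> yvel m q b) (at_right 0)" by (simp add: v_def)
    have "\<forall>\<^sub>F \<beta> in at_right 0. xvel m u q b = Re (v \<beta> b) / \<beta>"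
      using eventually_at_right_less[of "0::real"] by eventually_elim (simp add: v_def)
    then show "((\<lambda>\<beta>. Re (v \<beta> b) / \<beta>) \<longlongrightarrow> xvel m u q b) (at_right 0)"
      by (rule Lim_transform_eventually[OF tendsto_const])
  next
    fix c assume c: "Suc c < 2 * m + N"
    have ev: "\<forall>\<^sub>F \<beta> in at_right 0. clearance m c \<beta> (z \<beta>) = gap m x y c"
      using sqrt_near_two(2)[OF hr[of c]] sqrt_near_two(2)[OF hc[of "c - 2 * m"]] eventually_at_right_less[of "0::real"]
    proof eventually_elim
      case (elim \<beta>)
      show ?case
      proof (cases "c < 2 * m")
        case True
        have "(norm (z \<beta> (Suc c) - z \<beta> c))\<^sup>2 = (sqrt (4 + hr c \<beta>))\<^sup>2 + (if c = m \<or> Suc c = m then 4 * \<beta>\<^sup>2 else 0)"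
          using True unfolding cmod_power2 by (auto simp: z_def X_def Y_def power_mult_distrib)
        also have "\<dots> = 4 + 4 * \<beta> ^ 3 * (x (Suc c) - x c)" using elim(1) by (simp add: hr_def)
        finally show ?thesis using True elim(3)
          by (simp add: clearance_def contact_def gap_def scale_def power2_eq_square power3_eq_cube)
      next
        case False
        define e where "e = c - 2 * m"
        have "c = 2 * m + e" using False by (simp add: e_def)
        then have "(norm (z \<beta> (Suc c) - z \<beta> (contact m c)))\<^sup>2 = (sqrt (4 + hc e \<beta>))\<^sup>2"
          unfolding cmod_power2 by (auto simp: z_def contact_def X_def Y_def)
        also have "\<dots> = 4 + 4 * \<beta>\<^sup>2 * (y e - y (Suc e))" using elim(2) by (simp add: hc_def e_def)
        finally show ?thesis using False elim(3)
          by (simp add: clearance_def gap_def scale_def e_def)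
      qed
    qed
    then have ev': "\<forall>\<^sub>F \<beta> in at_right 0. gap m x y c = clearance m c \<beta> (z \<beta>)" by eventually_elim simp
    show "((\<lambda>\<beta>. clearance m c \<beta> (z \<beta>)) \<longlongrightarrow> gap m x y c) (at_right 0)"
      by (rule Lim_transform_eventually[OF tendsto_const ev'])
    show "\<forall>\<^sub>F \<beta> in at_right 0. 0 \<le> clearance m c \<beta> (z \<beta>)"
      using ev by eventually_elim (use gaps[OF c] in simp)
  qed
  then show ?thesis by blast
qed

section \<open>Assembly in the plane and embedding into higher dimensions\<close>

lemma planar_run:
  assumes m: "0 < m" "0 < N"
  shows "\<exists>z v :: nat \<Rightarrow> complex. run (2 * m + N) (m * (2 * m + 1) + (\<Sum>l=1..<N. l + (m * m + 2 * m))) z v \<and>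
    (\<forall>t\<le>0. apart (2 * m + N) (drift t z v))"
proof -
  let ?u = "\<lambda>i. start m i - side m i" and ?k = "m * (2 * m + 1) + (\<Sum>l=1..<N. l + (m * m + 2 * m))"
  obtain x y where x: "\<forall>i. x i < x (Suc i)" and y: "cols_open N y" and r: "irun m N ?k x ?u y speed"
    using ideal_run[OF m] by blast
  have "rows_open m x" using x by (simp add: rows_open_def)
  then have gaps: "0 < gap m x y c" if "Suc c < 2 * m + N" for c
    using open_iff_gap[OF m(2), of m x y] y that by blast
  obtain z v where ap: "approx m N z v x ?u y speed" using initial_approx[OF m(2) gaps] by blast
  \<comment> \<open>As \<open>speed 0 = 1\<close>, the initial horizontal velocities are just
    \<open>start\<close>, which decreases along the row.\<close>
  have P: "xvel m ?u speed j < xvel m ?u speed i" if "i < j" "j \<le> 2 * m" for i j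
    using start_less[OF that(1) m(1)] that by (simp add: xvel_def speed_def)
  have "\<forall>\<^sub>F \<beta> in at_right 0. \<forall>s\<le>0. apart (2 * m + N) (drift s (z \<beta>) (v \<beta>))"
    by (rule approx_past[OF ap m gaps P]) (auto simp: strict_mono_def)
  with irun_run[OF r m ap]
  have "\<forall>\<^sub>F \<beta> in at_right 0. run (2 * m + N) ?k (z \<beta>) (v \<beta>) \<and> (\<forall>s\<le>0. apart (2 * m + N) (drift s (z \<beta>) (v \<beta>)))"
    by eventually_elim blast
  then show ?thesis using eventually_happens[of _ "at_right (0::real)"] trivial_limit_at_right_real by blast
qed

lemma plane_embedding:
  assumes "2 \<le> CARD('d::finite)"
  shows "\<exists>f :: complex \<Rightarrow> real ^ 'd. linear f \<and> (\<forall>x y. f x \<bullet> f y = x \<bullet> y)"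
proof -
  have "\<not> is_singleton (UNIV :: 'd set)" using assms by (auto simp: is_singleton_altdef)
  then obtain a b :: 'd where "a \<noteq> b" by (metis UNIV_I UNIV_not_empty is_singletonI')
  let ?f = "\<lambda>z. Re z *\<^sub>R axis a 1 + Im z *\<^sub>R axis b 1 :: real ^ 'd"
  have "linear ?f" by (rule linearI) (simp_all add: algebra_simps)
  moreover have "?f x \<bullet> ?f y = x \<bullet> y" for x y
    using \<open>a \<noteq> b\<close> by (simp add: inner_add_left inner_add_right inner_axis_axis inner_complex_def)
  ultimately show ?thesis by blast
qed

text \<open>The two sides differ by exactly \<open>m * N\<close>: the construction makes more
  collisions than required.\<close>

lemma f_bound_le:
  assumes "3 \<le> n" and m: "m = n div 3" and N: "N = n - 2 * m"
  shows "f_bound n \<le> m * (2 * m + 1) + (\<Sum>l=1..<N. l + (m * m + 2 * m))"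
proof -
  have "0 < N" "0 < m" using assms by auto
  \<comment> \<open>Successor forms eliminate the truncated subtractions \<open>N - 1\<close> and
    \<open>m - 1\<close>.\<close>
  then obtain p k where p: "N = Suc p" and k: "m = Suc k" by (metis gr0_implies_Suc)
  have S: "(\<Sum>l=1..<Suc p. l + (m * m + 2 * m)) = Suc p * p div 2 + p * (m * m + 2 * m)"
  proof -
    have "(\<Sum>l=1..<Suc p. l) = \<Sum>{1..p}" by (simp add: atLeastLessThanSuc_atLeastAtMost)
    also have "\<dots> = Suc p * p div 2" by (simp add: Sum_Icc_nat mult.commute)
    finally show ?thesis by (simp add: sum.distrib)
  qed
  have "f_bound n = m * (m + 1) * N + N * (N - 1) div 2 + m * (m - 1)"
    unfolding f_bound_def Let_def m[symmetric] N[symmetric] ..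
  then show ?thesis unfolding p S unfolding k by (simp add: algebra_simps)
qed

theorem theorem1p1:
  fixes n :: nat
  assumes "n \<ge> 3" and "CARD('d::finite) \<ge> 2"
  shows "K TYPE(real ^ 'd) n \<ge> enat (f_bound n)"
proof -
  define m N where "m = n div 3" and "N = n - 2 * m"
  have m: "0 < m" "0 < N" "2 * m + N = n" using assms(1) by (auto simp: m_def N_def)
  let ?k = "m * (2 * m + 1) + (\<Sum>l=1..<N. l + (m * m + 2 * m))"
  obtain z v :: "nat \<Rightarrow> complex" where zv: "run n ?k z v" "\<And>t. t \<le> 0 \<Longrightarrow> apart n (drift t z v)"
    using planar_run[OF m(1,2)] m(3) by metis
  obtain f :: "complex \<Rightarrow> real ^ 'd" where f: "linear f" "\<And>x y. f x \<bullet> f y = x \<bullet> y"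
    using plane_embedding[OF assms(2)] by blast
  have iso: "dist (f x) (f y) = dist x y" for x y
    by (simp add: dist_norm norm_eq_sqrt_inner f(2) flip: linear_diff[OF f(1)])
  have "enat ?k \<le> K TYPE(real ^ 'd) n"
  proof (rule run_K)
    show "run n ?k (\<lambda>i. f (z i)) (\<lambda>i. f (v i))" by (rule run_isometry[OF f zv(1)])
    have "drift t (\<lambda>i. f (z i)) (\<lambda>i. f (v i)) = (\<lambda>i. f (drift t z v i))" for t
      by (simp add: drift_def linear_add[OF f(1)] linear_scale[OF f(1)])
    then show "apart n (drift t (\<lambda>i. f (z i)) (\<lambda>i. f (v i)))" if "t \<le> 0" for t
      using zv(2)[OF that] by (simp add: apart_isometry[OF iso])
  qed
  moreover have "f_bound n \<le> ?k" by (rule f_bound_le[OF assms(1) m_def N_def])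
  ultimately show ?thesis by (meson enat_ord_simps(1) order_trans)
qed

end
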